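(* Let $n=2m\ge 4$ be an even integer, let $B_1\subset\mathbb{R}^n$ be the open unit ball and let $K\in L^\infty(B_1)$ be nonnegative. Let $u\in C^{2m}(B_1\setminus\{0\})$ be a solution of \[ (-\Delta)^{m}u=K(x)e^{u}\quad\text{in }B_1\setminus\{0\} \] satisfying \[ \int_{B_1\setminus\{0\}}e^{u(x)}\,dx<+\infty \quad\text{and}\quad \int_{B_r\setminus\{0\}}|u(x)|\,dx=o\big(r^{2m-2}\big)\ \text{ as } r\to0 . \] Then there exist a constant $\alpha>-2m$, a radius $\rho\in(0,1)$, an exponent $\gamma\in(0,1)$ and a function $\varphi\in C^{\gamma}(B_\rho)$ such that \[ u(x)=\alpha\ln|x|+\varphi(x)\quad\text{for all }x\in B_\rho\setminus\{0\}. \]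
   Context: $B_r$ denotes the open ball of radius $r$ centered at the origin in $\mathbb{R}^n$; the equation holds pointwise. *)

theory Defs
  imports "HOL-Analysis.Analysis"
begin

definition pderiv_dir :: "'a::euclidean_space \<Rightarrow> ('a \<Rightarrow> real) \<Rightarrow> 'a \<Rightarrow> real" where
  "pderiv_dir i f x = deriv (\<lambda>t. f (x + t *\<^sub>R i)) 0"

definition laplacian :: "('a::euclidean_space \<Rightarrow> real) \<Rightarrow> 'a \<Rightarrow> real" where
  "laplacian f x = (\<Sum>i\<in>Basis. pderiv_dir i (pderiv_dir i f) x)"

definition neg_lap_pow :: "nat \<Rightarrow> ('a::euclidean_space \<Rightarrow> real) \<Rightarrow> 'a \<Rightarrow> real" where
  "neg_lap_pow m f x = (-1) ^ m * (laplacian ^^ m) f x"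

fun Ck_on :: "nat \<Rightarrow> 'a::euclidean_space set \<Rightarrow> ('a \<Rightarrow> real) \<Rightarrow> bool" where
  "Ck_on 0 S f = continuous_on S f"
| "Ck_on (Suc k) S f = (continuous_on S f \<and> f differentiable_on S \<and>
      (\<forall>i\<in>Basis. Ck_on k S (pderiv_dir i f)))"

definition holder_on :: "real \<Rightarrow> 'a::metric_space set \<Rightarrow> ('a \<Rightarrow> real) \<Rightarrow> bool" where
  "holder_on \<gamma> S f \<longleftrightarrow> bounded (f ` S) \<and>
     (\<exists>C. \<forall>x\<in>S. \<forall>y\<in>S. \<bar>f x - f y\<bar> \<le> C * dist x y powr \<gamma>)"

end

theory Submission
  imports Defs "HOL-Computational_Algebra.Polynomial"
begin

text \<open>
  Write \<open>n = 2 m\<close> and \<open>f = (-\<Delta>)\<^sup>m u \<ge> 0\<close>. Because \<open>\<integral> |u|\<close> over \<open>B\<^sub>r\<close> is \<open>o(r\<^sup>n\<^sup>-\<^sup>2)\<close>, the equation may be tested with any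
  \<open>C\<^sup>2\<^sup>m\<close> function of compact support that vanishes to second order at the origin. Testing with
  \<open>(1 - |y - x|\<^sup>2 / s)\<^sub>+\<^sup>N\<close>, corrected to vanish to second order at \<open>0\<close>, gives the \<open>s\<close>-derivative of a mollification of \<open>u\<close>
  at \<open>x\<close>; integrating over \<open>0 < s < T\<close> yields
  \<open>u(x) = \<alpha> ln |x| + B \<bullet> x / |x|\<^sup>2 + h(x) + v(x)\<close> near \<open>0\<close>, up to a smooth cutoff of the second term, with \<open>h\<close> Lipschitz
  and \<open>v \<ge> 0\<close> a truncated logarithmic potential of \<open>f\<close>. As \<open>v \<ge> 0\<close> and \<open>exp u\<close> is integrable, \<open>B = 0\<close> and \<open>\<alpha> > -n\<close>.
  Finally \<open>f \<le> C |x|\<^sup>\<alpha> exp v\<close>, and Jensen's inequality bounds \<open>exp v\<close> near \<open>0\<close> by an average of \<open>|y - w|\<^sup>-\<^sup>\<epsilon>\<close>,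
  so \<open>\<integral> |x - y|\<^sup>-\<^sup>\<gamma> f(y) dy\<close> is bounded near \<open>0\<close> for a small \<open>\<gamma> > 0\<close>, which makes \<open>v\<close> Hoelder continuous.
\<close>

subsection \<open>Iterated partial derivatives\<close>

text \<open>No fundamental solution, distribution theory or elliptic regularity enters: the formula
  for u is derived separately at each point x. The profile is a polynomial in the truncated
  variable, so iterated Laplacians of it are polynomial algebra; even dimension keeps the scaling
  factors integer powers s^m and the moments quotients of factorials. N = 2 m + 1 is the least
  exponent making the truncated power C^(2m). The obstacle is the origin. A cutoff at scale \<delta>
  costs \<delta>^(-2m), a second order zero of the test function returns \<delta>^2, and
  o(\<delta>^(2m-2)) closes the balance exactly. An unknown combination of the Dirac mass at 0 and
  its first derivatives therefore survives, with coefficients independent of x and s; integrated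
  against ds/s it gives the terms with \<alpha> and B. The mass c of the mollifier is not
  normalised; it is shown to have the sign (-1)^m, so dividing the m-th Laplacian power of u by c
  gives a nonnegative density. The last step is circular, since the bound on this density involves
  its own potential. The circle is broken by the small mass near 0, which makes the exponent
  produced by Jensen's inequality small.\<close>

lemma has_real_derivative_along:
  fixes f :: "'a::euclidean_space \<Rightarrow> real"
  assumes "(f has_derivative f') (at (x + t *\<^sub>R i))"
  shows "((\<lambda>t. f (x + t *\<^sub>R i)) has_real_derivative f' i) (at t)"
proof -
  interpret bounded_linear f' using assms by (rule has_derivative_bounded_linear)
  have "((\<lambda>t. f (x + t *\<^sub>R i)) has_derivative (\<lambda>t. f' (t *\<^sub>R i))) (at t)"
    by (rule has_derivative_compose[of "\<lambda>t. x + t *\<^sub>R i" "\<lambda>t. t *\<^sub>R i" t UNIV f f', OF _ assms])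
       (auto intro!: derivative_eq_intros)
  moreover have "(\<lambda>t. f' (t *\<^sub>R i)) = (*) (f' i)" by (auto simp: scaleR)
  ultimately show ?thesis by (simp add: has_field_derivative_def)
qed

lemma pderiv_dir_eq:
  assumes "(f has_derivative f') (at x)"
  shows "pderiv_dir i f x = f' i"
  unfolding pderiv_dir_def using has_real_derivative_along[of f f' x 0] assms by (intro DERIV_imp_deriv) simp

lemma pderiv_dir_DERIV_at:
  assumes "f differentiable (at (x + t *\<^sub>R i))"
  shows "((\<lambda>t. f (x + t *\<^sub>R i)) has_real_derivative pderiv_dir i f (x + t *\<^sub>R i)) (at t)"
  using assms has_real_derivative_along pderiv_dir_eq unfolding differentiable_def by metis

lemma pderiv_dir_DERIV:
  assumes "f differentiable (at x)"
  shows "((\<lambda>t. f (x + t *\<^sub>R i)) has_real_derivative pderiv_dir i f x) (at 0)"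
  using pderiv_dir_DERIV_at[of f x 0] assms by simp

lemma pderiv_dir_cong:
  fixes x :: "'a::euclidean_space"
  assumes "open S" "x \<in> S" "\<And>y. y \<in> S \<Longrightarrow> f y = g y"
  shows "pderiv_dir i f x = pderiv_dir i g x"
proof -
  have "((\<lambda>t::real. x + t *\<^sub>R i) \<longlongrightarrow> x + 0 *\<^sub>R i) (nhds 0)"
    by (intro tendsto_intros filterlim_ident)
  then have "eventually (\<lambda>t. x + t *\<^sub>R i \<in> S) (nhds (0::real))"
    using assms(1,2) by (auto intro: topological_tendstoD)
  then have "eventually (\<lambda>t. f (x + t *\<^sub>R i) = g (x + t *\<^sub>R i)) (nhds 0)"
    by (rule eventually_mono) (rule assms(3))
  then show ?thesis unfolding pderiv_dir_def by (intro deriv_cong_ev) auto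
qed

lemma differentiable_on_cong:
  assumes "\<And>y. y \<in> S \<Longrightarrow> f y = g y" "f differentiable_on S"
  shows "g differentiable_on S"
  using assms unfolding differentiable_on_def differentiable_def
  by (metis has_derivative_transform)

lemma Ck_on_cong:
  assumes "open S" "\<And>y. y \<in> S \<Longrightarrow> f y = g y" "Ck_on k S f"
  shows "Ck_on k S g"
  using assms(2,3)
proof (induction k arbitrary: f g)
  case 0
  then show ?case using continuous_on_cong by fastforce
next
  case (Suc k)
  have "continuous_on S g" using Suc.prems continuous_on_cong by fastforce
  moreover have "g differentiable_on S" using Suc.prems differentiable_on_cong by auto
  moreover have "Ck_on k S (pderiv_dir i g)" if "i \<in> Basis" for i
    using Suc.IH[of "pderiv_dir i f" "pderiv_dir i g"] Suc.prems that pderiv_dir_cong[OF \<open>open S\<close>, of _ f g]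
    by auto
  ultimately show ?case by simp
qed

lemma Ck_on_continuous: "Ck_on k S f \<Longrightarrow> continuous_on S f"
  by (cases k) auto

lemma Ck_on_SucD: "Ck_on (Suc k) S f \<Longrightarrow> Ck_on k S f"
  by (induction k arbitrary: f) auto

lemma Ck_on_le: "Ck_on k S f \<Longrightarrow> j \<le> k \<Longrightarrow> Ck_on j S f"
  by (induction k) (auto simp: le_Suc_eq dest: Ck_on_SucD simp del: Ck_on.simps)

lemma Ck_on_subset: "Ck_on k S f \<Longrightarrow> T \<subseteq> S \<Longrightarrow> Ck_on k T f"
  by (induction k arbitrary: f) (auto intro: continuous_on_subset differentiable_on_subset)

lemma Ck_on_Suc_differentiable:
  "Ck_on (Suc k) S f \<Longrightarrow> open S \<Longrightarrow> x \<in> S \<Longrightarrow> f differentiable (at x)"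
  by (auto simp: differentiable_on_eq_differentiable_at)

lemma Ck_on_Suc_I:
  fixes f :: "'a::euclidean_space \<Rightarrow> real"
  assumes "open S" "\<And>x. x \<in> S \<Longrightarrow> (f has_derivative f' x) (at x)"
    "\<And>i. i \<in> Basis \<Longrightarrow> Ck_on k S (\<lambda>x. f' x i)"
  shows "Ck_on (Suc k) S f"
proof -
  have d: "f differentiable_on S"
    using assms(2) unfolding differentiable_on_def differentiable_def
    by (meson has_derivative_at_withinI)
  have "Ck_on k S (pderiv_dir i f)" if "i \<in> Basis" for i
    by (rule Ck_on_cong[OF assms(1) _ assms(3)[OF that]]) (simp add: pderiv_dir_eq[OF assms(2)])
  with d show ?thesis by (auto intro: differentiable_imp_continuous_on)
qed

text \<open>Serves to extend by zero: a function of class C^k on an open set that vanishes off a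
  compact subset is glued to the zero function on the complement of that subset.\<close>

lemma Ck_on_Un:
  fixes f :: "'a::euclidean_space \<Rightarrow> real"
  assumes "open S" "open T" "Ck_on k S f" "Ck_on k T f"
  shows "Ck_on k (S \<union> T) f"
  using assms(3,4)
proof (induction k arbitrary: f)
  case 0
  then show ?case using assms(1,2) continuous_on_open_Un by auto
next
  case (Suc k)
  then show ?case using assms(1,2) continuous_on_open_Un[of S T f]
    by (auto simp: differentiable_on_eq_differentiable_at open_Un)
qed

lemma pderiv_dir_add:
  assumes "f differentiable (at x)" "g differentiable (at x)"
  shows "pderiv_dir i (\<lambda>y. f y + g y) x = pderiv_dir i f x + pderiv_dir i g x"
  unfolding pderiv_dir_def[of i "\<lambda>y. f y + g y"]
  by (rule DERIV_imp_deriv) (intro DERIV_add pderiv_dir_DERIV assms)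

lemma pderiv_dir_mult:
  assumes "f differentiable (at x)" "g differentiable (at x)"
  shows "pderiv_dir i (\<lambda>y. f y * g y) x = pderiv_dir i f x * g x + f x * pderiv_dir i g x"
  unfolding pderiv_dir_def[of i "\<lambda>y. f y * g y"]
  using DERIV_mult[OF pderiv_dir_DERIV[OF assms(1)] pderiv_dir_DERIV[OF assms(2)], of i i]
  by (intro DERIV_imp_deriv) (simp add: algebra_simps)

lemma pderiv_dir_const: "pderiv_dir i (\<lambda>y. c) x = 0"
  by (simp add: pderiv_dir_def)

lemma pderiv_dir_cmult:
  assumes "f differentiable (at x)"
  shows "pderiv_dir i (\<lambda>y. c * f y) x = c * pderiv_dir i f x"
  using pderiv_dir_mult[of "\<lambda>_. c", OF _ assms] by (simp add: pderiv_dir_const)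

lemma pderiv_dir_sum:
  assumes "finite A" "\<And>a. a \<in> A \<Longrightarrow> f a differentiable (at x)"
  shows "pderiv_dir i (\<lambda>y. \<Sum>a\<in>A. f a y) x = (\<Sum>a\<in>A. pderiv_dir i (f a) x)"
  unfolding pderiv_dir_def[of i "\<lambda>y. \<Sum>a\<in>A. f a y"]
  by (rule DERIV_imp_deriv) (intro DERIV_sum pderiv_dir_DERIV assms)

lemma Ck_on_const: "Ck_on k S (\<lambda>y. c)"
proof (induction k arbitrary: c)
  case (Suc k)
  have "pderiv_dir i (\<lambda>y. c) = (\<lambda>y. 0)" for i :: 'a by (rule ext) (rule pderiv_dir_const)
  with Suc show ?case by simp
qed simp

lemma Ck_on_add:
  assumes "open S" "Ck_on k S f" "Ck_on k S g"
  shows "Ck_on k S (\<lambda>y. f y + g y)"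
  using assms(2,3)
proof (induction k arbitrary: f g)
  case (Suc k)
  have "Ck_on k S (pderiv_dir i (\<lambda>y. f y + g y))" if "i \<in> Basis" for i
    by (rule Ck_on_cong[OF assms(1) _ Suc.IH[of "pderiv_dir i f" "pderiv_dir i g"]])
       (use Suc.prems that assms(1) in \<open>auto intro!: pderiv_dir_add[symmetric]
          simp: differentiable_on_eq_differentiable_at\<close>)
  with Suc.prems show ?case by (simp add: continuous_on_add continuous_on_mult differentiable_on_add differentiable_on_mult)
qed (auto intro: continuous_intros)

lemma Ck_on_mult:
  assumes "open S" "Ck_on k S f" "Ck_on k S g"
  shows "Ck_on k S (\<lambda>y. f y * g y)"
  using assms(2,3)
proof (induction k arbitrary: f g)
  case (Suc k)
  have "Ck_on k S (pderiv_dir i (\<lambda>y. f y * g y))" if "i \<in> Basis" for i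
    by (rule Ck_on_cong[OF assms(1) _ Ck_on_add[OF assms(1)
            Suc.IH[of "pderiv_dir i f" g] Suc.IH[of f "pderiv_dir i g"]]])
       (use Suc.prems that assms(1) Ck_on_SucD[OF Suc.prems(1)] Ck_on_SucD[OF Suc.prems(2)]
        in \<open>auto intro!: pderiv_dir_mult[symmetric]
          simp: differentiable_on_eq_differentiable_at\<close>)
  with Suc.prems show ?case by (simp add: continuous_on_add continuous_on_mult differentiable_on_add differentiable_on_mult)
qed (auto intro: continuous_intros)

lemma Ck_on_cmult: "open S \<Longrightarrow> Ck_on k S f \<Longrightarrow> Ck_on k S (\<lambda>y. c * f y)"
  by (intro Ck_on_mult Ck_on_const)

lemma Ck_on_diff:
  assumes "open S" "Ck_on k S f" "Ck_on k S g"
  shows "Ck_on k S (\<lambda>y. f y - g y)"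
  using Ck_on_add[OF assms(1,2) Ck_on_cmult[OF assms(1,3), of "-1"]] by simp

lemma Ck_on_sum:
  assumes "open S" "finite A" "\<And>a. a \<in> A \<Longrightarrow> Ck_on k S (f a)"
  shows "Ck_on k S (\<lambda>y. \<Sum>a\<in>A. f a y)"
  using assms(2,3) by (induction A rule: finite_induct) (auto intro: Ck_on_const Ck_on_add assms(1))

lemma Ck_on_inner: 
  fixes i :: "'a::euclidean_space"
  assumes "open S" shows "Ck_on k S (\<lambda>y. y \<bullet> i)"
proof (cases k)
  case (Suc j)
  show ?thesis unfolding Suc
    by (rule Ck_on_Suc_I[OF assms, of _ "\<lambda>_ h. h \<bullet> i"]) (auto intro!: derivative_eq_intros Ck_on_const)
qed (auto intro: continuous_intros)

lemma Ck_on_norm_sq_diff: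
  fixes x :: "'a::euclidean_space"
  assumes "open S" shows "Ck_on k S (\<lambda>y. (norm (y - x))\<^sup>2)"
proof -
  have "(norm (y - x))\<^sup>2 = (\<Sum>i\<in>Basis. (y \<bullet> i + (- (x \<bullet> i))) * (y \<bullet> i + (- (x \<bullet> i))))" for y
    unfolding power2_norm_eq_inner by (subst euclidean_inner) (simp add: inner_diff_left)
  then show ?thesis
    by (simp only:) (intro Ck_on_sum Ck_on_mult Ck_on_add Ck_on_inner Ck_on_const assms finite_Basis)
qed

text \<open>The exponent is at least 2, so the corner at 0 is flat: there the difference quotient
  lies between 0 and |h|^N.\<close>

lemma has_real_derivative_pos_part_power:
  fixes t :: real
  assumes "N > 0"
  shows "((\<lambda>t. max 0 t ^ Suc N) has_real_derivative real (Suc N) * max 0 t ^ N) (at t)"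
proof -
  consider "t > 0" | "t < 0" | "t = 0" by linarith
  then show ?thesis
  proof cases
    case 1
    have "((\<lambda>t. t ^ Suc N) has_real_derivative real (Suc N) * max 0 t ^ N) (at t)"
      using DERIV_pow[of "Suc N" t] 1 by (simp add: max_def)
    then show ?thesis
      by (rule has_field_derivative_transform_within_open[where S="{0<..}"]) (use 1 in \<open>auto simp: max_def\<close>)
  next
    case 2
    have "((\<lambda>t. 0) has_real_derivative real (Suc N) * max 0 t ^ N) (at t)"
      using 2 assms by (simp add: power_0_left)
    then show ?thesis
      by (rule has_field_derivative_transform_within_open[where S="{..<0}"]) (use 2 in \<open>auto simp: max_def\<close>)
  next
    case 3
    have "((\<lambda>h::real. max 0 h ^ Suc N / h) \<longlongrightarrow> 0) (at 0)"
    proof (rule tendsto_sandwich[of "\<lambda>_. 0" _ _ "\<lambda>h::real. \<bar>h\<bar> ^ N"])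
      show "\<forall>\<^sub>F h::real in at 0. 0 \<le> max 0 h ^ Suc N / h"
        by (rule always_eventually) (auto simp: max_def)
      show "\<forall>\<^sub>F h::real in at 0. max 0 h ^ Suc N / h \<le> \<bar>h\<bar> ^ N"
        by (rule always_eventually) (auto simp: max_def)
      show "((\<lambda>h::real. \<bar>h\<bar> ^ N) \<longlongrightarrow> 0) (at 0)"
        using assms by (auto intro!: tendsto_eq_intros)
    qed simp
    then show ?thesis using 3 assms by (simp add: DERIV_def power_0_left)
  qed
qed

text \<open>Each derivative lowers the exponent by one, and exponent 1 is still continuous; hence k
  < N. All cutoffs and kernels below are built from such truncated powers, so finite smoothness is
  all that is ever available or used.\<close>

lemma Ck_on_pos_part_power:
  fixes f :: "'a::euclidean_space \<Rightarrow> real"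
  assumes "open S" "Ck_on k S f" "k < N"
  shows "Ck_on k S (\<lambda>y. max 0 (f y) ^ N)"
  using assms(2,3)
proof (induction k arbitrary: N)
  case 0
  then show ?case by (auto intro!: continuous_intros)
next
  case (Suc k)
  obtain M where N: "N = Suc M" "M > k" using Suc.prems by (cases N) auto
  have M0: "M > 0" using N by auto
  have D: "((\<lambda>y. max 0 (f y) ^ N) has_derivative (\<lambda>h. (real N * max 0 (f x) ^ M) * frechet_derivative f (at x) h)) (at x)"
    if "x \<in> S" for x
  proof -
    have "(f has_derivative frechet_derivative f (at x)) (at x)"
      using Ck_on_Suc_differentiable[OF Suc.prems(1) assms(1) that] by (simp add: frechet_derivative_works)
    moreover have "((\<lambda>t. max 0 t ^ N) has_derivative (*) (real N * max 0 (f x) ^ M)) (at (f x))"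
      using has_real_derivative_pos_part_power[OF M0, of "f x"] unfolding N has_field_derivative_def .
    ultimately show ?thesis by (rule has_derivative_compose)
  qed
  have "Ck_on k S (\<lambda>x. (real N * max 0 (f x) ^ M) * frechet_derivative f (at x) i)" if "i \<in> Basis" for i
  proof -
    have "pderiv_dir i f x = frechet_derivative f (at x) i" if "x \<in> S" for x
      using Ck_on_Suc_differentiable[OF Suc.prems(1) assms(1) that]
      by (intro pderiv_dir_eq) (simp add: frechet_derivative_works)
    with Suc.prems that have "Ck_on k S (\<lambda>x. frechet_derivative f (at x) i)"
      by (auto intro: Ck_on_cong[OF assms(1), of "pderiv_dir i f" _ k])
    then show ?thesis
      using N Suc.IH[OF Ck_on_SucD[OF Suc.prems(1)], of M] by (intro Ck_on_mult Ck_on_const assms(1)) auto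
  qed
  from Ck_on_Suc_I[OF assms(1) D this] show ?case .
qed

section \<open>Locality and linearity of iterated Laplacians\<close>

lemma laplacian_cong:
  fixes x :: "'a::euclidean_space"
  assumes "open S" "x \<in> S" "\<And>y. y \<in> S \<Longrightarrow> f y = g y"
  shows "laplacian f x = laplacian g x"
  unfolding laplacian_def
  by (intro sum.cong refl pderiv_dir_cong[OF assms(1,2)]) (rule pderiv_dir_cong[OF assms(1)], auto simp: assms(3))

lemma laplacian_pow_cong:
  fixes x :: "'a::euclidean_space"
  assumes "open S" "x \<in> S" "\<And>y. y \<in> S \<Longrightarrow> f y = g y"
  shows "(laplacian ^^ m) f x = (laplacian ^^ m) g x"
  using assms(2,3)
proof (induction m arbitrary: x)
  case (Suc m)
  show ?case unfolding funpow.simps o_def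
    by (rule laplacian_cong[OF assms(1) Suc.prems(1)]) (rule Suc.IH[OF _ Suc.prems(2)])
qed simp

lemma laplacian_zero: "laplacian (\<lambda>_. 0) = (\<lambda>_. 0)"
  unfolding laplacian_def by (auto simp: pderiv_dir_def fun_eq_iff)

lemma laplacian_pow_zero: "(laplacian ^^ m) (\<lambda>_. 0) = (\<lambda>_. 0)"
  by (induction m) (auto simp: laplacian_zero)

lemma laplacian_pow_eq_0:
  fixes x :: "'a::euclidean_space"
  assumes "open S" "x \<in> S" "\<And>y. y \<in> S \<Longrightarrow> f y = 0"
  shows "(laplacian ^^ m) f x = 0"
  using laplacian_pow_cong[OF assms(1,2), of f "\<lambda>_. 0"] assms(3) by (simp add: laplacian_pow_zero)

lemma Ck_on_laplacian:
  assumes "open S" "Ck_on (Suc (Suc k)) S f"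
  shows "Ck_on k S (laplacian f)"
  unfolding laplacian_def using assms by (auto intro!: Ck_on_sum)

lemma Ck_on_laplacian_pow:
  assumes "open S" "Ck_on (2 * m + k) S f"
  shows "Ck_on k S ((laplacian ^^ m) f)"
  using assms(2)
proof (induction m arbitrary: k)
  case (Suc m)
  show ?case using Ck_on_laplacian[OF assms(1) Suc.IH[of "Suc (Suc k)"]] Suc.prems by simp
qed simp

text \<open>\<open>deriv\<close> is a total function with no useful value where the derivative fails
  to exist, so even additivity rests on the smoothness hypotheses. The induction replaces the inner
  iterate on the open set S and differentiates twice more there.\<close>

lemma laplacian_pow_add:
  fixes x :: "'a::euclidean_space"
  assumes "open S" "Ck_on (2 * m) S f" "Ck_on (2 * m) S g" "x \<in> S"
  shows "(laplacian ^^ m) (\<lambda>y. f y + g y) x = (laplacian ^^ m) f x + (laplacian ^^ m) g x"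
  using assms(2-)
proof (induction m arbitrary: x)
  case (Suc m)
  let ?F = "(laplacian ^^ m) f" and ?G = "(laplacian ^^ m) g"
  have C: "Ck_on (Suc (Suc 0)) S ?F" "Ck_on (Suc (Suc 0)) S ?G"
    using Suc.prems by (auto intro!: Ck_on_laplacian_pow[OF assms(1)] simp del: Ck_on.simps)
  have d: "?F differentiable (at y)" "?G differentiable (at y)"
    and dd: "i \<in> Basis \<Longrightarrow> pderiv_dir i ?F differentiable (at y)" "i \<in> Basis \<Longrightarrow> pderiv_dir i ?G differentiable (at y)"
    if "y \<in> S" for y i
    using C that assms(1) by (auto simp: differentiable_on_eq_differentiable_at)
  have "laplacian ((laplacian ^^ m) (\<lambda>y. f y + g y)) x = laplacian (\<lambda>y. ?F y + ?G y) x"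
    using Suc.prems
    by (intro laplacian_cong[OF assms(1)] Suc.IH Ck_on_le[of "2 * Suc m" S _ "2 * m"]) auto
  also have "\<dots> = (\<Sum>i\<in>Basis. pderiv_dir i (\<lambda>y. pderiv_dir i ?F y + pderiv_dir i ?G y) x)"
    unfolding laplacian_def[of "\<lambda>y. ?F y + ?G y"]
    by (intro sum.cong refl pderiv_dir_cong[OF assms(1)] pderiv_dir_add d Suc.prems)
  also have "\<dots> = laplacian ?F x + laplacian ?G x"
    unfolding laplacian_def[of ?F] laplacian_def[of ?G] sum.distrib[symmetric]
    by (intro sum.cong refl pderiv_dir_add dd Suc.prems)
  finally show ?case by simp
qed simp

lemma laplacian_pow_cmult:
  fixes x :: "'a::euclidean_space"
  assumes "open S" "Ck_on (2 * m) S f" "x \<in> S"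
  shows "(laplacian ^^ m) (\<lambda>y. c * f y) x = c * (laplacian ^^ m) f x"
  using assms(2-)
proof (induction m arbitrary: x)
  case (Suc m)
  let ?F = "(laplacian ^^ m) f"
  have C: "Ck_on (Suc (Suc 0)) S ?F"
    using Suc.prems by (auto intro!: Ck_on_laplacian_pow[OF assms(1)] simp del: Ck_on.simps)
  have d: "?F differentiable (at y)"
    and dd: "i \<in> Basis \<Longrightarrow> pderiv_dir i ?F differentiable (at y)"
    if "y \<in> S" for y i
    using C that assms(1) by (auto simp: differentiable_on_eq_differentiable_at)
  have "laplacian ((laplacian ^^ m) (\<lambda>y. c * f y)) x = laplacian (\<lambda>y. c * ?F y) x"
    using Suc.prems
    by (intro laplacian_cong[OF assms(1)] Suc.IH Ck_on_le[of "2 * Suc m" S _ "2 * m"]) auto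
  also have "\<dots> = (\<Sum>i\<in>Basis. pderiv_dir i (\<lambda>y. c * pderiv_dir i ?F y) x)"
    unfolding laplacian_def[of "\<lambda>y. c * ?F y"]
    by (intro sum.cong refl pderiv_dir_cong[OF assms(1)] pderiv_dir_cmult d Suc.prems)
  also have "\<dots> = c * laplacian ?F x"
    unfolding laplacian_def[of ?F] sum_distrib_left
    by (intro sum.cong refl pderiv_dir_cmult dd Suc.prems)
  finally show ?case by simp
qed simp

lemma laplacian_pow_diff:
  fixes x :: "'a::euclidean_space"
  assumes "open S" "Ck_on (2 * m) S f" "Ck_on (2 * m) S g" "x \<in> S"
  shows "(laplacian ^^ m) (\<lambda>y. f y - g y) x = (laplacian ^^ m) f x - (laplacian ^^ m) g x"
  using laplacian_pow_add[OF assms(1,2) Ck_on_cmult[OF assms(1,3)] assms(4), of "-1"]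
    laplacian_pow_cmult[OF assms(1,3,4), of "-1"] by simp

lemma laplacian_pow_sum:
  fixes x :: "'a::euclidean_space"
  assumes "open S" "finite A" "\<And>a. a \<in> A \<Longrightarrow> Ck_on (2 * m) S (f a)" "x \<in> S"
  shows "(laplacian ^^ m) (\<lambda>y. \<Sum>a\<in>A. f a y) x = (\<Sum>a\<in>A. (laplacian ^^ m) (f a) x)"
  using assms(2,3)
proof (induction A rule: finite_induct)
  case empty
  then show ?case by (simp add: laplacian_pow_zero)
next
  case (insert a A)
  then show ?case
    using laplacian_pow_add[OF assms(1) _ Ck_on_sum[OF assms(1)] assms(4), of m "f a" A f] by simp
qed

subsection \<open>Green's formula for powers of the Laplacian\<close>

lemma pderiv_dir_diff:
  assumes "f differentiable (at x)" "g differentiable (at x)"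
  shows "pderiv_dir i (\<lambda>y. f y - g y) x = pderiv_dir i f x - pderiv_dir i g x"
  unfolding pderiv_dir_def[of i "\<lambda>y. f y - g y"]
  by (rule DERIV_imp_deriv) (intro DERIV_diff pderiv_dir_DERIV assms)

lemma integrable_compact_support:
  fixes f :: "'a::euclidean_space \<Rightarrow> real"
  assumes "continuous_on UNIV f" "\<And>y. R < norm y \<Longrightarrow> f y = 0"
  shows "integrable lborel f"
proof -
  have "integrable lborel (\<lambda>y. indicator (cball 0 R) y *\<^sub>R f y)"
    using assms(1) by (intro borel_integrable_compact) (auto intro: continuous_on_subset)
  moreover have "(\<lambda>y. indicator (cball 0 R) y *\<^sub>R f y) = f"
    using assms(2) by (auto simp: indicator_def fun_eq_iff not_le)
  ultimately show ?thesis by simp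
qed

lemma integral_lborel_translation:
  fixes f :: "'a::euclidean_space \<Rightarrow> real"
  assumes "f \<in> borel_measurable borel"
  shows "(LINT y|lborel. f (c + y)) = (LINT y|lborel. f y)"
proof -
  have "(LINT y|lborel. f y) = (LINT y|distr lborel borel ((+) c). f y)"
    by (simp add: lborel_distr_plus)
  also have "\<dots> = (LINT y|lborel. f (c + y))"
    using assms by (intro integral_distr) auto
  finally show ?thesis by simp
qed

lemma pderiv_dir_eq_0:
  fixes x :: "'a::euclidean_space"
  assumes "open S" "x \<in> S" "\<And>y. y \<in> S \<Longrightarrow> f y = 0"
  shows "pderiv_dir i f x = 0"
  using pderiv_dir_cong[OF assms(1,2), of f "\<lambda>_. 0"] assms(3) by (simp add: pderiv_dir_const)

lemma open_norm_greater: "open {y::'a::real_normed_vector. R < norm y}"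
  by (intro open_Collect_less continuous_intros)

lemma bounded_compact_support:
  fixes f :: "'a::euclidean_space \<Rightarrow> real"
  assumes "continuous_on UNIV f" "\<And>y. R < norm y \<Longrightarrow> f y = 0"
  shows "\<exists>C>0. \<forall>y. \<bar>f y\<bar> \<le> C"
proof -
  have "compact (f ` cball 0 R)"
    using assms(1) by (intro compact_continuous_image) (auto intro: continuous_on_subset)
  then obtain C where "C > 0" "\<forall>y\<in>cball 0 R. \<bar>f y\<bar> \<le> C"
    using bounded_pos[THEN iffD1, OF compact_imp_bounded] by (metis image_eqI real_norm_def)
  moreover have "\<bar>f y\<bar> \<le> C" if "y \<notin> cball 0 R" for y
    using assms(2)[of y] that \<open>C > 0\<close> by auto
  ultimately show ?thesis by (metis)
qed

text \<open>Substitute for the divergence theorem: difference quotients have integral zero because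
  Lebesgue measure is translation invariant, and they converge boundedly to the derivative by the
  mean value theorem.\<close>

lemma integral_pderiv_dir_eq_0:
  fixes f :: "'a::euclidean_space \<Rightarrow> real"
  assumes C1: "Ck_on (Suc 0) UNIV f" and supp: "\<And>y. R < norm y \<Longrightarrow> f y = 0" and i: "i \<in> Basis"
  shows "integrable lborel (pderiv_dir i f)" "(LINT y|lborel. pderiv_dir i f y) = 0"
proof -
  let ?d = "pderiv_dir i f"
  have contf: "continuous_on UNIV f" and contd: "continuous_on UNIV ?d" using C1 i by auto
  have diff: "f differentiable (at y)" for y using C1 by (auto simp: differentiable_on_eq_differentiable_at)
  have [measurable]: "f \<in> borel_measurable borel" "?d \<in> borel_measurable borel"
    using contf contd by (auto intro: borel_measurable_continuous_onI)
  have dsupp: "?d y = 0" if "R < norm y" for y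
    by (rule pderiv_dir_eq_0[OF open_norm_greater[of R]]) (use that supp in auto)
  show "integrable lborel ?d" by (rule integrable_compact_support[OF contd dsupp])
  obtain C where C: "C > 0" "\<And>y. \<bar>?d y\<bar> \<le> C" using bounded_compact_support[OF contd dsupp] by auto
  define q where "q n y = real (Suc n) * (f ((1 / real (Suc n)) *\<^sub>R i + y) - f y)" for n y
  have [measurable]: "q n \<in> borel_measurable borel" for n unfolding q_def by measurable
  have q_bound: "\<bar>q n y\<bar> \<le> C" for n y
  proof -
    let ?h = "1 / real (Suc n)"
    have "\<exists>z>0. z < ?h \<and> f (y + ?h *\<^sub>R i) - f (y + 0 *\<^sub>R i) = (?h - 0) * ?d (y + z *\<^sub>R i)"
      by (rule MVT2) (use diff pderiv_dir_DERIV_at[of f y _ i] in auto)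
    then obtain z where "f (y + ?h *\<^sub>R i) - f (y + 0 *\<^sub>R i) = (?h - 0) * ?d (y + z *\<^sub>R i)" by auto
    then have "q n y = ?d (y + z *\<^sub>R i)" by (simp add: q_def add.commute field_simps)
    then show ?thesis using C by simp
  qed
  \<comment> \<open>The increments 1 / (n + 1) are at most 1, so all quotients are supported in one
    common ball.\<close>
  have q_supp: "q n y = 0" if "y \<notin> cball 0 (R + 1)" for n y
  proof -
    have "norm y \<le> norm ((1 / real (Suc n)) *\<^sub>R i + y) + norm ((1 / real (Suc n)) *\<^sub>R i)"
      by (metis add.commute add_diff_cancel norm_triangle_ineq4)
    moreover have "norm ((1 / real (Suc n)) *\<^sub>R i) \<le> 1" using i by simp
    moreover have "R + 1 < norm y" using that by simp
    ultimately have "R < norm y" "R < norm ((1 / real (Suc n)) *\<^sub>R i + y)" by linarith+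
    then show ?thesis by (simp add: q_def supp)
  qed
  have q_lim: "(\<lambda>n. q n y) \<longlonglongrightarrow> ?d y" for y
  proof -
    have "(\<lambda>h. (f (y + h *\<^sub>R i) - f y) / h) \<midarrow>0\<rightarrow> ?d y"
      using pderiv_dir_DERIV[OF diff, of y i] by (simp add: DERIV_def)
    moreover have "filterlim (\<lambda>n. 1 / real (Suc n)) (at 0) sequentially"
      unfolding filterlim_at using LIMSEQ_inverse_real_of_nat by (auto simp: inverse_eq_divide)
    ultimately have "(\<lambda>n. (f (y + (1 / real (Suc n)) *\<^sub>R i) - f y) / (1 / real (Suc n))) \<longlonglongrightarrow> ?d y"
      by (rule filterlim_compose)
    then show ?thesis by (simp add: q_def add.commute mult.commute)
  qed
  have "(\<lambda>n. LINT y|lborel. q n y) \<longlonglongrightarrow> (LINT y|lborel. ?d y)"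
  proof (rule integral_dominated_convergence[where w="\<lambda>y. indicator (cball 0 (R + 1)) y *\<^sub>R C"])
    show "integrable lborel (\<lambda>y::'a. indicator (cball 0 (R + 1)) y *\<^sub>R C)"
      by (intro borel_integrable_compact) auto
    show "AE y in lborel. norm (q n y) \<le> indicator (cball 0 (R + 1)) y *\<^sub>R C" for n
      using q_bound q_supp by (auto simp: indicator_def)
  qed (use q_lim in auto)
  moreover have "(LINT y|lborel. q n y) = 0" for n
  proof -
    have intf: "integrable lborel f" by (rule integrable_compact_support[OF contf supp])
    have supp': "f ((1 / real (Suc n)) *\<^sub>R i + y) = 0" if "R + 1 < norm y" for y
    proof -
      have "norm y \<le> norm ((1 / real (Suc n)) *\<^sub>R i + y) + norm ((1 / real (Suc n)) *\<^sub>R i)"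
        by (metis add.commute add_diff_cancel norm_triangle_ineq4)
      moreover have "norm ((1 / real (Suc n)) *\<^sub>R i) \<le> 1" using i by simp
      ultimately show ?thesis using that by (intro supp) linarith
    qed
    have "integrable lborel (\<lambda>y. f ((1 / real (Suc n)) *\<^sub>R i + y))"
      by (rule integrable_compact_support[OF _ supp'])
         (intro continuous_on_compose2[OF contf] continuous_intros, auto)
    then show ?thesis unfolding q_def
      using intf integral_lborel_translation[of f "(1 / real (Suc n)) *\<^sub>R i"] by simp
  qed
  ultimately show "(LINT y|lborel. ?d y) = 0" by (simp add: LIMSEQ_const_iff)
qed

lemma integrable_compact_support_indicator:
  fixes f :: "'a::euclidean_space \<Rightarrow> real"
  assumes "open S" "compact K" "K \<subseteq> S" "continuous_on S f" "\<And>y. y \<in> S - K \<Longrightarrow> f y = 0"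
  shows "integrable lborel (\<lambda>y. indicator S y * f y)"
proof -
  have "integrable lborel (\<lambda>y. indicator K y *\<^sub>R f y)"
    using assms by (intro borel_integrable_compact) (auto intro: continuous_on_subset)
  moreover have "(\<lambda>y. indicator K y *\<^sub>R f y) = (\<lambda>y. indicator S y * f y)"
    using assms by (auto simp: indicator_def fun_eq_iff)
  ultimately show ?thesis by simp
qed

text \<open>The function w lives on S only and may be singular at the edge of S. The field v grad w
  - w grad v vanishes off K, so it extends by zero to a C^1 field on the whole space, and its
  divergence v \<Delta>w - w \<Delta>v integrates to zero.\<close>

lemma green_laplacian:
  fixes v w :: "'a::euclidean_space \<Rightarrow> real"
  assumes S: "open S" and K: "compact K" "K \<subseteq> S"
    and v: "Ck_on 2 S v" and w: "Ck_on 2 S w" and supp: "\<And>y. y \<in> S - K \<Longrightarrow> v y = 0"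
  shows "(LINT y|lborel. indicator S y * (v y * laplacian w y))
       = (LINT y|lborel. indicator S y * (w y * laplacian v y))"
proof -
  have oSK: "open (S - K)" using S K by (simp add: open_Diff compact_imp_closed)
  have C2: "Ck_on (Suc (Suc 0)) S v" "Ck_on (Suc (Suc 0)) S w"
    using v w by (simp_all only: numeral_2_eq_2)
  note C1 = C2[THEN Ck_on_SucD]
  have Cd: "Ck_on (Suc 0) S (pderiv_dir i v)" "Ck_on (Suc 0) S (pderiv_dir i w)" if "i \<in> Basis" for i
    using C2 that by simp_all
  have dsupp: "pderiv_dir i v y = 0" if "y \<in> S - K" for i y
    by (rule pderiv_dir_eq_0[OF oSK that supp])
  define g where "g i y = v y * pderiv_dir i w y - w y * pderiv_dir i v y" for i y
  define F where "F i y = (if y \<in> S then g i y else 0)" for i y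
  have gC: "Ck_on (Suc 0) S (g i)" if "i \<in> Basis" for i
    unfolding g_def by (intro Ck_on_diff Ck_on_mult S C1 Cd that)
  have F0: "F i y = 0" if "y \<in> - K" for i y
    using that supp dsupp by (auto simp: F_def g_def)
  have SK: "S \<union> (- K) = UNIV" using K by auto
  have oK: "open (- K)" using K by (simp add: compact_imp_closed open_Compl)
  have FC: "Ck_on (Suc 0) UNIV (F i)" if "i \<in> Basis" for i
    unfolding SK[symmetric]
  proof (rule Ck_on_Un[OF S oK])
    show "Ck_on (Suc 0) S (F i)" by (rule Ck_on_cong[OF S _ gC[OF that]]) (simp add: F_def)
    show "Ck_on (Suc 0) (- K) (F i)"
      by (rule Ck_on_cong[OF oK _ Ck_on_const[of _ _ 0]]) (simp add: F0)
  qed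
  obtain R where "\<forall>y\<in>K. norm y \<le> R"
    using compact_imp_bounded[OF K(1)] unfolding bounded_iff by blast
  then have R: "K \<subseteq> cball 0 R" by auto
  have FR: "F i y = 0" if "R < norm y" for i y
    using R that by (intro F0) (auto dest: subsetD)
  have diffs: "v differentiable (at y)" "w differentiable (at y)"
    "i \<in> Basis \<Longrightarrow> pderiv_dir i v differentiable (at y)" "i \<in> Basis \<Longrightarrow> pderiv_dir i w differentiable (at y)"
    if "y \<in> S" for y i
    using that C1 Cd S by (auto simp: differentiable_on_eq_differentiable_at)
  have dF: "pderiv_dir i (F i) y = indicator S y *
      (v y * pderiv_dir i (pderiv_dir i w) y - w y * pderiv_dir i (pderiv_dir i v) y)"
    if i: "i \<in> Basis" for i y
  proof (cases "y \<in> S")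
    case True
    have "pderiv_dir i (F i) y = pderiv_dir i (\<lambda>y. v y * pderiv_dir i w y - w y * pderiv_dir i v y) y"
      by (rule pderiv_dir_cong[OF S True]) (simp add: F_def g_def)
    also have "\<dots> = v y * pderiv_dir i (pderiv_dir i w) y - w y * pderiv_dir i (pderiv_dir i v) y"
      using diffs[OF True] i by (simp add: pderiv_dir_diff pderiv_dir_mult algebra_simps)
    finally show ?thesis using True by simp
  next
    case False
    then have "y \<in> - K" using K by auto
    from pderiv_dir_eq_0[OF oK this F0] False show ?thesis by simp
  qed
  have "(LINT y|lborel. (\<Sum>i\<in>Basis. pderiv_dir i (F i) y)) = 0"
    using integral_pderiv_dir_eq_0[OF FC FR] by (subst Bochner_Integration.integral_sum) auto
  also have "(\<lambda>y. \<Sum>i\<in>Basis. pderiv_dir i (F i) y) =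
      (\<lambda>y. indicator S y * (v y * laplacian w y) - indicator S y * (w y * laplacian v y))"
    by (simp add: dF laplacian_def sum_distrib_left sum_subtractf right_diff_distrib fun_eq_iff)
  also have "(LINT y|lborel. indicator S y * (v y * laplacian w y) - indicator S y * (w y * laplacian v y))
     = (LINT y|lborel. indicator S y * (v y * laplacian w y)) - (LINT y|lborel. indicator S y * (w y * laplacian v y))"
  proof (rule Bochner_Integration.integral_diff)
    have "continuous_on S (laplacian v)" "continuous_on S (laplacian w)"
      using Ck_on_laplacian[OF S C2(1)] Ck_on_laplacian[OF S C2(2)] by simp_all
    moreover have "continuous_on S v" "continuous_on S w" using C1 by auto
    moreover have "laplacian v y = 0" if "y \<in> S - K" for y
      using laplacian_pow_eq_0[OF oSK that supp, where m="Suc 0"] by simp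
    ultimately show "integrable lborel (\<lambda>y. indicator S y * (v y * laplacian w y))"
      "integrable lborel (\<lambda>y. indicator S y * (w y * laplacian v y))"
      by (intro integrable_compact_support_indicator[OF S K] continuous_intros; simp add: supp)+
  qed
  finally show ?thesis by simp
qed

text \<open>One Laplacian is moved across at a time. The induction is over all v because the moved
  Laplacian turns v into \<open>laplacian v\<close>, which has the same compact support.\<close>

lemma green_laplacian_pow:
  fixes v w :: "'a::euclidean_space \<Rightarrow> real"
  assumes S: "open S" and K: "compact K" "K \<subseteq> S"
    and v: "Ck_on (2 * m) S v" and w: "Ck_on (2 * m) S w" and supp: "\<And>y. y \<in> S - K \<Longrightarrow> v y = 0"
  shows "(LINT y|lborel. indicator S y * (v y * (laplacian ^^ m) w y))
       = (LINT y|lborel. indicator S y * (w y * (laplacian ^^ m) v y))"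
  using v w supp
proof (induction m arbitrary: v)
  case 0
  then show ?case by (simp add: mult.commute)
next
  case (Suc m)
  have oSK: "open (S - K)" using S K by (simp add: open_Diff compact_imp_closed)
  have "(LINT y|lborel. indicator S y * (v y * (laplacian ^^ Suc m) w y))
      = (LINT y|lborel. indicator S y * (v y * laplacian ((laplacian ^^ m) w) y))" by simp
  also have "\<dots> = (LINT y|lborel. indicator S y * ((laplacian ^^ m) w y * laplacian v y))"
    using Suc.prems by (intro green_laplacian[OF S K] Ck_on_laplacian_pow[OF S])
      (auto simp del: Ck_on.simps intro: Ck_on_le)
  also have "\<dots> = (LINT y|lborel. indicator S y * (laplacian v y * (laplacian ^^ m) w y))"
    by (simp add: mult.commute)
  also have "\<dots> = (LINT y|lborel. indicator S y * (w y * (laplacian ^^ m) (laplacian v) y))"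
  proof (rule Suc.IH)
    show "Ck_on (2 * m) S (laplacian v)" using Suc.prems(1) by (intro Ck_on_laplacian[OF S]) simp
    show "Ck_on (2 * m) S w" using Suc.prems(2) by (rule Ck_on_le) simp
    show "laplacian v y = 0" if "y \<in> S - K" for y
      using laplacian_pow_eq_0[OF oSK that Suc.prems(3), where m="Suc 0"] by simp
  qed
  finally show ?case by (simp add: funpow_swap1)
qed

subsection \<open>Derivative bounds on shells\<close>

text \<open>Size of the derivatives of a family \<open>f \<delta>\<close> on the shells \<open>\<delta> \<le> |y| \<le> 2 \<delta>\<close>: each derivative
  costs a factor \<open>1 / \<delta>\<close>. In this form the Leibniz rule is a plain induction.\<close>

fun shell_bound :: "nat \<Rightarrow> int \<Rightarrow> (real \<Rightarrow> 'a::euclidean_space \<Rightarrow> real) \<Rightarrow> bool" where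
  "shell_bound 0 j f = (\<exists>C. \<forall>\<delta> y. 0 < \<delta> \<and> \<delta> \<le> 1 \<and> \<delta> \<le> norm y \<and> norm y \<le> 2 * \<delta> \<longrightarrow> \<bar>f \<delta> y\<bar> \<le> C * \<delta> powi j)"
| "shell_bound (Suc k) j f = (shell_bound 0 j f \<and> (\<forall>i\<in>Basis. shell_bound k (j - 1) (\<lambda>\<delta>. pderiv_dir i (f \<delta>))))"

lemma shell_bound_SucD: "shell_bound (Suc k) j f \<Longrightarrow> shell_bound k j f"
  by (induction k arbitrary: j f) auto

lemma shell_bound_0: "shell_bound k j f \<Longrightarrow> shell_bound 0 j f"
  by (cases k) auto

lemma shell_bound_add_0: 
  assumes "shell_bound 0 j f" "shell_bound 0 j g"
  shows "shell_bound 0 j (\<lambda>\<delta> y. f \<delta> y + g \<delta> y)"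
proof -
  obtain C D where C: "\<And>\<delta> y. 0 < \<delta> \<and> \<delta> \<le> 1 \<and> \<delta> \<le> norm y \<and> norm y \<le> 2 * \<delta> \<Longrightarrow> \<bar>f \<delta> y\<bar> \<le> C * \<delta> powi j"
    and D: "\<And>\<delta> y. 0 < \<delta> \<and> \<delta> \<le> 1 \<and> \<delta> \<le> norm y \<and> norm y \<le> 2 * \<delta> \<Longrightarrow> \<bar>g \<delta> y\<bar> \<le> D * \<delta> powi j"
    using assms by auto
  have "\<bar>f \<delta> y + g \<delta> y\<bar> \<le> (C + D) * \<delta> powi j" if "0 < \<delta> \<and> \<delta> \<le> 1 \<and> \<delta> \<le> norm y \<and> norm y \<le> 2 * \<delta>" for \<delta> y
    using C[OF that] D[OF that] by (simp add: distrib_right)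
  then show ?thesis by auto
qed

lemma shell_bound_mult_0: 
  assumes "shell_bound 0 a f" "shell_bound 0 b g"
  shows "shell_bound 0 (a + b) (\<lambda>\<delta> y. f \<delta> y * g \<delta> y)"
proof -
  obtain C D where C: "\<And>\<delta> y. 0 < \<delta> \<and> \<delta> \<le> 1 \<and> \<delta> \<le> norm y \<and> norm y \<le> 2 * \<delta> \<Longrightarrow> \<bar>f \<delta> y\<bar> \<le> C * \<delta> powi a"
    and D: "\<And>\<delta> y. 0 < \<delta> \<and> \<delta> \<le> 1 \<and> \<delta> \<le> norm y \<and> norm y \<le> 2 * \<delta> \<Longrightarrow> \<bar>g \<delta> y\<bar> \<le> D * \<delta> powi b"
    using assms by auto
  have "\<bar>f \<delta> y * g \<delta> y\<bar> \<le> (C * D) * \<delta> powi (a + b)" if H: "0 < \<delta> \<and> \<delta> \<le> 1 \<and> \<delta> \<le> norm y \<and> norm y \<le> 2 * \<delta>" for \<delta> y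
  proof -
    have "\<bar>f \<delta> y * g \<delta> y\<bar> \<le> (C * \<delta> powi a) * (D * \<delta> powi b)"
      unfolding abs_mult using C[OF H] D[OF H] by (intro mult_mono) auto
    then show ?thesis using H by (simp add: power_int_add mult_ac)
  qed
  then show ?thesis by auto
qed

lemma pderiv_dir_add_fun:
  "f differentiable_on UNIV \<Longrightarrow> g differentiable_on UNIV \<Longrightarrow>
    pderiv_dir i (\<lambda>y. f y + g y) = (\<lambda>y. pderiv_dir i f y + pderiv_dir i g y)"
  by (rule ext, rule pderiv_dir_add) (auto simp: differentiable_on_eq_differentiable_at)

lemma pderiv_dir_mult_fun:
  "f differentiable_on UNIV \<Longrightarrow> g differentiable_on UNIV \<Longrightarrow>
    pderiv_dir i (\<lambda>y. f y * g y) = (\<lambda>y. pderiv_dir i f y * g y + f y * pderiv_dir i g y)"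
  by (rule ext, rule pderiv_dir_mult) (auto simp: differentiable_on_eq_differentiable_at)

lemma shell_bound_add: 
  assumes "shell_bound k j f" "shell_bound k j g" "\<And>\<delta>. Ck_on k UNIV (f \<delta>)" "\<And>\<delta>. Ck_on k UNIV (g \<delta>)"
  shows "shell_bound k j (\<lambda>\<delta> y. f \<delta> y + g \<delta> y)"
  using assms
proof (induction k arbitrary: j f g)
  case 0
  then show ?case using shell_bound_add_0 by blast
next
  case (Suc k)
  have "shell_bound k (j - 1) (\<lambda>\<delta>. pderiv_dir i (\<lambda>y. f \<delta> y + g \<delta> y))" if "i \<in> Basis" for i
    using Suc.IH[of "j - 1" "\<lambda>\<delta>. pderiv_dir i (f \<delta>)" "\<lambda>\<delta>. pderiv_dir i (g \<delta>)"] Suc.prems that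
    by (simp add: pderiv_dir_add_fun)
  moreover have "shell_bound 0 j (\<lambda>\<delta> y. f \<delta> y + g \<delta> y)"
    using Suc.prems(1,2) by (intro shell_bound_add_0 shell_bound_0[of "Suc k"])
  ultimately show ?case unfolding shell_bound.simps(2) by blast
qed

lemma shell_bound_mult: 
  assumes "shell_bound k a f" "shell_bound k b g" "\<And>\<delta>. Ck_on k UNIV (f \<delta>)" "\<And>\<delta>. Ck_on k UNIV (g \<delta>)"
  shows "shell_bound k (a + b) (\<lambda>\<delta> y. f \<delta> y * g \<delta> y)"
  using assms
proof (induction k arbitrary: a b f g)
  case 0
  then show ?case using shell_bound_mult_0 by blast
next
  case (Suc k)
  have "shell_bound k (a + b - 1) (\<lambda>\<delta>. pderiv_dir i (\<lambda>y. f \<delta> y * g \<delta> y))" if i: "i \<in> Basis" for i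
  proof -
    have *: "a + b - 1 = (a - 1) + b" "a + b - 1 = a + (b - 1)" by simp_all
    note [simp del] = Ck_on.simps shell_bound.simps
    note C = Ck_on_SucD[OF Suc.prems(3)] Ck_on_SucD[OF Suc.prems(4)]
      shell_bound_SucD[OF Suc.prems(1)] shell_bound_SucD[OF Suc.prems(2)]
    have D: "Ck_on k UNIV (pderiv_dir i (f \<delta>))" "Ck_on k UNIV (pderiv_dir i (g \<delta>))" for \<delta>
      using Suc.prems i by (simp_all add: Ck_on.simps)
    have E: "shell_bound k (a - 1) (\<lambda>\<delta>. pderiv_dir i (f \<delta>))" "shell_bound k (b - 1) (\<lambda>\<delta>. pderiv_dir i (g \<delta>))"
      using Suc.prems i by (simp_all add: shell_bound.simps)
    have "shell_bound k (a + b - 1) (\<lambda>\<delta> y. pderiv_dir i (f \<delta>) y * g \<delta> y)"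
      unfolding *(1) by (rule Suc.IH[OF E(1) C(4) D(1) C(2)])
    moreover have "shell_bound k (a + b - 1) (\<lambda>\<delta> y. f \<delta> y * pderiv_dir i (g \<delta>) y)"
      unfolding *(2) by (rule Suc.IH[OF C(3) E(2) C(1) D(2)])
    ultimately have "shell_bound k (a + b - 1) (\<lambda>\<delta> y. pderiv_dir i (f \<delta>) y * g \<delta> y + f \<delta> y * pderiv_dir i (g \<delta>) y)"
      by (rule shell_bound_add) (intro Ck_on_mult open_UNIV C D)+
    moreover have "f \<delta> differentiable_on UNIV" "g \<delta> differentiable_on UNIV" for \<delta>
      using Suc.prems by (simp_all add: Ck_on.simps)
    ultimately show ?thesis by (simp add: pderiv_dir_mult_fun)
  qed
  moreover have "shell_bound 0 (a + b) (\<lambda>\<delta> y. f \<delta> y * g \<delta> y)"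
    using Suc.prems(1,2) by (intro shell_bound_mult_0 shell_bound_0[of "Suc k"])
  ultimately show ?case unfolding shell_bound.simps(2) by blast
qed

lemma shell_bound_zero: "shell_bound k j (\<lambda>\<delta> y. 0)"
proof (induction k arbitrary: j)
  case (Suc k)
  have "pderiv_dir i (\<lambda>y. 0) = (\<lambda>y. 0)" for i :: 'a by (rule ext) (rule pderiv_dir_const)
  moreover have "shell_bound 0 j (\<lambda>\<delta> y::'a. 0)" by (auto intro!: exI[of _ 0])
  ultimately show ?case using Suc by (simp only: shell_bound.simps(2)) blast
qed (auto intro: exI[of _ 0])

lemma shell_bound_sum: 
  assumes "finite A" "\<And>a. a \<in> A \<Longrightarrow> shell_bound k j (f a)" "\<And>\<delta> a. a \<in> A \<Longrightarrow> Ck_on k UNIV (f a \<delta>)"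
  shows "shell_bound k j (\<lambda>\<delta> y. \<Sum>a\<in>A. f a \<delta> y)"
  using assms(1-3)
  by (induction A rule: finite_induct) (auto intro!: shell_bound_zero shell_bound_add Ck_on_sum)

lemma shell_bound_laplacian:
  assumes "shell_bound (Suc (Suc k)) j f" "\<And>\<delta>. Ck_on (Suc (Suc k)) UNIV (f \<delta>)"
  shows "shell_bound k (j - 2) (\<lambda>\<delta>. laplacian (f \<delta>))"
  unfolding laplacian_def using assms
  by (intro shell_bound_sum finite_Basis) auto

lemma shell_bound_laplacian_pow:
  assumes "shell_bound (2 * m + k) j f" "\<And>\<delta>. Ck_on (2 * m + k) UNIV (f \<delta>)"
  shows "shell_bound k (j - 2 * int m) (\<lambda>\<delta>. (laplacian ^^ m) (f \<delta>))"
  using assms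
proof (induction m arbitrary: k)
  case (Suc m)
  have "shell_bound k (j - 2 * int m - 2) (\<lambda>\<delta>. laplacian ((laplacian ^^ m) (f \<delta>)))"
    using Suc.prems by (intro shell_bound_laplacian Suc.IH Ck_on_laplacian_pow open_UNIV) auto
  then show ?case by (simp add: algebra_simps)
qed simp

lemma continuous_bounded_cball:
  fixes f :: "'a::euclidean_space \<Rightarrow> real"
  assumes "continuous_on UNIV f"
  shows "\<exists>C. \<forall>y. norm y \<le> r \<longrightarrow> \<bar>f y\<bar> \<le> C"
proof -
  have "compact (f ` cball 0 r)"
    using assms(1) by (intro compact_continuous_image) (auto intro: continuous_on_subset)
  from compact_imp_bounded[OF this] obtain a where "\<forall>x\<in>cball 0 r. \<bar>f x\<bar> \<le> a" unfolding bounded_iff by auto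
  then show ?thesis by (intro exI[of _ a]) auto
qed

lemma pderiv_dir_scale:
  fixes g :: "'a::euclidean_space \<Rightarrow> real"
  assumes "g differentiable_on UNIV"
  shows "pderiv_dir i (\<lambda>y. c * g (d *\<^sub>R y)) = (\<lambda>y. (c * d) * pderiv_dir i g (d *\<^sub>R y))"
proof
  fix y
  obtain g' where g': "(g has_derivative g') (at (d *\<^sub>R y))"
    using assms by (auto simp: differentiable_on_eq_differentiable_at differentiable_def)
  interpret bounded_linear g' using g' by (rule has_derivative_bounded_linear)
  have "((\<lambda>y. g (d *\<^sub>R y)) has_derivative (\<lambda>h. g' (d *\<^sub>R h))) (at y)"
    by (rule has_derivative_compose[of "\<lambda>y. d *\<^sub>R y" "\<lambda>y. d *\<^sub>R y" y UNIV g g', OF _ g'])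
       (auto intro!: derivative_eq_intros)
  then have "((\<lambda>y. c * g (d *\<^sub>R y)) has_derivative (\<lambda>h. c * g' (d *\<^sub>R h))) (at y)"
    by (rule has_derivative_mult_right)
  then show "pderiv_dir i (\<lambda>y. c * g (d *\<^sub>R y)) y = (c * d) * pderiv_dir i g (d *\<^sub>R y)"
    by (simp add: pderiv_dir_eq pderiv_dir_eq[OF g'] scaleR)
qed

lemma Ck_on_scale:
  fixes g :: "'a::euclidean_space \<Rightarrow> real"
  assumes "Ck_on k UNIV g"
  shows "Ck_on k UNIV (\<lambda>y. c * g (d *\<^sub>R y))"
  using assms
proof (induction k arbitrary: g c)
  case 0
  then show ?case by (auto intro!: continuous_intros continuous_on_compose2[of UNIV g])
next
  case (Suc k)
  have "(\<lambda>y. c * g (d *\<^sub>R y)) differentiable (at x)" for x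
  proof -
    have "(g \<circ> (\<lambda>y. d *\<^sub>R y)) differentiable (at x)"
      using Suc.prems by (intro differentiable_chain_at) (auto simp: differentiable_on_eq_differentiable_at)
    then show ?thesis by (auto simp: o_def)
  qed
  then have "(\<lambda>y. c * g (d *\<^sub>R y)) differentiable_on UNIV"
    by (auto simp: differentiable_on_eq_differentiable_at)
  then show ?case using Suc.prems
    by (auto simp: pderiv_dir_scale intro!: Suc.IH intro: differentiable_imp_continuous_on)
qed

lemma shell_bound_0_scale:
  fixes g :: "'a::euclidean_space \<Rightarrow> real"
  assumes "continuous_on UNIV g" and c: "\<And>\<delta>. 0 < \<delta> \<Longrightarrow> c \<delta> = \<delta> powi j"
  shows "shell_bound 0 j (\<lambda>\<delta> y. c \<delta> * g ((1 / \<delta>) *\<^sub>R y))"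
proof -
  obtain C where C: "\<And>y. norm y \<le> 2 \<Longrightarrow> \<bar>g y\<bar> \<le> C"
    using continuous_bounded_cball[OF assms(1), of 2] by auto
  have "\<bar>c \<delta> * g ((1 / \<delta>) *\<^sub>R y)\<bar> \<le> C * \<delta> powi j" if "0 < \<delta>" "norm y \<le> 2 * \<delta>" for \<delta> y
  proof -
    have "norm ((1 / \<delta>) *\<^sub>R y) \<le> 2" using that by (simp add: field_simps)
    from C[OF this] show ?thesis using that c[of \<delta>] by (simp add: abs_mult mult.commute[of C] mult_left_mono)
  qed
  then show ?thesis by auto
qed

text \<open>A fixed profile rescaled to size \<delta> is the model of a family obeying these bounds:
  the chain rule extracts one factor 1 / \<delta> per derivative.\<close>

lemma shell_bound_scale:
  fixes g :: "'a::euclidean_space \<Rightarrow> real"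
  assumes "Ck_on k UNIV g"
  shows "shell_bound k j (\<lambda>\<delta> y. \<delta> powi j * g ((1 / \<delta>) *\<^sub>R y))"
proof -
  \<comment> \<open>The prefactor is generalised to any c that is right for positive \<delta>: after
    one derivative it becomes \<open>c \<delta> * (1 / \<delta>)\<close>, which need not equal
    \<open>\<delta> powi (j - 1)\<close> at \<delta> = 0.\<close>
  have *: "shell_bound k j (\<lambda>\<delta> y. c \<delta> * g ((1 / \<delta>) *\<^sub>R y))"
    if "\<And>\<delta>. 0 < \<delta> \<Longrightarrow> c \<delta> = \<delta> powi j" for c
    using assms that
  proof (induction k arbitrary: g j c)
    case 0
    then show ?case by (intro shell_bound_0_scale) auto
  next
    case (Suc k)
    have "shell_bound k (j - 1) (\<lambda>\<delta> y. (c \<delta> * (1 / \<delta>)) * pderiv_dir i g ((1 / \<delta>) *\<^sub>R y))" if "i \<in> Basis" for i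
      using Suc.prems that by (intro Suc.IH) (auto simp: power_int_diff)
    moreover have "shell_bound 0 j (\<lambda>\<delta> y. c \<delta> * g ((1 / \<delta>) *\<^sub>R y))"
      using Suc.prems by (intro shell_bound_0_scale) auto
    ultimately show ?case using Suc.prems by (simp add: pderiv_dir_scale del: shell_bound.simps(1))
  qed
  show ?thesis by (rule *) simp
qed

text \<open>For \<delta> \<le> 1 a nonpositive power of \<delta> is at least 1, so mere boundedness
  is enough. This is why the shells are restricted to \<delta> \<le> 1.\<close>

lemma shell_bound_0_const_nonpos:
  fixes g :: "'a::euclidean_space \<Rightarrow> real"
  assumes "continuous_on UNIV g" "j \<le> 0"
  shows "shell_bound 0 j (\<lambda>\<delta>. g)"
proof -
  obtain C where C: "\<And>y. norm y \<le> 2 \<Longrightarrow> \<bar>g y\<bar> \<le> C"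
    using continuous_bounded_cball[OF assms(1), of 2] by auto
  have "\<bar>g y\<bar> \<le> C * \<delta> powi j" if "0 < \<delta>" "\<delta> \<le> 1" "norm y \<le> 2 * \<delta>" for \<delta> y
  proof -
    have "norm y \<le> 2" using that by simp
    note C[OF this]
    moreover have "1 \<le> \<delta> powi j" using that assms(2) by (metis power_int_0_right power_int_decreasing less_le_not_le not_le)
    moreover have "0 \<le> C" using C[of 0] by auto
    ultimately show ?thesis by (meson mult_le_cancel_left1 order_trans not_le)
  qed
  then show ?thesis by auto
qed

lemma shell_bound_const_nonpos:
  fixes g :: "'a::euclidean_space \<Rightarrow> real"
  assumes "Ck_on k UNIV g" "j \<le> 0"
  shows "shell_bound k j (\<lambda>\<delta>. g)"
  using assms
proof (induction k arbitrary: g j)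
  case 0
  then show ?case by (intro shell_bound_0_const_nonpos) auto
next
  case (Suc k)
  have "shell_bound 0 j (\<lambda>\<delta>. g)" using Suc.prems by (intro shell_bound_0_const_nonpos) auto
  then show ?case using Suc by (simp del: shell_bound.simps(1))
qed

lemma C1_linear_bound:
  fixes g :: "'a::euclidean_space \<Rightarrow> real"
  assumes diff: "g differentiable_on UNIV" and g0: "g 0 = 0"
    and bd: "\<And>i z. i \<in> Basis \<Longrightarrow> norm z \<le> norm y \<Longrightarrow> \<bar>pderiv_dir i g z\<bar> \<le> B"
  shows "\<bar>g y\<bar> \<le> real DIM('a) * B * norm y"
proof -
  define G where "G z = frechet_derivative g (at z)" for z
  have G: "(g has_derivative G z) (at z)" for z
    using diff by (simp add: G_def differentiable_on_eq_differentiable_at frechet_derivative_works[symmetric])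
  have Gy: "G z h = (\<Sum>i\<in>Basis. (h \<bullet> i) * pderiv_dir i g z)" for z h
  proof -
    interpret bounded_linear "G z" using G by (rule has_derivative_bounded_linear)
    have "G z h = G z (\<Sum>i\<in>Basis. (h \<bullet> i) *\<^sub>R i)" by (simp add: euclidean_representation)
    also have "\<dots> = (\<Sum>i\<in>Basis. (h \<bullet> i) * pderiv_dir i g z)" by (simp add: sum scaleR pderiv_dir_eq[OF G])
    finally show ?thesis .
  qed
  have "((\<lambda>t. g (0 + t *\<^sub>R y)) has_real_derivative G (0 + t *\<^sub>R y) y) (at t)" for t
    by (rule has_real_derivative_along[OF G])
  then have "\<exists>t::real>0. t < 1 \<and> g (0 + 1 *\<^sub>R y) - g (0 + 0 *\<^sub>R y) = (1 - 0) * G (0 + t *\<^sub>R y) y"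
    by (intro MVT2) auto
  then obtain t where t: "0 < t" "t < 1" "g y = G (t *\<^sub>R y) y" using g0 by auto
  have "\<bar>G (t *\<^sub>R y) y\<bar> \<le> (\<Sum>i\<in>Basis. \<bar>y \<bullet> i\<bar> * \<bar>pderiv_dir i g (t *\<^sub>R y)\<bar>)"
    unfolding Gy by (rule order_trans[OF sum_abs]) (simp add: abs_mult)
  also have "\<dots> \<le> (\<Sum>i\<in>(Basis::'a set). norm y * B)"
    using t by (intro sum_mono mult_mono bd Basis_le_norm) (auto simp: mult_left_le_one_le)
  finally show ?thesis using t by (simp add: mult_ac)
qed

text \<open>Taylor expansion by two applications of \<open>C1_linear_bound\<close>: bounded second
  derivatives make the gradient O(|y|) and then g itself O(|y|^2). From order two on, the
  derivatives are only bounded, which suffices because the required power of \<delta> is then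
  nonpositive.\<close>

lemma shell_bound_second_order:
  fixes g :: "'a::euclidean_space \<Rightarrow> real"
  assumes C: "Ck_on (Suc (Suc k)) UNIV g" and "g 0 = 0" "\<And>i. i \<in> Basis \<Longrightarrow> pderiv_dir i g 0 = 0"
  shows "shell_bound (Suc (Suc k)) 2 (\<lambda>\<delta>. g)"
proof -
  let ?d = "\<lambda>i. pderiv_dir i g" and ?dd = "\<lambda>i j. pderiv_dir j (pderiv_dir i g)"
  have "\<exists>B. \<forall>y. norm y \<le> 2 \<longrightarrow> \<bar>?dd i j y\<bar> \<le> B" if "i \<in> Basis" "j \<in> Basis" for i j
    using C that by (intro continuous_bounded_cball) (auto dest: Ck_on_continuous)
  then obtain B where B: "\<And>i j y. i \<in> Basis \<Longrightarrow> j \<in> Basis \<Longrightarrow> norm y \<le> 2 \<Longrightarrow> \<bar>?dd i j y\<bar> \<le> B i j"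
    by metis
  define B' where "B' = (\<Sum>i\<in>Basis. \<Sum>j\<in>Basis. \<bar>B i j\<bar>)"
  have B': "\<bar>?dd i j y\<bar> \<le> B'" if "i \<in> Basis" "j \<in> Basis" "norm y \<le> 2" for i j y
  proof -
    have "\<bar>?dd i j y\<bar> \<le> \<bar>B i j\<bar>" using B[OF that] by simp
    also have "\<dots> \<le> (\<Sum>j\<in>Basis. \<bar>B i j\<bar>)" using that by (intro member_le_sum) auto
    also have "\<dots> \<le> B'" unfolding B'_def using that
      by (intro member_le_sum[of i Basis "\<lambda>i. \<Sum>j\<in>Basis. \<bar>B i j\<bar>"]) (auto intro: sum_nonneg)
    finally show ?thesis .
  qed
  have B'0: "0 \<le> B'" unfolding B'_def by (intro sum_nonneg) auto
  define n where "n = real DIM('a)"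
  have d: "\<bar>?d i y\<bar> \<le> n * B' * norm y" if "i \<in> Basis" "norm y \<le> 2" for i y
  proof -
    have "pderiv_dir i g differentiable_on UNIV" using C that by auto
    moreover have "pderiv_dir i g 0 = 0" using that assms(3) by auto
    ultimately have "\<bar>pderiv_dir i g y\<bar> \<le> real DIM('a) * B' * norm y"
      by (rule C1_linear_bound) (use that B' in auto)
    then show ?thesis by (simp add: n_def)
  qed
  have gb: "\<bar>g y\<bar> \<le> n * (n * B' * norm y) * norm y" if "norm y \<le> 2" for y
    unfolding n_def
  proof (rule C1_linear_bound)
    fix i z :: 'a assume "i \<in> Basis" "norm z \<le> norm y"
    then have "\<bar>?d i z\<bar> \<le> n * B' * norm z" using d that by auto
    also have "\<dots> \<le> n * B' * norm y" using \<open>norm z \<le> norm y\<close> B'0 by (intro mult_left_mono) (auto simp: n_def)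
    finally show "\<bar>?d i z\<bar> \<le> real DIM('a) * B' * norm y" by (simp add: n_def)
  qed (use C assms(2) in auto)
  have "shell_bound 0 2 (\<lambda>\<delta>. g)"
  proof -
    have "\<bar>g y\<bar> \<le> (n * n * B' * 4) * \<delta> powi 2" if "0 < \<delta>" "\<delta> \<le> 1" "norm y \<le> 2 * \<delta>" for \<delta> y
    proof -
      have "\<bar>g y\<bar> \<le> n * n * B' * (norm y * norm y)" using gb[of y] that by (simp add: mult_ac)
      also have "\<dots> \<le> n * n * B' * ((2 * \<delta>) * (2 * \<delta>))"
        using that B'0 by (intro mult_left_mono mult_mono) (auto simp: n_def)
      finally show ?thesis by (simp add: power2_eq_square mult_ac)
    qed
    then show ?thesis by auto
  qed
  moreover have "shell_bound 0 1 (\<lambda>\<delta>. ?d i)" if "i \<in> Basis" for i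
  proof -
    have "\<bar>?d i y\<bar> \<le> (n * B' * 2) * \<delta> powi 1" if "0 < \<delta>" "\<delta> \<le> 1" "norm y \<le> 2 * \<delta>" for \<delta> y
    proof -
      have "\<bar>?d i y\<bar> \<le> n * B' * norm y" using d[OF \<open>i \<in> Basis\<close>] that by simp
      also have "\<dots> \<le> n * B' * (2 * \<delta>)" using that B'0 by (intro mult_left_mono) (auto simp: n_def)
      finally show ?thesis by (simp add: mult_ac)
    qed
    then show ?thesis by auto
  qed
  moreover have "shell_bound k 0 (\<lambda>\<delta>. ?dd i j)" if "i \<in> Basis" "j \<in> Basis" for i j
    using C that by (intro shell_bound_const_nonpos) auto
  ultimately show ?thesis by (simp del: shell_bound.simps(1))
qed

subsection \<open>Removability of the origin\<close>

lemma borel_measurable_indicator_times_continuous: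
  fixes f :: "'a::euclidean_space \<Rightarrow> real"
  assumes "open S" "continuous_on S f"
  shows "(\<lambda>y. indicator S y * f y) \<in> borel_measurable borel"
  using borel_measurable_continuous_on_indicator[OF _ assms(2)] assms(1) by simp

lemma indicator_times_integrable_bound:
  fixes f g :: "'a::euclidean_space \<Rightarrow> real"
  assumes "integrable lborel f" "g \<in> borel_measurable borel" "\<And>y. \<bar>g y\<bar> \<le> C"
  shows "integrable lborel (\<lambda>y. f y * g y)"
proof (rule Bochner_Integration.integrable_bound[of _ "\<lambda>y. C * f y"])
  show "AE y in lborel. norm (f y * g y) \<le> norm (C * f y)"
  proof (intro AE_I2)
    fix y
    have "\<bar>g y\<bar> \<le> \<bar>C\<bar>" using assms(3)[of y] by simp
    then show "norm (f y * g y) \<le> norm (C * f y)"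
      by (simp add: abs_mult mult.commute[of "\<bar>C\<bar>"] mult_left_mono)
  qed
qed (use assms in auto)

text \<open>Green's formula holds for \<psi> times a cutoff that vanishes on |y| \<le> \<delta> and
  is 1 beyond 2 \<delta>. Its m-th Laplacian is O(\<delta>^(2-2m)) on |y| \<le> 2 \<delta>, by the
  second order zero of \<psi>, and the integral of |u| there is o(\<delta>^(2m-2)); so the error
  made by the cutoff tends to zero.\<close>

lemma removable_origin:
  fixes u \<psi> :: "'a::euclidean_space \<Rightarrow> real"
  assumes m: "1 \<le> m" and r1: "r1 < R" and R: "0 < R"
    and u: "Ck_on (2 * m) (ball 0 R - {0}) u"
    and U: "integrable lborel (\<lambda>y. indicator (ball 0 R - {0}) y * u y)"
    and F: "integrable lborel (\<lambda>y. indicator (ball 0 R - {0}) y * (laplacian ^^ m) u y)"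
    and small: "\<And>\<epsilon>. 0 < \<epsilon> \<Longrightarrow> \<forall>\<^sub>F r in at_right 0.
        (LINT y|lborel. indicator (ball 0 r - {0}) y * \<bar>u y\<bar>) \<le> \<epsilon> * r ^ (2 * m - 2)"
    and \<psi>: "Ck_on (2 * m) UNIV \<psi>" "\<psi> 0 = 0" "\<And>i. i \<in> Basis \<Longrightarrow> pderiv_dir i \<psi> 0 = 0"
    and supp: "\<And>y. r1 < norm y \<Longrightarrow> \<psi> y = 0"
  shows "(LINT y|lborel. indicator (ball 0 R - {0}) y * (laplacian ^^ m) u y * \<psi> y)
       = (LINT y|lborel. indicator (ball 0 R - {0}) y * u y * (laplacian ^^ m) \<psi> y)"
proof -
  let ?S = "ball 0 R - {0} :: 'a set"
  let ?L = "laplacian ^^ m"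
  have S: "open ?S" by auto
  define N where "N = 2 * m + 1"
  \<comment> \<open>Two nested truncated powers give a C^(2m) transition: the inner one vanishes for
    |y| \<le> 1 and is at least 1 for |y| \<ge> 2, where the outer truncation makes \<eta> exactly
    1.\<close>
  define \<eta> :: "'a \<Rightarrow> real" where "\<eta> y = 1 - max 0 (1 - max 0 ((norm (y - 0))\<^sup>2 - 1) ^ N) ^ N" for y
  have \<eta>C: "Ck_on (2 * m) UNIV \<eta>"
    unfolding \<eta>_def N_def
    by (intro Ck_on_diff Ck_on_const Ck_on_pos_part_power Ck_on_norm_sq_diff open_UNIV) auto
  have \<eta>0: "\<eta> y = 0" if "norm y \<le> 1" for y
    using that by (simp add: \<eta>_def N_def power_le_one)
  have \<eta>1: "\<eta> y = 1" if "2 \<le> norm y" for y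
  proof -
    have "2\<^sup>2 \<le> (norm y)\<^sup>2" using that by (intro power_mono) auto
    then have "1 \<le> (norm y)\<^sup>2 - 1" by simp
    then have "1 \<le> ((norm y)\<^sup>2 - 1) ^ N" by (rule one_le_power)
    then show ?thesis using \<open>1 \<le> (norm y)\<^sup>2 - 1\<close> by (simp add: \<eta>_def N_def max_def)
  qed
  have \<eta>b: "\<bar>\<eta> y\<bar> \<le> 1" for y
  proof -
    have "0 \<le> max 0 (1 - max 0 ((norm (y - 0))\<^sup>2 - 1) ^ N) ^ N"
      "max 0 (1 - max 0 ((norm (y - 0))\<^sup>2 - 1) ^ N) ^ N \<le> 1" by (auto intro!: power_le_one)
    then show ?thesis unfolding \<eta>_def by linarith
  qed
  \<comment> \<open>The factor \<open>\<delta> powi 0\<close> is 1; it brings e into the form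
    required by \<open>shell_bound_scale\<close> with j = 0.\<close>
  define e :: "real \<Rightarrow> 'a \<Rightarrow> real" where "e \<delta> y = \<delta> powi 0 * \<eta> ((1 / \<delta>) *\<^sub>R y)" for \<delta> y
  have eC: "Ck_on (2 * m) UNIV (e \<delta>)" for \<delta> unfolding e_def by (rule Ck_on_scale[OF \<eta>C])
  define v where "v \<delta> y = e \<delta> y * \<psi> y" for \<delta> y
  have vC: "Ck_on (2 * m) UNIV (v \<delta>)" for \<delta> unfolding v_def by (intro Ck_on_mult open_UNIV eC \<psi>)
  have "shell_bound (2 * m) (0 + 2) v"
    unfolding v_def
  proof (rule shell_bound_mult)
    show "shell_bound (2 * m) 0 e" unfolding e_def by (rule shell_bound_scale[OF \<eta>C])
    obtain k where k: "2 * m = Suc (Suc k)" using m by (metis Suc_le_D mult_Suc_right numeral_2_eq_2 add_2_eq_Suc One_nat_def)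
    show "shell_bound (2 * m) 2 (\<lambda>\<delta>. \<psi>)" unfolding k by (rule shell_bound_second_order) (use \<psi> k in auto)
  qed (intro eC \<psi>)+
  then have "shell_bound 0 (2 - 2 * int m) (\<lambda>\<delta>. ?L (v \<delta>))"
    using shell_bound_laplacian_pow[of m 0 2 v] vC by simp
  then obtain C where C: "\<And>\<delta> y. 0 < \<delta> \<Longrightarrow> \<delta> \<le> 1 \<Longrightarrow> \<delta> \<le> norm y \<Longrightarrow> norm y \<le> 2 * \<delta> \<Longrightarrow>
      \<bar>?L (v \<delta>) y\<bar> \<le> C * \<delta> powi (2 - 2 * int m)"
    by auto
  define C' where "C' = max 0 C"
  have C': "\<bar>?L (v \<delta>) y\<bar> \<le> C' * \<delta> powi (2 - 2 * int m)" if "0 < \<delta>" "\<delta> \<le> 1" "norm y \<le> 2 * \<delta>" for \<delta> y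
  proof (cases "\<delta> \<le> norm y")
    case True
    have "C * \<delta> powi (2 - 2 * int m) \<le> C' * \<delta> powi (2 - 2 * int m)"
      unfolding C'_def using that by (intro mult_right_mono) auto
    with C[OF that(1,2) True that(3)] show ?thesis by linarith
  next
    case False
    have "?L (v \<delta>) y = 0"
      by (rule laplacian_pow_eq_0[of "ball 0 \<delta>"])
         (use that False in \<open>auto simp: v_def e_def field_simps intro!: \<eta>0\<close>)
    then show ?thesis using that by (simp add: C'_def)
  qed
  have Lout: "?L (v \<delta>) y = ?L \<psi> y" if "0 < \<delta>" "2 * \<delta> < norm y" for \<delta> y
    by (rule laplacian_pow_cong[OF open_norm_greater[of "2 * \<delta>"]])
       (use that in \<open>auto simp: v_def e_def field_simps intro!: \<eta>1\<close>)
  have green: "(LINT y|lborel. indicator ?S y * (v \<delta> y * ?L u y)) = (LINT y|lborel. indicator ?S y * (u y * ?L (v \<delta>) y))"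
    if "0 < \<delta>" for \<delta>
  proof (rule green_laplacian_pow[OF S])
    have "{y::'a. \<delta> \<le> norm y \<and> norm y \<le> r1} = cball 0 r1 \<inter> {y. \<delta> \<le> norm y}" by auto
    then show "compact {y::'a. \<delta> \<le> norm y \<and> norm y \<le> r1}"
      by (simp add: compact_Int_closed closed_Collect_le continuous_on_norm_id)
    show "{y::'a. \<delta> \<le> norm y \<and> norm y \<le> r1} \<subseteq> ?S" using that r1 by auto
    show "Ck_on (2 * m) ?S (v \<delta>)" by (rule Ck_on_subset[OF vC]) simp
    show "v \<delta> y = 0" if "y \<in> ?S - {y. \<delta> \<le> norm y \<and> norm y \<le> r1}" for y
      using that supp[of y] \<eta>0[of "(1 / \<delta>) *\<^sub>R y"] \<open>0 < \<delta>\<close> by (cases "r1 < norm y") (auto simp: v_def e_def field_simps)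
  qed (rule u)
  define \<delta> where "\<delta> n = 1 / real (Suc n)" for n
  have \<delta>: "0 < \<delta> n" "\<delta> n \<le> 1" for n by (auto simp: \<delta>_def)
  have \<delta>lim: "\<delta> \<longlonglongrightarrow> 0" unfolding \<delta>_def using LIMSEQ_inverse_real_of_nat by (simp add: inverse_eq_divide)
  have \<delta>ev: "\<forall>\<^sub>F n in sequentially. c * \<delta> n < d" if "0 < d" for c d
    using order_tendstoD(2)[OF tendsto_mult[OF tendsto_const \<delta>lim, of c], of d] that by simp
  have contu: "continuous_on ?S u" "continuous_on ?S (?L u)"
    using Ck_on_continuous[OF u] Ck_on_laplacian_pow[OF S, of m 0 u] u by simp_all
  have cont\<psi>: "continuous_on UNIV \<psi>" "continuous_on UNIV (?L \<psi>)" "continuous_on UNIV (v \<delta>)" "continuous_on UNIV (?L (v \<delta>))" for \<delta>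
    using Ck_on_continuous[OF \<psi>(1)] Ck_on_laplacian_pow[of UNIV m 0, OF open_UNIV, of \<psi>] \<psi>(1)
      Ck_on_laplacian_pow[of UNIV m 0, OF open_UNIV, of "v \<delta>"] vC[of \<delta>] Ck_on_continuous[OF vC] by simp_all
  have [measurable]: "\<psi> \<in> borel_measurable borel" "?L \<psi> \<in> borel_measurable borel"
    "v \<delta> \<in> borel_measurable borel" "?L (v \<delta>) \<in> borel_measurable borel" for \<delta>
    using cont\<psi> by (auto intro: borel_measurable_continuous_onI)
  define Ue Fe where "Ue y = indicator ?S y * u y" and "Fe y = indicator ?S y * ?L u y" for y
  have [measurable]: "Ue \<in> borel_measurable borel" "Fe \<in> borel_measurable borel"
    unfolding Ue_def Fe_def using contu by (auto intro!: borel_measurable_indicator_times_continuous simp: S)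
  have intU: "integrable lborel Ue" "integrable lborel Fe" using U F by (simp_all add: Ue_def[abs_def] Fe_def[abs_def])
  obtain D where D: "\<And>y. \<bar>\<psi> y\<bar> \<le> D" using bounded_compact_support[OF cont\<psi>(1) supp] by blast
  have Lsupp: "?L \<psi> y = 0" if "r1 < norm y" for y
    by (rule laplacian_pow_eq_0[OF open_norm_greater[of r1]]) (use that supp in auto)
  obtain D' where D': "D' > 0" "\<And>y. \<bar>?L \<psi> y\<bar> \<le> D'" using bounded_compact_support[OF cont\<psi>(2) Lsupp] by blast

  have lim1: "(\<lambda>n. LINT y|lborel. Fe y * v (\<delta> n) y) \<longlonglongrightarrow> (LINT y|lborel. Fe y * \<psi> y)"
  proof (rule integral_dominated_convergence[where w="\<lambda>y. \<bar>Fe y\<bar> * D"])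
    show "integrable lborel (\<lambda>y. \<bar>Fe y\<bar> * D)" using intU by auto
    show "AE y in lborel. (\<lambda>n. Fe y * v (\<delta> n) y) \<longlonglongrightarrow> Fe y * \<psi> y"
    proof (intro AE_I2)
      fix y
      show "(\<lambda>n. Fe y * v (\<delta> n) y) \<longlonglongrightarrow> Fe y * \<psi> y"
      proof (cases "y = 0")
        case False
        have "eventually (\<lambda>n. 2 * \<delta> n < norm y) sequentially" using False by (intro \<delta>ev) simp
        then have "eventually (\<lambda>n. Fe y * v (\<delta> n) y = Fe y * \<psi> y) sequentially"
        proof (rule eventually_mono)
          fix n assume "2 * \<delta> n < norm y"
          then have "\<eta> ((1 / \<delta> n) *\<^sub>R y) = 1" using \<delta>[of n] by (intro \<eta>1) (simp add: field_simps)
          then show "Fe y * v (\<delta> n) y = Fe y * \<psi> y" by (simp add: v_def e_def)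
        qed
        then show ?thesis by (rule tendsto_eventually)
      qed (simp add: Fe_def)
    qed
    show "AE y in lborel. norm (Fe y * v (\<delta> n) y) \<le> \<bar>Fe y\<bar> * D" for n
    proof (intro AE_I2)
      fix y
      have "\<bar>e (\<delta> n) y\<bar> * \<bar>\<psi> y\<bar> \<le> 1 * D" using \<eta>b D by (intro mult_mono) (auto simp: e_def)
      then show "norm (Fe y * v (\<delta> n) y) \<le> \<bar>Fe y\<bar> * D" by (simp add: v_def abs_mult mult_left_mono)
    qed
  qed auto
  \<comment> \<open>A is the part beyond the transition zone, where the cutoff is 1 and no error
    arises; B carries the whole effect of the cutoff.\<close>
  define A where "A n y = Ue y * (indicator {y. 2 * \<delta> n < norm y} y * ?L \<psi> y)" for n y
  define B where "B n y = Ue y * (indicator {y. norm y \<le> 2 * \<delta> n} y * ?L (v (\<delta> n)) y)" for n y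
  have lim2: "(\<lambda>n. LINT y|lborel. A n y) \<longlonglongrightarrow> (LINT y|lborel. Ue y * ?L \<psi> y)"
  proof (rule integral_dominated_convergence[where w="\<lambda>y. \<bar>Ue y\<bar> * D'"])
    show "integrable lborel (\<lambda>y. \<bar>Ue y\<bar> * D')" using intU by auto
    show "AE y in lborel. (\<lambda>n. A n y) \<longlonglongrightarrow> Ue y * ?L \<psi> y"
    proof (intro AE_I2)
      fix y
      show "(\<lambda>n. A n y) \<longlonglongrightarrow> Ue y * ?L \<psi> y"
      proof (cases "y = 0")
        case False
        have "eventually (\<lambda>n. 2 * \<delta> n < norm y) sequentially" using False by (intro \<delta>ev) simp
        then have "eventually (\<lambda>n. A n y = Ue y * ?L \<psi> y) sequentially"
          by (rule eventually_mono) (auto simp: A_def)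
        then show ?thesis by (rule tendsto_eventually)
      qed (simp add: Ue_def A_def)
    qed
    show "AE y in lborel. norm (A n y) \<le> \<bar>Ue y\<bar> * D'" for n
      using D' by (auto simp: A_def abs_mult mult_left_mono indicator_def)
  qed (auto simp: A_def)
  have intA: "integrable lborel (A n)" for n
    unfolding A_def using D' by (intro indicator_times_integrable_bound[OF intU(1), where C=D']) (auto simp: indicator_def)
  have Bb: "\<bar>indicator {y. norm y \<le> 2 * \<delta> n} y * ?L (v (\<delta> n)) y\<bar> \<le> C' * \<delta> n powi (2 - 2 * int m)" for n y
    using C'[OF \<delta>] \<delta>[of n] by (auto simp: indicator_def C'_def)
  have intB: "integrable lborel (B n)" for n
    unfolding B_def by (rule indicator_times_integrable_bound[OF intU(1) _ Bb]) measurable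
  have lim3: "(\<lambda>n. LINT y|lborel. B n y) \<longlonglongrightarrow> 0"
  proof (rule tendstoI)
    fix \<epsilon> :: real assume \<epsilon>: "0 < \<epsilon>"
    \<comment> \<open>The smallness of u is used at radius 3 \<delta>, so that the open ball
      contains the closed ball of radius 2 \<delta>; hence the power of 3.\<close>
    define \<epsilon>' where "\<epsilon>' = \<epsilon> / (2 * (C' + 1) * 3 ^ (2 * m - 2))"
    have \<epsilon>': "0 < \<epsilon>'" using \<epsilon> by (auto simp: \<epsilon>'_def C'_def intro!: divide_pos_pos mult_pos_pos add_nonneg_pos)
    have "filterlim (\<lambda>n. 3 * \<delta> n) (at_right 0) sequentially"
      unfolding filterlim_at using tendsto_mult[OF tendsto_const \<delta>lim, of 3] \<delta>(1)
      by (simp add: less_imp_neq[THEN not_sym])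
    from eventually_compose_filterlim[OF small[OF \<epsilon>'] this]
    have "\<forall>\<^sub>F n in sequentially. (LINT y|lborel. indicator (ball 0 (3 * \<delta> n) - {0}) y * \<bar>u y\<bar>) \<le> \<epsilon>' * (3 * \<delta> n) ^ (2 * m - 2)" .
    moreover have "\<forall>\<^sub>F n in sequentially. 3 * \<delta> n < R"
      by (rule \<delta>ev[OF R])
    ultimately show "\<forall>\<^sub>F n in sequentially. dist (LINT y|lborel. B n y) 0 < \<epsilon>"
    proof eventually_elim
      case (elim n)
      let ?I = "indicator (ball 0 (3 * \<delta> n) - {0}) :: 'a \<Rightarrow> real"
      have eqU: "?I y * \<bar>u y\<bar> = \<bar>Ue y\<bar> * ?I y" for y using elim by (auto simp: Ue_def indicator_def)
      have intI: "integrable lborel (\<lambda>y. \<bar>Ue y\<bar> * ?I y)"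
        using intU by (intro indicator_times_integrable_bound[where C=1]) (auto simp: indicator_def)
      have "\<bar>LINT y|lborel. B n y\<bar> \<le> (LINT y|lborel. \<bar>B n y\<bar>)" by (rule integral_abs_bound)
      also have "\<dots> \<le> (LINT y|lborel. (C' * \<delta> n powi (2 - 2 * int m)) * (\<bar>Ue y\<bar> * ?I y))"
      proof (rule integral_mono)
        fix y
        show "\<bar>B n y\<bar> \<le> (C' * \<delta> n powi (2 - 2 * int m)) * (\<bar>Ue y\<bar> * ?I y)"
        proof (cases "y \<noteq> 0 \<and> norm y \<le> 2 * \<delta> n")
          case True
          then have "?I y = 1" using \<delta>[of n] by (auto simp: indicator_def)
          then show ?thesis using Bb[of n y] by (simp add: B_def abs_mult mult.commute mult_left_mono)
        next
          case False
          then show ?thesis using \<delta>[of n] by (auto simp: B_def Ue_def C'_def indicator_def)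
        qed
      qed (use intB intI in auto)
      also have "\<dots> = (C' * \<delta> n powi (2 - 2 * int m)) * (LINT y|lborel. ?I y * \<bar>u y\<bar>)"
        by (simp add: eqU)
      also have "\<dots> \<le> (C' * \<delta> n powi (2 - 2 * int m)) * (\<epsilon>' * (3 * \<delta> n) ^ (2 * m - 2))"
        using elim \<delta>[of n] by (intro mult_left_mono) (auto simp: C'_def)
      also have "\<dots> = C' * \<epsilon>' * 3 ^ (2 * m - 2) * (\<delta> n powi (2 - 2 * int m) * \<delta> n ^ (2 * m - 2))"
        by (simp add: power_mult_distrib)
      \<comment> \<open>The two powers of \<delta> cancel exactly; no weaker power in the smallness
        hypothesis would do for this estimate.\<close>
      also have "\<delta> n powi (2 - 2 * int m) * \<delta> n ^ (2 * m - 2) = 1"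
      proof -
        have "\<delta> n ^ (2 * m - 2) = \<delta> n powi (2 * int m - 2)"
          using m by (simp add: power_int_def nat_diff_distrib nat_mult_distrib)
        then show ?thesis using \<delta>[of n] by (simp add: power_int_add[symmetric])
      qed
      also have "C' * \<epsilon>' * 3 ^ (2 * m - 2) * 1 < \<epsilon>"
      proof -
        have "C' * \<epsilon>' * 3 ^ (2 * m - 2) = \<epsilon> * (C' / (2 * (C' + 1)))" by (simp add: \<epsilon>'_def)
        also have "\<dots> < \<epsilon> * 1" using \<epsilon> by (intro mult_strict_left_mono) (auto simp: C'_def field_simps)
        finally show ?thesis by simp
      qed
      finally show ?case by simp
    qed
  qed
  have split: "(LINT y|lborel. Fe y * v (\<delta> n) y) = (LINT y|lborel. A n y) + (LINT y|lborel. B n y)" for n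
  proof -
    have "(LINT y|lborel. Fe y * v (\<delta> n) y) = (LINT y|lborel. Ue y * ?L (v (\<delta> n)) y)"
      using green[OF \<delta>(1)[of n]] by (simp add: Fe_def Ue_def mult_ac)
    also have "(\<lambda>y. Ue y * ?L (v (\<delta> n)) y) = (\<lambda>y. A n y + B n y)"
      using Lout[OF \<delta>(1)[of n]] by (auto simp: A_def B_def indicator_def fun_eq_iff)
    also have "(LINT y|lborel. A n y + B n y) = (LINT y|lborel. A n y) + (LINT y|lborel. B n y)"
      by (rule Bochner_Integration.integral_add[OF intA intB])
    finally show ?thesis .
  qed
  have "(LINT y|lborel. Fe y * \<psi> y) = (LINT y|lborel. Ue y * ?L \<psi> y) + 0"
    using lim1 tendsto_add[OF lim2 lim3] unfolding split by (rule LIMSEQ_unique)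
  then show ?thesis by (simp add: Fe_def Ue_def)
qed

subsection \<open>Truncated radial polynomials\<close>

text \<open>Order of vanishing at \<sigma> = 0, that is, at the edge of the support of the truncated
  profile. \<open>vanish (Suc k)\<close> makes the profile C^k (\<open>Ck_on_radial\<close>), and
  every Laplacian uses up two orders.\<close>

definition vanish :: "nat \<Rightarrow> real poly \<Rightarrow> bool" where
  "vanish k p \<longleftrightarrow> (\<forall>j<k. coeff p j = 0)"

text \<open>With \<open>\<sigma> = 1 - |y - x|\<^sup>2 / s\<close> and \<open>t = 1 - \<sigma>\<close>, the radial Laplacian in dimension \<open>2 m\<close> is
  \<open>4 t (d/dt)\<^sup>2 + 4 m (d/dt)\<close>; the following is its expression in the variable \<open>\<sigma>\<close>.\<close>

definition lap_poly :: "nat \<Rightarrow> real poly \<Rightarrow> real poly" where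
  "lap_poly m p = [:4, -4:] * pderiv (pderiv p) - smult (4 * real m) (pderiv p)"

definition radial :: "real poly \<Rightarrow> real \<Rightarrow> 'a::euclidean_space \<Rightarrow> 'a \<Rightarrow> real" where
  "radial p s x y = poly p (max 0 (1 - (norm (y - x))\<^sup>2 / s))"

lemma vanish_pderiv: "vanish (Suc k) p \<Longrightarrow> vanish k (pderiv p)"
  by (auto simp: vanish_def coeff_pderiv)

lemma vanish_le: "vanish k p \<Longrightarrow> j \<le> k \<Longrightarrow> vanish j p"
  by (auto simp: vanish_def)

lemma vanish_smult: "vanish k p \<Longrightarrow> vanish k (smult c p)"
  by (auto simp: vanish_def)

lemma vanish_diff: "vanish k p \<Longrightarrow> vanish k q \<Longrightarrow> vanish k (p - q)"
  by (auto simp: vanish_def)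

lemma vanish_linear_mult: "vanish k p \<Longrightarrow> vanish k ([:a, b:] * p)"
  by (auto simp: vanish_def coeff_pCons split: nat.splits)

lemma vanish_monom: "vanish k (monom c k)"
  by (auto simp: vanish_def)

lemma vanish_lap_poly: "vanish (Suc (Suc k)) p \<Longrightarrow> vanish k (lap_poly m p)"
  unfolding lap_poly_def
  by (intro vanish_diff vanish_linear_mult vanish_smult vanish_pderiv) (auto intro: vanish_le vanish_pderiv)

lemma vanish_lap_poly_pow: "vanish (2 * i + k) p \<Longrightarrow> vanish k ((lap_poly m ^^ i) p)"
proof (induction i arbitrary: k)
  case (Suc i)
  then show ?case using vanish_lap_poly[of k "(lap_poly m ^^ i) p"] by simp
qed simp

lemma vanish_poly_0: "vanish k p \<Longrightarrow> 0 < k \<Longrightarrow> poly p 0 = 0"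
  by (auto simp: vanish_def poly_0_coeff_0)

text \<open>A linear term would leave a corner at 0. Once it is excluded, differentiation commutes
  with truncation, so derivatives stay within the profiles given by polynomials.\<close>

lemma has_real_derivative_poly_pos_part:
  assumes "vanish 2 p"
  shows "((\<lambda>t. poly p (max 0 t)) has_real_derivative poly (pderiv p) (max 0 t)) (at t)"
proof -
  have eq: "poly p s = (\<Sum>j\<le>degree p. coeff p j * s ^ j)" for s by (rule poly_altdef)
  have D: "((\<lambda>t. coeff p j * max 0 t ^ j) has_real_derivative coeff p j * (real j * max 0 t ^ (j - 1))) (at t)" for j
  proof (cases "j < 2")
    case True
    then show ?thesis using assms by (simp add: vanish_def)
  next
    case False
    then have "j = Suc (j - 1)" "0 < j - 1" by auto
    then have "((\<lambda>t. max 0 t ^ j) has_real_derivative (real j * max 0 t ^ (j - 1))) (at t)"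
      using has_real_derivative_pos_part_power[of "j - 1" t] by simp
    then show ?thesis by (rule DERIV_cmult)
  qed
  have "((\<lambda>t. poly p (max 0 t)) has_real_derivative (\<Sum>j\<le>degree p. coeff p j * (real j * max 0 t ^ (j - 1)))) (at t)"
    unfolding eq by (intro DERIV_sum D)
  also have "(\<Sum>j\<le>degree p. coeff p j * (real j * max 0 t ^ (j - 1))) = poly (pderiv p) (max 0 t)"
  proof -
    have "((\<lambda>s. \<Sum>j\<le>degree p. coeff p j * s ^ j) has_real_derivative (\<Sum>j\<le>degree p. coeff p j * (real j * max 0 t ^ (j - 1)))) (at (max 0 t))"
      by (auto intro!: derivative_eq_intros sum.cong)
    then show ?thesis using poly_DERIV[of p "max 0 t"] unfolding eq[symmetric] by (rule DERIV_unique)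
  qed
  finally show ?thesis .
qed

lemma has_derivative_radial:
  assumes "vanish 2 p" "0 < s"
  shows "(radial p s x has_derivative (\<lambda>h. - (2 / s) * ((y - x) \<bullet> h) * radial (pderiv p) s x y)) (at y)"
proof -
  have "((\<lambda>y. 1 - (1 / s) * ((y - x) \<bullet> (y - x))) has_derivative (\<lambda>h. - (2 / s) * ((y - x) \<bullet> h))) (at y)"
    using assms(2) by (auto intro!: derivative_eq_intros simp: inner_commute)
  then have "((\<lambda>y. 1 - (norm (y - x))\<^sup>2 / s) has_derivative (\<lambda>h. - (2 / s) * ((y - x) \<bullet> h))) (at y)"
    unfolding power2_norm_eq_inner by simp
  from has_derivative_compose[OF this has_real_derivative_poly_pos_part[OF assms(1), unfolded has_field_derivative_def]]
  show ?thesis by (simp add: radial_def[abs_def] mult_ac)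
qed

lemma Ck_on_radial:
  fixes x :: "'a::euclidean_space"
  assumes "vanish (Suc k) p"
  shows "Ck_on k UNIV (radial p s x)"
proof -
  have eq: "radial p s x y = (\<Sum>j\<in>{Suc k..degree p}. coeff p j * max 0 (1 + (- 1 / s) * (norm (y - x))\<^sup>2) ^ j)" for y
    unfolding radial_def poly_altdef
    by (rule sum.mono_neutral_cong_right) (use assms in \<open>auto simp: vanish_def not_le\<close>)
  have "Ck_on k UNIV (\<lambda>y. \<Sum>j\<in>{Suc k..degree p}. coeff p j * max 0 (1 + (- 1 / s) * (norm (y - x))\<^sup>2) ^ j)"
    by (intro Ck_on_sum Ck_on_cmult Ck_on_pos_part_power Ck_on_add Ck_on_const Ck_on_norm_sq_diff open_UNIV) auto
  then show ?thesis by (rule Ck_on_cong[OF open_UNIV, rotated]) (simp add: eq)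
qed

lemma pderiv_dir_radial:
  "vanish 2 p \<Longrightarrow> 0 < s \<Longrightarrow> pderiv_dir i (radial p s x) y = - (2 / s) * ((y - x) \<bullet> i) * radial (pderiv p) s x y"
  by (rule pderiv_dir_eq[OF has_derivative_radial])

lemma laplacian_radial:
  fixes x :: "'a::euclidean_space"
  assumes dim: "DIM('a) = 2 * m" and p: "vanish 3 p" and s: "0 < s"
  shows "laplacian (radial p s x) = (\<lambda>y. (1 / s) * radial (lap_poly m p) s x y)"
proof
  fix y
  have p2: "vanish 2 p" and p': "vanish 2 (pderiv p)" and p'': "vanish 1 (pderiv (pderiv p))"
    using p by (auto intro!: vanish_pderiv intro: vanish_le simp: numeral_2_eq_2 numeral_3_eq_3)
  let ?r = "radial (pderiv p) s x" and ?q = "radial (pderiv (pderiv p)) s x"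
  have dd: "pderiv_dir i (pderiv_dir i (radial p s x)) y = - (2 / s) * ?r y + (4 / s\<^sup>2) * ((y - x) \<bullet> i)\<^sup>2 * ?q y"
    if i: "i \<in> Basis" for i
  proof -
    have "pderiv_dir i (radial p s x) = (\<lambda>y. - (2 / s) * ((y - x) \<bullet> i) * ?r y)"
      by (rule ext) (rule pderiv_dir_radial[OF p2 s])
    moreover have "((\<lambda>y. - (2 / s) * ((y - x) \<bullet> i) * ?r y) has_derivative
       (\<lambda>h. - (2 / s) * ((y - x) \<bullet> i) * (- (2 / s) * ((y - x) \<bullet> h) * ?q y) + - (2 / s) * (h \<bullet> i) * ?r y)) (at y)"
      by (intro has_derivative_mult has_derivative_radial[OF p' s]) (use s in \<open>auto intro!: derivative_eq_intros\<close>)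
    ultimately have "pderiv_dir i (pderiv_dir i (radial p s x)) y
       = - (2 / s) * ((y - x) \<bullet> i) * (- (2 / s) * ((y - x) \<bullet> i) * ?q y) + - (2 / s) * (i \<bullet> i) * ?r y"
      by (simp add: pderiv_dir_eq)
    then show ?thesis using i s by (simp add: power2_eq_square)
  qed
  have nsq: "(\<Sum>i\<in>Basis. ((y - x) \<bullet> i)\<^sup>2) = (norm (y - x))\<^sup>2"
    unfolding power2_norm_eq_inner by (subst euclidean_inner[of "y - x" "y - x"]) (simp add: power2_eq_square)
  have "laplacian (radial p s x) y = (\<Sum>i\<in>Basis. - (2 / s) * ?r y + (4 / s\<^sup>2) * ((y - x) \<bullet> i)\<^sup>2 * ?q y)"
    unfolding laplacian_def by (rule sum.cong) (auto simp: dd)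
  also have "\<dots> = real (2 * m) * (- (2 / s) * ?r y) + (\<Sum>i\<in>Basis. (4 / s\<^sup>2) * ?q y * ((y - x) \<bullet> i)\<^sup>2)"
    by (subst sum.distrib) (simp add: dim mult_ac)
  also have "(\<Sum>i\<in>Basis. (4 / s\<^sup>2) * ?q y * ((y - x) \<bullet> i)\<^sup>2) = (4 / s\<^sup>2) * ?q y * (norm (y - x))\<^sup>2"
    by (simp only: sum_distrib_left[symmetric] nsq)
  also have "(4 / s\<^sup>2) * ?q y * (norm (y - x))\<^sup>2 = (4 / s) * ((norm (y - x))\<^sup>2 / s * ?q y)"
    by (simp add: power2_eq_square)
  \<comment> \<open>Inside the support this is the substitution t = 1 - \<sigma>; outside, both
    sides vanish because the second derivative of p has no constant term.\<close>
  also have "(norm (y - x))\<^sup>2 / s * ?q y = (1 - max 0 (1 - (norm (y - x))\<^sup>2 / s)) * ?q y"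
    using vanish_poly_0[OF p''] by (cases "(norm (y - x))\<^sup>2 / s < 1") (auto simp: max_def radial_def)
  also have "real (2 * m) * (- (2 / s) * ?r y) + (4 / s) * ((1 - max 0 (1 - (norm (y - x))\<^sup>2 / s)) * ?q y)
      = (1 / s) * radial (lap_poly m p) s x y"
    by (simp add: lap_poly_def radial_def algebra_simps)
  finally show "laplacian (radial p s x) y = (1 / s) * radial (lap_poly m p) s x y" .
qed

lemma laplacian_pow_radial:
  fixes x :: "'a::euclidean_space"
  assumes dim: "DIM('a) = 2 * m" and p: "vanish (2 * i + 1) p" and s: "0 < s"
  shows "(laplacian ^^ i) (radial p s x) = (\<lambda>y. (1 / s) ^ i * radial ((lap_poly m ^^ i) p) s x y)"
  using p
proof (induction i)
  case (Suc i)
  let ?q = "(lap_poly m ^^ i) p"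
  have q: "vanish 3 ?q" by (intro vanish_lap_poly_pow vanish_le[OF Suc.prems]) simp
  have "(laplacian ^^ Suc i) (radial p s x) = laplacian (\<lambda>y. (1 / s) ^ i * radial ?q s x y)"
    using Suc.IH vanish_le[OF Suc.prems] by simp
  also have "\<dots> = (\<lambda>y. (1 / s) ^ i * laplacian (radial ?q s x) y)"
  proof
    have "vanish (Suc (2 * Suc 0)) ?q" using q by (simp add: numeral_3_eq_3)
    from Ck_on_radial[OF this, of s x] show "laplacian (\<lambda>y. (1 / s) ^ i * radial ?q s x y) y = (1 / s) ^ i * laplacian (radial ?q s x) y" for y
      using laplacian_pow_cmult[of UNIV "Suc 0" "radial ?q s x" y "(1 / s) ^ i"]
      by (simp del: Ck_on.simps add: numeral_2_eq_2)
  qed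
  finally show ?case by (simp add: laplacian_radial[OF dim q s] mult_ac)
qed simp

lemma continuous_on_radial: "continuous_on UNIV (radial p s x)"
  unfolding radial_def
  by (rule continuous_on_compose2[of UNIV "poly p"]) (auto intro!: continuous_intros simp: divide_inverse)

lemma borel_measurable_radial [measurable]: "radial p s x \<in> borel_measurable borel"
  by (rule borel_measurable_continuous_onI[OF continuous_on_radial])

lemma radial_eq_0: "vanish 1 p \<Longrightarrow> 0 < s \<Longrightarrow> s \<le> (norm (y - x))\<^sup>2 \<Longrightarrow> radial p s x y = 0"
  using vanish_poly_0[of 1 p] by (auto simp: radial_def max_def)

lemma radial_support:
  fixes x :: "'a::euclidean_space"
  assumes "vanish 1 p" "0 < s" "norm x + sqrt s < norm y"
  shows "radial p s x y = 0"
proof (rule radial_eq_0[OF assms(1,2)])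
  have "sqrt s \<le> norm (y - x)" using assms(3) norm_triangle_ineq2[of y x] by simp
  then have "(sqrt s)\<^sup>2 \<le> (norm (y - x))\<^sup>2" using assms(2) by (intro power_mono) auto
  then show "s \<le> (norm (y - x))\<^sup>2" using assms(2) by simp
qed

lemma integrable_radial:
  fixes x :: "'a::euclidean_space"
  assumes "vanish 1 p" "0 < s"
  shows "integrable lborel (radial p s x)"
  by (rule integrable_compact_support[OF continuous_on_radial radial_support[OF assms]])

lemma integral_radial_scale:
  fixes x :: "'a::euclidean_space"
  assumes dim: "DIM('a) = 2 * m" and s: "0 < s"
  shows "(LINT y|lborel. radial p s x y) = s ^ m * (LINT y|lborel. radial p 1 (0::'a) y)"
proof -
  have "(LINT y|lborel. radial p s x y) = (LINT y|density (distr lborel borel (\<lambda>y. x + sqrt s *\<^sub>R y)) (\<lambda>_. \<bar>sqrt s\<bar> ^ DIM('a)). radial p s x y)"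
    using lborel_affine[of "sqrt s" x] s by simp
  also have "\<dots> = (LINT y|distr lborel borel (\<lambda>y. x + sqrt s *\<^sub>R y). \<bar>sqrt s\<bar> ^ DIM('a) *\<^sub>R radial p s x y)"
    by (rule integral_density) (auto simp: AE_I2)
  also have "\<dots> = (LINT y|lborel. \<bar>sqrt s\<bar> ^ DIM('a) *\<^sub>R radial p s x (x + sqrt s *\<^sub>R y))"
    by (rule integral_distr) auto
  also have "\<dots> = (LINT y|lborel. s ^ m * radial p 1 (0::'a) y)"
  proof (intro Bochner_Integration.integral_cong refl)
    fix y :: 'a
    have "\<bar>sqrt s\<bar> ^ DIM('a) = s ^ m" using s dim by (simp add: power_mult)
    moreover have "radial p s x (x + sqrt s *\<^sub>R y) = radial p 1 0 y"
      using s by (simp add: radial_def power_mult_distrib)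
    ultimately show "\<bar>sqrt s\<bar> ^ DIM('a) *\<^sub>R radial p s x (x + sqrt s *\<^sub>R y) = s ^ m * radial p 1 0 y" by simp
  qed
  finally show ?thesis by simp
qed

lemma integral_laplacian_eq_0:
  fixes f :: "'a::euclidean_space \<Rightarrow> real"
  assumes C2: "Ck_on 2 UNIV f" and supp: "\<And>y. R < norm y \<Longrightarrow> f y = 0"
  shows "(LINT y|lborel. laplacian f y) = 0"
proof -
  have C: "Ck_on (Suc (Suc 0)) UNIV f" using C2 by (simp only: numeral_2_eq_2)
  have "Ck_on (Suc 0) UNIV (pderiv_dir i f)" if "i \<in> Basis" for i using C that by simp
  moreover have "pderiv_dir i f y = 0" if "R < norm y" for i y
    by (rule pderiv_dir_eq_0[OF open_norm_greater[of R]]) (use that supp in auto)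
  ultimately show ?thesis unfolding laplacian_def
    using integral_pderiv_dir_eq_0[of "pderiv_dir _ f" R]
    by (subst Bochner_Integration.integral_sum) auto
qed

section \<open>Moments of truncated powers and the mass of the mollifier\<close>

lemma lap_poly_0: "lap_poly m 0 = 0"
  by (simp add: lap_poly_def)

lemma lap_poly_monom:
  "lap_poly m (monom c (Suc (Suc i))) = monom (4 * c * real (i + 2) * real (i + 1)) i - monom (4 * c * real (i + 2) * real (i + 1 + m)) (Suc i)"
proof -
  have q: "[:4, -4:] * monom a i = monom (4 * a) i - monom (4 * a) (Suc i)" for a :: real
    by (rule poly_eqI) (simp add: coeff_pCons split: nat.splits)
  have "lap_poly m (monom c (Suc (Suc i))) = monom (4 * (real (i + 1) * (real (i + 2) * c))) i
      - monom (4 * (real (i + 1) * (real (i + 2) * c))) (Suc i) - monom (4 * real m * (real (i + 2) * c)) (Suc i)"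
    unfolding lap_poly_def pderiv_monom q[symmetric] by (simp add: smult_monom pderiv_monom)
  then show ?thesis by (simp add: diff_diff_eq add_monom algebra_simps)
qed

definition bump_moment :: "'a::euclidean_space itself \<Rightarrow> nat \<Rightarrow> real" where
  "bump_moment _ k = (LINT y|lborel. radial (monom 1 k) 1 (0::'a) y)"

text \<open>The Laplacian of the (k + 1)-st truncated power has integral zero, and by
  \<open>lap_poly_monom\<close> it combines the powers k - 1 and k. This takes the place of polar
  coordinates. The bound on k makes the (k + 1)-st power C^2.\<close>

lemma bump_moment_Suc:
  assumes dim: "DIM('a::euclidean_space) = 2 * m" and k: "2 \<le> k"
  shows "real (k + m) * bump_moment TYPE('a) k = real k * bump_moment TYPE('a) (k - 1)"
proof -
  obtain j where j: "k = Suc j" "1 \<le> j" using k by (cases k) auto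
  have v: "vanish (Suc k) (monom 1 (Suc k) :: real poly)" by (rule vanish_monom)
  have v3: "vanish 3 (monom 1 (Suc k) :: real poly)" by (rule vanish_le[OF v]) (use k in auto)
  have "vanish (Suc 2) (monom 1 (Suc k) :: real poly)" using v3 by (simp add: numeral_3_eq_3)
  from Ck_on_radial[OF this]
  have 0: "(LINT y|lborel. laplacian (radial (monom 1 (Suc k)) 1 (0::'a)) y) = 0"
    by (rule integral_laplacian_eq_0[OF _ radial_support]) (auto intro: vanish_le[OF v])
  have lp: "lap_poly m (monom 1 (Suc k)) = smult (4 * real (Suc k) * real k) (monom 1 (k - 1)) - smult (4 * real (Suc k) * real (k + m)) (monom 1 k)"
    unfolding j lap_poly_monom by (simp add: smult_monom algebra_simps)
  have int: "integrable lborel (radial (monom 1 l) 1 (0::'a))" if "1 \<le> l" for l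
    using that by (intro integrable_radial vanish_le[OF vanish_monom]) auto
  have rad: "laplacian (radial (monom 1 (Suc k)) 1 (0::'a)) y = (4 * real (Suc k) * real k) * radial (monom 1 (k - 1)) 1 0 y - (4 * real (Suc k) * real (k + m)) * radial (monom 1 k) 1 0 y" for y
    unfolding laplacian_radial[OF dim v3 zero_less_one] lp by (simp add: radial_def)
  have "0 = (4 * real (Suc k) * real k) * bump_moment TYPE('a) (k - 1) - (4 * real (Suc k) * real (k + m)) * bump_moment TYPE('a) k"
    using 0 int[of k] int[of "k - 1"] k unfolding rad bump_moment_def by (subst (asm) Bochner_Integration.integral_diff) auto
  also have "\<dots> = 4 * real (Suc k) * (real k * bump_moment TYPE('a) (k - 1) - real (k + m) * bump_moment TYPE('a) k)"
    by (simp add: algebra_simps)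
  finally show ?thesis by simp
qed

lemma bump_moment_eq:
  assumes dim: "DIM('a::euclidean_space) = 2 * m" and k: "1 \<le> k"
  shows "bump_moment TYPE('a) k = (bump_moment TYPE('a) 1 * fact (m + 1)) * (fact k / fact (k + m))"
  using k
proof (induction k rule: dec_induct)
  case (step k)
  have "real (Suc k + m) * bump_moment TYPE('a) (Suc k) = real (Suc k) * bump_moment TYPE('a) k"
    using bump_moment_Suc[OF dim, of "Suc k"] step by simp
  then have "bump_moment TYPE('a) (Suc k) = real (Suc k) * bump_moment TYPE('a) k / real (Suc k + m)"
    by (subst nonzero_eq_divide_eq) (simp_all add: mult.commute)
  then show ?case unfolding step.IH by (simp add: mult_ac)
qed simp

lemma bump_moment_pos: "0 < bump_moment TYPE('a::euclidean_space) 1"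
proof -
  let ?b = "radial (monom 1 1) 1 (0::'a)"
  have nn: "0 \<le> ?b y" for y by (simp add: radial_def poly_monom)
  have int: "integrable lborel ?b" by (intro integrable_radial vanish_monom) auto
  have "bump_moment TYPE('a) 1 \<noteq> 0"
  proof
    assume "bump_moment TYPE('a) 1 = 0"
    then have "AE y in lborel. ?b y = 0"
      unfolding bump_moment_def using integral_nonneg_eq_0_iff_AE[OF int] nn by auto
    moreover have "y \<notin> ball 0 1" if "?b y = 0" for y
      using that power_less_one_iff[of "norm y" 2] by (auto simp: radial_def poly_monom max_def split: if_splits)
    ultimately have "AE y in lborel. y \<notin> ball (0::'a) 1" by (rule eventually_mono)
    then have "ball (0::'a) 1 \<in> null_sets lborel" by (subst AE_iff_null_sets) auto
    then show False using content_ball_pos[of 1 "0::'a"] by (auto simp: measure_def)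
  qed
  moreover have "0 \<le> bump_moment TYPE('a) 1" unfolding bump_moment_def using nn by simp
  ultimately show ?thesis by simp
qed

text \<open>Up to a constant, \<open>beta_mom j p\<close> is the integral of \<open>t^(j-1) p(1-t)\<close> over \<open>0 < t < 1\<close>.\<close>

definition beta_mom :: "nat \<Rightarrow> real poly \<Rightarrow> real" where
  "beta_mom j p = (\<Sum>k\<le>degree p. coeff p k * (fact k / fact (k + j)))"

lemma beta_mom_altdef:
  assumes "degree p \<le> n"
  shows "beta_mom j p = (\<Sum>k\<le>n. coeff p k * (fact k / fact (k + j)))"
  unfolding beta_mom_def using assms
  by (intro sum.mono_neutral_left) (auto simp: coeff_eq_0)

lemma beta_mom_add: "beta_mom j (p + q) = beta_mom j p + beta_mom j q"
proof -
  define n where "n = max (degree p) (degree q)"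
  have "degree p \<le> n" "degree q \<le> n" "degree (p + q) \<le> n" by (auto simp: n_def degree_add_le)
  then show ?thesis by (simp add: beta_mom_altdef sum.distrib distrib_right add_divide_distrib)
qed

lemma beta_mom_smult: "beta_mom j (smult c p) = c * beta_mom j p"
  using beta_mom_altdef[of "smult c p" "degree p"]
  by (simp add: beta_mom_def sum_distrib_left mult_ac degree_smult_le)

lemma beta_mom_0: "beta_mom j 0 = 0"
  by (simp add: beta_mom_def)

lemma beta_mom_sum: "beta_mom j (\<Sum>a\<in>A. f a) = (\<Sum>a\<in>A. beta_mom j (f a))"
  by (induction A rule: infinite_finite_induct) (auto simp: beta_mom_add beta_mom_0)

lemma beta_mom_monom: "beta_mom j (monom c k) = c * (fact k / fact (k + j))"
proof -
  have "beta_mom j (monom c k) = (\<Sum>i\<le>k. if i = k then c * (fact k / fact (k + j)) else 0)"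
    by (subst beta_mom_altdef[OF degree_monom_le]) (rule sum.cong, auto)
  then show ?thesis by simp
qed

lemma lap_poly_add: "lap_poly m (p + q) = lap_poly m p + lap_poly m q"
  by (simp add: lap_poly_def pderiv_add algebra_simps smult_add_right)

lemma lap_poly_sum: "lap_poly m (\<Sum>a\<in>A. f a) = (\<Sum>a\<in>A. lap_poly m (f a))"
  by (induction A rule: infinite_finite_induct) (simp_all add: lap_poly_add lap_poly_0)

text \<open>In the variable t this is integration by parts applied to 4 t q'' + 4 m q' against a
  power of t; it is verified here on monomials through factorials. With k \<ge> 2 there are no
  boundary terms at t = 1.\<close>

lemma beta_mom_lap_poly_monom:
  assumes "2 \<le> k"
  shows "beta_mom (Suc j) (lap_poly m (monom c k)) = 4 * (real (Suc j) - real m) * beta_mom j (monom c k)"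
proof -
  obtain i where k: "k = Suc (Suc i)" using assms by (intro that[of "k - 2"]) simp
  have diff: "beta_mom (Suc j) (p - q) = beta_mom (Suc j) p - beta_mom (Suc j) q" for p q
  proof -
    have "beta_mom (Suc j) (p - q) = beta_mom (Suc j) (p + smult (- 1) q)" by simp
    also have "\<dots> = beta_mom (Suc j) p - beta_mom (Suc j) q" unfolding beta_mom_add beta_mom_smult by simp
    finally show ?thesis .
  qed
  define A :: real where "A = fact (i + j + 1)"
  have A: "A \<noteq> 0" by (simp add: A_def)
  have f: "fact (i + Suc j) = A" "fact (Suc i + Suc j) = real (i + j + 2) * A" "fact (Suc (Suc i) + j) = real (i + j + 2) * A"
    by (simp_all add: A_def algebra_simps)
  show ?thesis unfolding k lap_poly_monom diff beta_mom_monom f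
    using A by (simp add: divide_simps) (simp add: algebra_simps)
qed

lemma beta_mom_lap_poly:
  assumes "vanish 2 p"
  shows "beta_mom (Suc j) (lap_poly m p) = 4 * (real (Suc j) - real m) * beta_mom j p"
proof -
  have p: "p = (\<Sum>k\<le>degree p. monom (coeff p k) k)" by (rule poly_as_sum_of_monoms[symmetric])
  have "beta_mom (Suc j) (lap_poly m (monom (coeff p k) k)) = 4 * (real (Suc j) - real m) * beta_mom j (monom (coeff p k) k)" for k
  proof (cases "2 \<le> k")
    case False
    then show ?thesis using assms by (simp add: vanish_def beta_mom_0 lap_poly_def)
  qed (rule beta_mom_lap_poly_monom)
  then show ?thesis
    by (subst (1 2) p) (simp add: lap_poly_sum beta_mom_sum sum_distrib_left)
qed

lemma beta_mom_lap_poly_pow: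
  assumes "vanish (2 * i) p"
  shows "beta_mom (j + i) ((lap_poly m ^^ i) p) = (\<Prod>r=1..i. 4 * (real (j + r) - real m)) * beta_mom j p"
  using assms
proof (induction i)
  case (Suc i)
  have "vanish 2 ((lap_poly m ^^ i) p)" using Suc.prems by (intro vanish_lap_poly_pow) simp
  then show ?case using beta_mom_lap_poly[of "(lap_poly m ^^ i) p" "j + i" m] Suc.IH vanish_le[OF Suc.prems]
    by (simp add: mult_ac)
qed simp

text \<open>In dimension 2 m the radial measure is a multiple of t^(m-1) dt with t = |y|^2, so the
  index m of \<open>beta_mom\<close> is the one that measures mass. The constant comes from solving
  the recurrence for the moments down to the first one.\<close>

lemma integral_radial_eq_beta_mom:
  assumes dim: "DIM('a::euclidean_space) = 2 * m" and p: "vanish 1 p"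
  shows "(LINT y|lborel. radial p 1 (0::'a) y) = (bump_moment TYPE('a) 1 * fact (m + 1)) * beta_mom m p"
proof -
  have rad: "radial p 1 (0::'a) y = (\<Sum>k\<in>{1..degree p}. coeff p k * radial (monom 1 k) 1 0 y)" for y
  proof -
    have "radial p 1 0 y = (\<Sum>k\<le>degree p. coeff p k * radial (monom 1 k) 1 0 y)"
      by (simp add: radial_def poly_altdef[of p] poly_monom)
    also have "\<dots> = (\<Sum>k\<in>{1..degree p}. coeff p k * radial (monom 1 k) 1 0 y)"
      by (rule sum.mono_neutral_right) (use p in \<open>auto simp: vanish_def not_le\<close>)
    finally show ?thesis .
  qed
  have int: "integrable lborel (radial (monom 1 k) 1 (0::'a))" if "1 \<le> k" for k
    using that by (intro integrable_radial vanish_le[OF vanish_monom]) auto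
  have "(LINT y|lborel. radial p 1 (0::'a) y) = (\<Sum>k\<in>{1..degree p}. coeff p k * bump_moment TYPE('a) k)"
    unfolding rad bump_moment_def using int by (subst Bochner_Integration.integral_sum) auto
  also have "\<dots> = (\<Sum>k\<in>{1..degree p}. (bump_moment TYPE('a) 1 * fact (m + 1)) * (coeff p k * (fact k / fact (k + m))))"
  proof (intro sum.cong refl)
    fix k assume "k \<in> {1..degree p}"
    then have "bump_moment TYPE('a) k = (bump_moment TYPE('a) 1 * fact (m + 1)) * (fact k / fact (k + m))"
      by (intro bump_moment_eq[OF dim]) auto
    note * = this
    show "coeff p k * bump_moment TYPE('a) k = (bump_moment TYPE('a) 1 * fact (m + 1)) * (coeff p k * (fact k / fact (k + m)))"
      by (subst *) (simp only: mult_ac)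
  qed
  also have "\<dots> = (bump_moment TYPE('a) 1 * fact (m + 1)) * (\<Sum>k\<in>{1..degree p}. coeff p k * (fact k / fact (k + m)))"
    by (simp add: sum_distrib_left)
  also have "(\<Sum>k\<in>{1..degree p}. coeff p k * (fact k / fact (k + m))) = beta_mom m p"
    unfolding beta_mom_def by (rule sum.mono_neutral_left) (use p in \<open>auto simp: vanish_def not_le\<close>)
  finally show ?thesis .
qed

text \<open>Differentiating a radial Laplacian in t amounts to raising the dimension by two. This
  carries the derivative in \<open>mollifier_poly\<close> through to the monomial.\<close>

lemma pderiv_lap_poly: "pderiv (lap_poly m p) = lap_poly (Suc m) (pderiv p)"
  by (rule poly_eqI) (auto simp: lap_poly_def coeff_pderiv coeff_pCons algebra_simps split: nat.splits)

lemma pderiv_lap_poly_pow: "pderiv ((lap_poly m ^^ i) p) = (lap_poly (Suc m) ^^ i) (pderiv p)"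
  by (induction i) (auto simp: pderiv_lap_poly)

text \<open>Chosen so that the \<open>s\<close>-derivative of the kernel \<open>s\<^sup>-\<^sup>m Q(\<sigma>)\<close> is \<open>-1/s\<close> times the \<open>m\<close>-th Laplacian power
  of \<open>\<sigma>\<^sub>+\<^sup>N\<close> with \<open>N = 2 m + 1\<close>.\<close>

definition mollifier_poly :: "nat \<Rightarrow> real poly" where
  "mollifier_poly m = smult (-4) (pderiv ((lap_poly m ^^ (m - 1)) (monom 1 (2 * m + 1))))"

lemma vanish_mollifier_poly: "1 \<le> m \<Longrightarrow> vanish 2 (mollifier_poly m)"
  unfolding mollifier_poly_def
  by (intro vanish_smult vanish_pderiv vanish_lap_poly_pow vanish_le[OF vanish_monom]) auto

text \<open>The m - 1 Laplacians lead from \<open>beta_mom 1\<close> to \<open>beta_mom m\<close>,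
  the r-th contributing the negative factor 4 (r - m). With the factor -4 in
  \<open>mollifier_poly\<close> there are m negative factors and none is zero. The derivative inside
  the definition is what shifts r - (m - 1) to r - m and so avoids a vanishing factor.\<close>

lemma mollifier_poly_mass:
  assumes dim: "DIM('a::euclidean_space) = 2 * m" and m: "1 \<le> m"
  shows "0 < (-1) ^ m * (LINT y|lborel. radial (mollifier_poly m) 1 (0::'a) y)"
proof -
  obtain i where i: "m = Suc i" using m by (cases m) auto
  let ?q = "pderiv (monom 1 (2 * m + 1)) :: real poly"
  have q: "?q = monom (real (2 * m + 1)) (2 * m)" by (simp add: pderiv_monom)
  have "vanish 1 (mollifier_poly m)" by (rule vanish_le[OF vanish_mollifier_poly[OF m]]) simp
  then have "(LINT y|lborel. radial (mollifier_poly m) 1 (0::'a) y) = (bump_moment TYPE('a) 1 * fact (m + 1)) * beta_mom m (mollifier_poly m)"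
    by (rule integral_radial_eq_beta_mom[OF dim])
  also have "beta_mom m (mollifier_poly m) = -4 * beta_mom (1 + i) ((lap_poly (Suc m) ^^ i) ?q)"
    unfolding mollifier_poly_def beta_mom_smult pderiv_lap_poly_pow by (simp add: i)
  also have "beta_mom (1 + i) ((lap_poly (Suc m) ^^ i) ?q) = (\<Prod>r=1..i. 4 * (real (1 + r) - real (Suc m))) * beta_mom 1 ?q"
    unfolding q by (rule beta_mom_lap_poly_pow) (auto intro: vanish_le[OF vanish_monom] simp: i)
  \<comment> \<open>This is the integral over the unit interval of the derivative of the power 2 m +
    1.\<close>
  also have "beta_mom 1 ?q = 1" unfolding q beta_mom_monom by simp
  also have "(\<Prod>r=1..i. 4 * (real (1 + r) - real (Suc m))) = (\<Prod>r=1..i. (-1) * (4 * (real m - real r)))"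
    by (intro prod.cong) auto
  also have "\<dots> = (-1) ^ i * (\<Prod>r=1..i. 4 * (real m - real r))" by (subst prod.distrib) simp
  finally have eq: "(-1) ^ m * (LINT y|lborel. radial (mollifier_poly m) 1 (0::'a) y) =
     4 * bump_moment TYPE('a) 1 * fact (m + 1) * (\<Prod>r=1..i. 4 * (real m - real r)) * ((-1) ^ i * (-1) ^ i)"
    by (simp add: i)
  have "0 < (\<Prod>r=1..i. 4 * (real m - real r))" by (intro prod_pos) (auto simp: i)
  moreover have "(-1) ^ i * (-1) ^ i = (1::real)" by (simp flip: power_add add: mult_2[symmetric])
  ultimately show ?thesis unfolding eq using bump_moment_pos[where 'a='a] by simp
qed

subsection \<open>The truncated logarithmic kernel\<close>

text \<open>The finite exceptional set accommodates the point \<tau> = 1 of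
  \<open>log_kernel\<close>, where its two formulas meet.\<close>

lemma lborel_integral_FTC:
  fixes F f :: "real \<Rightarrow> real"
  assumes "finite S" "a \<le> b" "continuous_on {a..b} f" "continuous_on {a..b} F"
    "\<And>s. s \<in> {a<..<b} - S \<Longrightarrow> (F has_real_derivative f s) (at s)"
  shows "(LINT s|lborel. indicator {a..b} s * f s) = F b - F a"
proof -
  have "(f has_integral (F b - F a)) {a..b}"
    using assms by (intro fundamental_theorem_of_calculus_interior_strong)
      (auto simp: has_real_derivative_iff_has_vector_derivative[symmetric])
  moreover have "set_integrable lborel {a..b} f"
    unfolding set_integrable_def using assms(3) by (intro borel_integrable_compact) auto
  then have "(LINT s:{a..b}|lborel. f s) = integral {a..b} f" by (rule set_borel_integral_eq_integral)
  ultimately show ?thesis by (simp add: set_lebesgue_integral_def integral_unique)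
qed

text \<open>The kernel is bounded only for s in a compact interval; the kernels it is applied to
  blow up as s tends to 0, which is why a lower limit \<epsilon> is kept until the very end of the
  representation formula.\<close>

lemma lborel_Fubini_bounded_kernel:
  fixes g :: "'a::euclidean_space \<Rightarrow> real" and w :: "real \<Rightarrow> 'a \<Rightarrow> real"
  assumes g: "integrable lborel g" and w: "(\<lambda>(s, y). w s y) \<in> borel_measurable (borel \<Otimes>\<^sub>M borel)"
    and C: "\<forall>s\<in>{a..b}. \<forall>y. \<bar>w s y\<bar> \<le> C"
  shows "(LINT s|lborel. indicator {a..b} s * (LINT y|lborel. g y * w s y))
       = (LINT y|lborel. g y * (LINT s|lborel. indicator {a..b} s * w s y))"
    and "integrable lborel (\<lambda>s. indicator {a..b} s * (LINT y|lborel. g y * w s y))"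
    and "integrable lborel (\<lambda>y. g y * (LINT s|lborel. indicator {a..b} s * w s y))"
proof -
  note [measurable] = w borel_measurable_integrable[OF g]
  let ?f = "\<lambda>s y. g y * (indicator {a..b} s * w s y)"
  have bnd: "\<bar>?f s y\<bar> \<le> \<bar>g y\<bar> * (indicator {a..b} s * \<bar>C\<bar>)" for s y
  proof (cases "s \<in> {a..b}")
    case True
    then have "\<bar>w s y\<bar> \<le> \<bar>C\<bar>" using C by (meson abs_ge_self order_trans)
    then show ?thesis using True by (simp add: abs_mult mult_left_mono)
  qed simp
  have ints: "integrable lborel (\<lambda>s. indicator {a..b} s * \<bar>C\<bar>)"
    using borel_integrable_compact[of "{a..b}" "\<lambda>_. \<bar>C\<bar>"] by simp
  have "integrable (lborel \<Otimes>\<^sub>M lborel) (\<lambda>(s, y). \<bar>g y\<bar> * (indicator {a..b} s * \<bar>C\<bar>))"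
  proof (rule lborel_pair.Fubini_integrable)
    show "integrable lborel (\<lambda>s::real. LINT y|lborel. norm (case (s, y) of (s, y) \<Rightarrow> \<bar>g y\<bar> * (indicator {a..b} s * \<bar>C\<bar>)))"
      using ints by (simp add: abs_mult)
    show "AE s::real in lborel. integrable lborel (\<lambda>y. case (s, y) of (s, y) \<Rightarrow> \<bar>g y\<bar> * (indicator {a..b} s * \<bar>C\<bar>))"
      using g by auto
  qed measurable
  then have int: "integrable (lborel \<Otimes>\<^sub>M lborel) (\<lambda>(s, y). ?f s y)"
    by (rule Bochner_Integration.integrable_bound) (use bnd in \<open>auto simp: split_beta\<close>)
  have 1: "(LINT y|lborel. ?f s y) = indicator {a..b} s * (LINT y|lborel. g y * w s y)" for s
    by (simp add: mult.left_commute[of "g _"])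
  have 2: "(LINT s|lborel. ?f s y) = g y * (LINT s|lborel. indicator {a..b} s * w s y)" for y
    by simp
  show "(LINT s|lborel. indicator {a..b} s * (LINT y|lborel. g y * w s y))
       = (LINT y|lborel. g y * (LINT s|lborel. indicator {a..b} s * w s y))"
    using lborel_pair.Fubini_integral[OF int] unfolding 1 2 by simp
  show "integrable lborel (\<lambda>s. indicator {a..b} s * (LINT y|lborel. g y * w s y))"
    using lborel_pair.integrable_fst'[OF int] unfolding prod.case 1 .
  show "integrable lborel (\<lambda>y. g y * (LINT s|lborel. indicator {a..b} s * w s y))"
    using lborel_pair.integrable_snd[OF int] unfolding 2 .
qed

text \<open>A closed form of the integral of \<open>(1 - v)\<^sup>N / v\<close> over \<open>\<tau> < v < 1\<close>: logarithmic at \<open>0\<close>, zero beyond \<open>1\<close>.\<close>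

definition log_kernel :: "nat \<Rightarrow> real \<Rightarrow> real" where
  "log_kernel N \<tau> = - ln (min \<tau> 1) - (\<Sum>k=1..N. max 0 (1 - \<tau>) ^ k / real k)"

lemma log_kernel_eq_0: "1 \<le> \<tau> \<Longrightarrow> log_kernel N \<tau> = 0"
  by (auto simp: log_kernel_def min_def max_def power_0_left intro!: sum.neutral)

lemma has_real_derivative_log_kernel:
  assumes "0 < \<tau>" "\<tau> \<noteq> 1" "1 \<le> N"
  shows "(log_kernel N has_real_derivative - (max 0 (1 - \<tau>) ^ N / \<tau>)) (at \<tau>)"
proof (cases "\<tau> < 1")
  case True
  have "((\<lambda>\<tau>. - ln \<tau> - (\<Sum>k=1..N. (1 - \<tau>) ^ k / real k)) has_real_derivative
     - (1 / \<tau>) - (\<Sum>k=1..N. - ((1 - \<tau>) ^ (k - 1)))) (at \<tau>)"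
    using assms by (auto intro!: derivative_eq_intros sum.cong simp: divide_inverse)
  also have "(\<Sum>k=1..N. - ((1 - \<tau>) ^ (k - 1))) = - (\<Sum>k<N. (1 - \<tau>) ^ k)"
    by (simp add: sum_negf sum.atLeast1_atMost_eq lessThan_atLeast0)
  also have "(\<Sum>k<N. (1 - \<tau>) ^ k) = (1 - (1 - \<tau>) ^ N) / \<tau>"
    using assms sum_gp_strict[of "1 - \<tau>" N] by simp
  also have "- (1 / \<tau>) - - ((1 - (1 - \<tau>) ^ N) / \<tau>) = - (max 0 (1 - \<tau>) ^ N / \<tau>)"
    using True by (simp add: diff_divide_distrib max_def)
  finally show ?thesis
    by (rule has_field_derivative_transform_within_open[where S = "{0<..<1}"])
       (use assms True in \<open>auto simp: log_kernel_def min_def max_def\<close>)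
next
  case False
  have "((\<lambda>\<tau>. 0) has_real_derivative - (max 0 (1 - \<tau>) ^ N / \<tau>)) (at \<tau>)"
    using False assms by (simp add: max_def power_0_left)
  then show ?thesis
    by (rule has_field_derivative_transform_within_open[where S = "{1<..}"])
       (use assms False in \<open>auto simp: log_kernel_eq_0\<close>)
qed

lemma continuous_on_log_kernel: "continuous_on {0<..} (log_kernel N)"
  unfolding log_kernel_def by (intro continuous_intros) auto

lemma borel_measurable_log_kernel [measurable]: "log_kernel N \<in> borel_measurable borel"
  unfolding log_kernel_def by measurable

text \<open>The measure ds/s is invariant, up to orientation, under s -> t / s, so integrating the
  truncated power against it produces \<open>log_kernel\<close> at both ends.\<close>

lemma integral_log_kernel:
  assumes "0 < t" "0 < a" "a \<le> b" "1 \<le> N"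
  shows "(LINT s|lborel. indicator {a..b} s * (max 0 (1 - t / s) ^ N / s)) = log_kernel N (t / b) - log_kernel N (t / a)"
proof (rule lborel_integral_FTC[where S = "{t}"])
  show "continuous_on {a..b} (\<lambda>s. max 0 (1 - t / s) ^ N / s)"
    using assms by (auto intro!: continuous_intros)
  show "continuous_on {a..b} (\<lambda>s. log_kernel N (t / s))"
    using assms by (intro continuous_on_compose2[OF continuous_on_log_kernel] continuous_intros) auto
  fix s assume s: "s \<in> {a<..<b} - {t}"
  have s0: "s > 0" using s assms by auto
  have "((\<lambda>s. t / s) has_real_derivative - (t / s\<^sup>2)) (at s)"
    using s0 by (auto intro!: derivative_eq_intros simp: power2_eq_square)
  moreover have "(log_kernel N has_real_derivative - (max 0 (1 - t / s) ^ N / (t / s))) (at (t / s))"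
    using s s0 assms by (intro has_real_derivative_log_kernel) auto
  ultimately have "((\<lambda>s. log_kernel N (t / s)) has_real_derivative
     - (max 0 (1 - t / s) ^ N / (t / s)) * - (t / s\<^sup>2)) (at s)"
    by (rule DERIV_chain2[rotated])
  also have "- (max 0 (1 - t / s) ^ N / (t / s)) * - (t / s\<^sup>2) = max 0 (1 - t / s) ^ N / s"
    using s0 assms by (simp add: power2_eq_square)
  finally show "((\<lambda>s. log_kernel N (t / s)) has_real_derivative max 0 (1 - t / s) ^ N / s) (at s)" .
qed (use assms in auto)

lemma has_real_derivative_scaled_poly:
  assumes "vanish 2 p" "0 < s"
  shows "((\<lambda>s. poly p (max 0 (1 - t / s))) has_real_derivative poly (pderiv p) (max 0 (1 - t / s)) * (t / s\<^sup>2)) (at s)"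
proof (rule DERIV_chain2[OF has_real_derivative_poly_pos_part[OF assms(1)]])
  show "((\<lambda>s. 1 - t / s) has_real_derivative t / s\<^sup>2) (at s)"
    using assms by (auto intro!: derivative_eq_intros simp: power2_eq_square)
qed

lemma continuous_on_poly_id: "continuous_on S (poly (p :: real poly))"
  by (intro continuous_at_imp_continuous_on ballI poly_isCont)

lemma continuous_on_scaled_poly: "0 < a \<Longrightarrow> continuous_on {a..b} (\<lambda>s. poly p (max 0 (1 - t / s :: real)))"
  by (intro continuous_on_poly continuous_intros) auto

text \<open>Origin of \<open>mollifier_poly\<close>: since the s-derivative of \<sigma> is (1 -
  \<sigma>) / s, the s-derivative of s^(-m) Q(\<sigma>) is -s^(-m-1) times m Q - (1 - \<sigma>) Q'.
  With Q = -4 p' that bracket is the radial Laplacian of p.\<close>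

lemma lap_poly_eq: "lap_poly m p = smult (real m) (smult (- 4) (pderiv p)) - [:1, -1:] * pderiv (smult (- 4) (pderiv p))"
  unfolding pderiv_smult lap_poly_def by (simp add: smult_add_right mult.commute)

lemma integral_mollifier_kernel:
  fixes x y :: "'a::euclidean_space"
  assumes m: "1 \<le> m" and ab: "0 < a" "a \<le> b"
  shows "(LINT s|lborel. indicator {a..b} s * ((1 / s) * ((1 / s) ^ m * radial ((lap_poly m ^^ m) (monom 1 (2 * m + 1))) s x y)))
       = (1 / a) ^ m * radial (mollifier_poly m) a x y - (1 / b) ^ m * radial (mollifier_poly m) b x y"
proof -
  let ?t = "(norm (y - x))\<^sup>2"
  let ?B = "(lap_poly m ^^ (m - 1)) (monom 1 (2 * m + 1))" and ?Q = "mollifier_poly m"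
  have v: "vanish 2 ?Q" by (rule vanish_mollifier_poly[OF m])
  have B: "(lap_poly m ^^ m) (monom 1 (2 * m + 1)) = lap_poly m ?B"
    using m by (cases m) auto
  have key: "lap_poly m ?B = smult (real m) ?Q - [:1, -1:] * pderiv ?Q"
    unfolding mollifier_poly_def by (rule lap_poly_eq)
  have pQ: "vanish 1 (pderiv ?Q)" using v by (intro vanish_pderiv) (simp add: numeral_2_eq_2)
  have "(LINT s|lborel. indicator {a..b} s * ((1 / s) * ((1 / s) ^ m * radial (lap_poly m ?B) s x y)))
      = - ((1 / b) ^ m * radial ?Q b x y) - - ((1 / a) ^ m * radial ?Q a x y)"
  proof (rule lborel_integral_FTC[where S = "{}"])
    show "continuous_on {a..b} (\<lambda>s. (1 / s) * ((1 / s) ^ m * radial (lap_poly m ?B) s x y))"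
      "continuous_on {a..b} (\<lambda>s. - ((1 / s) ^ m * radial ?Q s x y))"
      unfolding radial_def using ab by (intro continuous_intros continuous_on_scaled_poly; auto)+
    fix s assume "s \<in> {a<..<b} - {}"
    then have s: "0 < s" using ab by auto
    have "((\<lambda>s. (1 / s) ^ m) has_real_derivative - (real m * (1 / s) ^ (m - 1) * (1 / s\<^sup>2))) (at s)"
    proof -
      have "((\<lambda>s. 1 / s) has_real_derivative - (1 / s\<^sup>2)) (at s)"
        using s by (auto intro!: derivative_eq_intros simp: power2_eq_square)
      from DERIV_power[OF this, of m] show ?thesis by (simp add: mult_ac)
    qed
    then have "((\<lambda>s. - ((1 / s) ^ m * radial ?Q s x y)) has_real_derivative
        - (- (real m * (1 / s) ^ (m - 1) * (1 / s\<^sup>2)) * radial ?Q s x y + radial (pderiv ?Q) s x y * (?t / s\<^sup>2) * (1 / s) ^ m)) (at s)"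
      unfolding radial_def by (intro DERIV_minus DERIV_mult has_real_derivative_scaled_poly[OF v s])
    also have "real m * (1 / s) ^ (m - 1) * (1 / s\<^sup>2) = real m * ((1 / s) * (1 / s) ^ m)"
      using s m by (cases m) (auto simp: power2_eq_square)
    also have "radial (pderiv ?Q) s x y * (?t / s\<^sup>2) * (1 / s) ^ m = (1 / s) * (1 / s) ^ m * (?t / s * radial (pderiv ?Q) s x y)"
      by (simp add: power2_eq_square)
    also have "?t / s * radial (pderiv ?Q) s x y = (1 - max 0 (1 - ?t / s)) * radial (pderiv ?Q) s x y"
      using vanish_poly_0[OF pQ] by (cases "?t / s < 1") (auto simp: max_def radial_def)
    finally show "((\<lambda>s. - ((1 / s) ^ m * radial ?Q s x y)) has_real_derivative (1 / s) * ((1 / s) ^ m * radial (lap_poly m ?B) s x y)) (at s)"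
      unfolding key by (simp add: radial_def algebra_simps)
  qed (use ab in auto)
  then show ?thesis unfolding B by simp
qed

lemma poly_bounded_unit:
  fixes p :: "real poly"
  shows "\<exists>C\<ge>0. \<forall>t\<in>{0..1}. \<bar>poly p t\<bar> \<le> C"
proof -
  have "compact (poly p ` {0..1})" by (intro compact_continuous_image continuous_on_poly_id) auto
  from compact_imp_bounded[OF this] obtain C where C: "\<forall>t\<in>{0..1}. \<bar>poly p t\<bar> \<le> C" unfolding bounded_iff by auto
  moreover have "0 \<le> C" using C[rule_format, of 0] by auto
  ultimately show ?thesis by blast
qed

lemma radial_bounded: "\<exists>C\<ge>0. \<forall>s>0. \<forall>x y::'a::euclidean_space. \<bar>radial p s x y\<bar> \<le> C"
proof -
  obtain C where C: "C \<ge> 0" "\<forall>t\<in>{0..1}. \<bar>poly p t\<bar> \<le> C" using poly_bounded_unit by blast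
  then show ?thesis by (intro exI[of _ C]) (auto simp: radial_def)
qed

lemma measurable_radial_pair [measurable]:
  "(\<lambda>(s, y). radial p s x y) \<in> borel_measurable (borel \<Otimes>\<^sub>M (borel :: 'a::euclidean_space measure))"
proof -
  have [measurable]: "poly p \<in> borel_measurable borel" by (intro borel_measurable_continuous_onI continuous_on_poly_id)
  show ?thesis unfolding radial_def by measurable
qed

text \<open>The kernel is corrected to second order at 0 with fixed functions: \<open>c0\<close> has
  value 1 and gradient 0 there, and \<open>c i\<close> has value 0 and gradient i. The numbers a0
  and a i are the defects of Green's formula on these functions. They are chosen before x and s, and
  this uniformity is what allows the later integration over s.\<close>

lemma kernel_identity:
  fixes u :: "'a::euclidean_space \<Rightarrow> real"
  assumes dim: "DIM('a) = 2 * m" and m: "1 \<le> m" and R: "0 < R" and T: "0 < T" "sqrt T < R"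
    and u: "Ck_on (2 * m) (ball 0 R - {0}) u"
    and U: "integrable lborel (\<lambda>y. indicator (ball 0 R - {0}) y * u y)"
    and F: "integrable lborel (\<lambda>y. indicator (ball 0 R - {0}) y * (laplacian ^^ m) u y)"
    and small: "\<And>\<epsilon>. 0 < \<epsilon> \<Longrightarrow> \<forall>\<^sub>F r in at_right 0.
        (LINT y|lborel. indicator (ball 0 r - {0}) y * \<bar>u y\<bar>) \<le> \<epsilon> * r ^ (2 * m - 2)"
  defines "b \<equiv> monom 1 (2 * m + 1)"
  shows "\<exists>a0 a. \<forall>x s. norm x + sqrt T < R \<longrightarrow> 0 < s \<longrightarrow> s \<le> T \<longrightarrow>
    (LINT y|lborel. (indicator (ball 0 R - {0}) y * u y) * ((1 / s) ^ m * radial ((lap_poly m ^^ m) b) s x y))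
    = (LINT y|lborel. (indicator (ball 0 R - {0}) y * (laplacian ^^ m) u y) * radial b s x y)
      + a0 * radial b s x 0 + (\<Sum>i\<in>Basis. a i * ((2 / s) * (x \<bullet> i) * radial (pderiv b) s x 0))"
proof -
  let ?L = "laplacian ^^ m"
  define Ue Fe where "Ue y = indicator (ball 0 R - {0}) y * u y" and "Fe y = indicator (ball 0 R - {0}) y * ?L u y" for y
  have intU: "integrable lborel Ue" "integrable lborel Fe" using U F by (simp_all add: Ue_def[abs_def] Fe_def[abs_def])
  have vb: "vanish (2 * m + 1) b" unfolding b_def by (rule vanish_monom)
  have v1: "vanish 1 b" and v2: "vanish 2 b" using m by (auto intro: vanish_le[OF vb])
  have CR: "Ck_on (2 * m) UNIV (radial b s x)" for s and x :: 'a using Ck_on_radial[of "2 * m" b] vb by simp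
  \<comment> \<open>The kernel centred at 0 at the largest scale T; its gradient vanishes at its
    centre, and its support fits into the ball of radius R because sqrt T < R.\<close>
  define c0 where "c0 = radial b T (0::'a)"
  define c where "c i y = (y \<bullet> i) * c0 y" for i y :: 'a
  have C0: "Ck_on (2 * m) UNIV c0" unfolding c0_def by (rule CR)
  have Cc: "Ck_on (2 * m) UNIV (c i)" for i unfolding c_def by (intro Ck_on_mult Ck_on_inner open_UNIV C0)
  have diff: "f differentiable (at y)" if "Ck_on (2 * m) UNIV f" for f :: "'a \<Rightarrow> real" and y
    using Ck_on_Suc_differentiable[of 0 UNIV f y] Ck_on_le[OF that, of 1] m by simp
  have c00: "c0 0 = 1" by (simp add: c0_def radial_def b_def poly_monom)
  have dc0: "pderiv_dir i c0 0 = 0" for i unfolding c0_def by (simp add: pderiv_dir_radial[OF v2 T(1)])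
  have dc: "pderiv_dir j (c i) 0 = (if i = j then 1 else 0)" if "i \<in> Basis" "j \<in> Basis" for i j
  proof -
    have "pderiv_dir j (c i) 0 = pderiv_dir j (\<lambda>y. y \<bullet> i) 0 * c0 0 + (0 \<bullet> i) * pderiv_dir j c0 0"
      unfolding c_def by (intro pderiv_dir_mult diff C0 Ck_on_inner open_UNIV)
    also have "pderiv_dir j (\<lambda>y. y \<bullet> i) 0 = j \<bullet> i" by (rule pderiv_dir_eq) (auto intro!: derivative_eq_intros)
    finally show ?thesis using that by (simp add: c00 inner_Basis)
  qed
  define a0 where "a0 = (LINT y|lborel. Ue y * ?L c0 y) - (LINT y|lborel. Fe y * c0 y)"
  define a where "a i = (LINT y|lborel. Ue y * ?L (c i) y) - (LINT y|lborel. Fe y * c i y)" for i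
  have cont_L: "continuous_on UNIV (?L f)" if "Ck_on (2 * m) UNIV f" for f :: "'a \<Rightarrow> real"
    using Ck_on_laplacian_pow[of UNIV m 0 f] that by simp
  have int_L: "integrable lborel (\<lambda>y. Ue y * ?L f y)" "integrable lborel (\<lambda>y. Fe y * f y)"
    if f: "Ck_on (2 * m) UNIV f" and supp: "\<And>y. r < norm y \<Longrightarrow> f y = 0" for f r
  proof -
    have sL: "?L f y = 0" if "r < norm y" for y
      by (rule laplacian_pow_eq_0[OF open_norm_greater[of r]]) (use that supp in auto)
    obtain C where "\<And>y. \<bar>?L f y\<bar> \<le> C" using bounded_compact_support[OF cont_L[OF f] sL] by blast
    then show "integrable lborel (\<lambda>y. Ue y * ?L f y)"
      by (intro indicator_times_integrable_bound[OF intU(1)] borel_measurable_continuous_onI cont_L f) auto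
    obtain C where "\<And>y. \<bar>f y\<bar> \<le> C" using bounded_compact_support[OF Ck_on_continuous[OF f] supp] by blast
    then show "integrable lborel (\<lambda>y. Fe y * f y)"
      by (intro indicator_times_integrable_bound[OF intU(2)] borel_measurable_continuous_onI Ck_on_continuous[OF f]) auto
  qed
  have s0: "c0 y = 0" if "sqrt T < norm y" for y
    unfolding c0_def by (rule radial_support[OF v1 T(1)]) (use that in simp)
  have sc: "c i y = 0" if "sqrt T < norm y" for i y using s0[OF that] by (simp add: c_def)
  have main: "(LINT y|lborel. Ue y * ((1 / s) ^ m * radial ((lap_poly m ^^ m) b) s x y))
    = (LINT y|lborel. Fe y * radial b s x y) + a0 * radial b s x 0 + (\<Sum>i\<in>Basis. a i * ((2 / s) * (x \<bullet> i) * radial (pderiv b) s x 0))"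
    if x: "norm x + sqrt T < R" and s: "0 < s" "s \<le> T" for x :: 'a and s
  proof -
    define f where "f = radial b s x"
    define d where "d i = (2 / s) * (x \<bullet> i) * radial (pderiv b) s x 0" for i
    have Cf: "Ck_on (2 * m) UNIV f" unfolding f_def by (rule CR)
    have sf: "f y = 0" if "norm x + sqrt T < norm y" for y
    proof -
      have "sqrt s \<le> sqrt T" using s by simp
      then show ?thesis unfolding f_def using that by (intro radial_support[OF v1 s(1)]) linarith
    qed
    have df: "pderiv_dir i f 0 = d i" for i unfolding f_def d_def by (simp add: pderiv_dir_radial[OF v2 s(1)])
    have Lf: "?L f = (\<lambda>y. (1 / s) ^ m * radial ((lap_poly m ^^ m) b) s x y)"
      unfolding f_def by (rule laplacian_pow_radial[OF dim vb s(1)])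
    define h where "h y = (\<Sum>i\<in>Basis. d i * c i y)" for y
    define \<psi> where "\<psi> y = (f y - f 0 * c0 y) - h y" for y
    have Ch: "Ck_on (2 * m) UNIV h" unfolding h_def by (intro Ck_on_sum Ck_on_cmult open_UNIV Cc finite_Basis)
    have Cfc: "Ck_on (2 * m) UNIV (\<lambda>y. f y - f 0 * c0 y)" by (intro Ck_on_diff Ck_on_cmult open_UNIV Cf C0)
    have C\<psi>: "Ck_on (2 * m) UNIV \<psi>" unfolding \<psi>_def by (intro Ck_on_diff open_UNIV Cfc Ch)
    have sx: "0 \<le> norm x" by simp
    have eq1: "(LINT y|lborel. Fe y * \<psi> y) = (LINT y|lborel. Ue y * ?L \<psi> y)"
      unfolding Fe_def Ue_def
    proof (rule removable_origin[OF m x R u U F small C\<psi>])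
      show "\<psi> 0 = 0" by (simp add: \<psi>_def h_def c_def c00)
      show "pderiv_dir j \<psi> 0 = 0" if j: "j \<in> Basis" for j
      proof -
        have "pderiv_dir j \<psi> 0 = (pderiv_dir j f 0 - f 0 * pderiv_dir j c0 0) - pderiv_dir j h 0"
          unfolding \<psi>_def using diff[OF Cf] diff[OF C0] diff[OF Ch] diff[OF Cfc]
          by (simp add: pderiv_dir_diff pderiv_dir_cmult Ck_on_cmult)
        also have "pderiv_dir j h 0 = (\<Sum>i\<in>Basis. d i * pderiv_dir j (c i) 0)"
          unfolding h_def using diff[OF Cc] by (simp add: pderiv_dir_sum pderiv_dir_cmult)
        also have "\<dots> = (\<Sum>i\<in>Basis. if i = j then d i else 0)" by (rule sum.cong) (use j in \<open>auto simp: dc\<close>)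
        finally show ?thesis using j by (simp add: df dc0)
      qed
      show "\<psi> y = 0" if "norm x + sqrt T < norm y" for y
      proof -
        have "sqrt T < norm y" using that sx by linarith
        then show ?thesis using sf[OF that] by (simp add: \<psi>_def h_def s0 sc)
      qed
    qed
    have L\<psi>: "?L \<psi> y = ?L f y - f 0 * ?L c0 y - (\<Sum>i\<in>Basis. d i * ?L (c i) y)" for y
    proof -
      have "?L \<psi> y = ?L (\<lambda>y. f y - f 0 * c0 y) y - ?L h y"
        unfolding \<psi>_def by (intro laplacian_pow_diff[of UNIV] open_UNIV Cfc Ch UNIV_I)
      also have "?L (\<lambda>y. f y - f 0 * c0 y) y = ?L f y - f 0 * ?L c0 y"
        using laplacian_pow_diff[OF open_UNIV Cf Ck_on_cmult[OF open_UNIV C0, of "f 0"] UNIV_I]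
          laplacian_pow_cmult[OF open_UNIV C0 UNIV_I] by simp
      also have "?L h y = (\<Sum>i\<in>Basis. d i * ?L (c i) y)"
      proof -
        have "?L h y = (\<Sum>i\<in>Basis. ?L (\<lambda>y. d i * c i y) y)"
          unfolding h_def by (rule laplacian_pow_sum[OF open_UNIV finite_Basis _ UNIV_I]) (intro Ck_on_cmult open_UNIV Cc)
        then show ?thesis using laplacian_pow_cmult[OF open_UNIV Cc UNIV_I] by simp
      qed
      finally show ?thesis .
    qed
    have "(LINT y|lborel. Ue y * ?L \<psi> y)
        = (LINT y|lborel. Ue y * ?L f y - f 0 * (Ue y * ?L c0 y) - (\<Sum>i\<in>Basis. d i * (Ue y * ?L (c i) y)))"
      by (simp add: L\<psi> right_diff_distrib sum_distrib_left mult_ac)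
    also have "\<dots> = (LINT y|lborel. Ue y * ?L f y) - f 0 * (LINT y|lborel. Ue y * ?L c0 y) - (\<Sum>i\<in>Basis. d i * (LINT y|lborel. Ue y * ?L (c i) y))"
      using int_L(1)[OF Cf sf] int_L(1)[OF C0 s0] int_L(1)[OF Cc sc] by (simp add: Bochner_Integration.integral_sum)
    finally have eq2: "(LINT y|lborel. Ue y * ?L \<psi> y) = \<dots>" .
    have "(LINT y|lborel. Fe y * \<psi> y) = (LINT y|lborel. Fe y * f y - f 0 * (Fe y * c0 y) - (\<Sum>i\<in>Basis. d i * (Fe y * c i y)))"
      by (simp add: \<psi>_def h_def right_diff_distrib sum_distrib_left mult_ac)
    also have "\<dots> = (LINT y|lborel. Fe y * f y) - f 0 * (LINT y|lborel. Fe y * c0 y) - (\<Sum>i\<in>Basis. d i * (LINT y|lborel. Fe y * c i y))"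
      using int_L(2)[OF Cf sf] int_L(2)[OF C0 s0] int_L(2)[OF Cc sc] by (simp add: Bochner_Integration.integral_sum)
    finally have eq3: "(LINT y|lborel. Fe y * \<psi> y) = \<dots>" .
    have "(LINT y|lborel. Ue y * ?L f y) = (LINT y|lborel. Fe y * f y) + a0 * f 0 + (\<Sum>i\<in>Basis. a i * d i)"
      using eq1 unfolding eq2 eq3 by (simp add: a0_def a_def algebra_simps sum_subtractf sum.distrib)
    then show ?thesis unfolding Lf by (simp add: f_def d_def)
  qed
  then show ?thesis unfolding Ue_def Fe_def by blast
qed

subsection \<open>The representation formula\<close>

text \<open>The kernel may change sign, so convergence needs a bound on its L^1 norm uniform in the
  scale, besides its mass. The scale e n is a squared radius, so that the dilation factor in
  dimension 2 m is an integer power.\<close>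

lemma mollifier_limit:
  fixes U :: "'a::euclidean_space \<Rightarrow> real"
  assumes dim: "DIM('a) = 2 * m" and U: "integrable lborel U" and cont: "isCont U x" and p: "vanish 1 p"
    and e: "e \<longlonglongrightarrow> 0" "\<And>n. 0 < e n"
  shows "(\<lambda>n. LINT y|lborel. U y * ((1 / e n) ^ m * radial p (e n) x y))
           \<longlonglongrightarrow> (LINT y|lborel. radial p 1 (0::'a) y) * U x"
proof -
  let ?k = "\<lambda>n y. (1 / e n) ^ m * radial p (e n) x y"
  obtain C where C: "C \<ge> 0" "\<And>s y. s > 0 \<Longrightarrow> \<bar>radial p s x y\<bar> \<le> C"
      by (metis radial_bounded[where p=p and 'a='a])
  have intk: "integrable lborel (?k n)" for n by (intro integrable_mult_right integrable_radial p e(2))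
  have intUk: "integrable lborel (\<lambda>y. U y * ?k n y)" for n
  proof (rule indicator_times_integrable_bound[OF U])
    show "\<bar>?k n y\<bar> \<le> (1 / e n) ^ m * C" for y using C e(2)[of n] by (simp add: abs_mult mult_left_mono)
  qed simp
  have massk: "(LINT y|lborel. ?k n y) = (LINT y|lborel. radial p 1 (0::'a) y)" for n
    using integral_radial_scale[OF dim e(2)[of n], of p x] e(2)[of n] by (simp add: power_one_over)
  define M where "M = C * unit_ball_vol DIM('a)"
  have M0: "0 \<le> M" using C by (simp add: M_def)
  have absk: "(LINT y|lborel. \<bar>?k n y\<bar>) \<le> M" for n
  proof -
    have bnd: "\<bar>?k n y\<bar> \<le> (1 / e n) ^ m * (C * indicator (cball x (sqrt (e n))) y)" for y
    proof (cases "y \<in> cball x (sqrt (e n))")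
      case True
      then show ?thesis using C e(2)[of n] by (simp add: abs_mult mult_left_mono)
    next
      case False
      then have "sqrt (e n) < norm (y - x)" by (simp add: dist_norm norm_minus_commute)
      then have "(sqrt (e n))\<^sup>2 \<le> (norm (y - x))\<^sup>2" using e(2)[of n] by (intro power_mono) auto
      then have "radial p (e n) x y = 0" using e(2)[of n] by (intro radial_eq_0[OF p]) auto
      then show ?thesis using False by simp
    qed
    have "(LINT y|lborel. \<bar>?k n y\<bar>) \<le> (LINT y|lborel. (1 / e n) ^ m * (C * indicator (cball x (sqrt (e n))) y))"
    proof (rule integral_mono[OF _ _ bnd])
      have "integrable lborel (indicator (cball x (sqrt (e n))) :: 'a \<Rightarrow> real)"
        using borel_integrable_compact[of "cball x (sqrt (e n))" "\<lambda>_. 1::real"] by simp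
      then show "integrable lborel (\<lambda>y. (1 / e n) ^ m * (C * indicator (cball x (sqrt (e n))) y))"
        by (intro integrable_mult_right)
    qed (intro integrable_abs intk)
    also have "\<dots> = (1 / e n) ^ m * (C * measure lborel (cball x (sqrt (e n))))" by simp
    also have "measure lborel (cball x (sqrt (e n))) = unit_ball_vol DIM('a) * (sqrt (e n)) ^ DIM('a)"
      using e(2)[of n] by (intro content_cball) simp
    also have "(sqrt (e n)) ^ DIM('a) = e n ^ m" using e(2)[of n] dim by (simp add: power_mult)
    also have "(1 / e n) ^ m * (C * (unit_ball_vol DIM('a) * e n ^ m)) = M"
      using e(2)[of n] by (simp add: M_def power_one_over)
    finally show ?thesis .
  qed
  have "(\<lambda>n. (LINT y|lborel. U y * ?k n y) - (LINT y|lborel. radial p 1 (0::'a) y) * U x) \<longlonglongrightarrow> 0"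
  proof (rule tendstoI)
    fix \<epsilon> :: real assume \<epsilon>: "0 < \<epsilon>"
    define \<epsilon>' where "\<epsilon>' = \<epsilon> / (2 * (M + 1))"
    have \<epsilon>': "0 < \<epsilon>'" using \<epsilon> M0 by (simp add: \<epsilon>'_def)
    obtain d where d: "d > 0" "\<And>y. dist y x < d \<Longrightarrow> dist (U y) (U x) < \<epsilon>'"
      using cont \<epsilon>' unfolding continuous_at by (metis (no_types, lifting) cont continuous_at_eps_delta dist_norm)
    have "\<forall>\<^sub>F n in sequentially. e n < d\<^sup>2" using e(1) d(1) by (intro order_tendstoD(2)) auto
    then show "\<forall>\<^sub>F n in sequentially. dist ((LINT y|lborel. U y * ?k n y) - (LINT y|lborel. radial p 1 (0::'a) y) * U x) 0 < \<epsilon>"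
    proof eventually_elim
      case (elim n)
      have pw: "\<bar>(U y - U x) * ?k n y\<bar> \<le> \<epsilon>' * \<bar>?k n y\<bar>" for y
      proof (cases "dist y x < d")
        case True
        then show ?thesis using d(2)[OF True] by (simp only: abs_mult) (intro mult_right_mono, auto simp: dist_real_def)
      next
        case False
        then have "d\<^sup>2 \<le> (norm (y - x))\<^sup>2" using d(1) by (intro power_mono) (auto simp: dist_norm)
        then have "radial p (e n) x y = 0" using e(2)[of n] elim by (intro radial_eq_0[OF p]) auto
        then show ?thesis by simp
      qed
      have "(LINT y|lborel. U y * ?k n y) - (LINT y|lborel. radial p 1 (0::'a) y) * U x
         = (LINT y|lborel. U y * ?k n y) - (LINT y|lborel. U x * ?k n y)"
        using massk[of n] by (simp only: integral_mult_right_zero) simp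
      also have "\<dots> = (LINT y|lborel. (U y - U x) * ?k n y)"
        using intUk[of n] intk[of n] by (subst Bochner_Integration.integral_diff[symmetric]) (auto simp: left_diff_distrib)
      also have "\<bar>\<dots>\<bar> \<le> (LINT y|lborel. \<bar>(U y - U x) * ?k n y\<bar>)" by (rule integral_abs_bound)
      also have "\<dots> \<le> (LINT y|lborel. \<epsilon>' * \<bar>?k n y\<bar>)"
      proof (rule integral_mono[OF _ _ pw])
        show "integrable lborel (\<lambda>y. \<bar>(U y - U x) * ?k n y\<bar>)"
          using intUk[of n] intk[of n] by (simp add: left_diff_distrib)
        show "integrable lborel (\<lambda>y. \<epsilon>' * \<bar>?k n y\<bar>)" using intk[of n] by simp
      qed
      also have "\<dots> = \<epsilon>' * (LINT y|lborel. \<bar>?k n y\<bar>)" by simp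
      also have "\<dots> \<le> \<epsilon>' * M" using absk \<epsilon>' by (intro mult_left_mono) auto
      also have "\<dots> < \<epsilon>" using \<epsilon> M0 by (simp add: \<epsilon>'_def field_simps add_nonneg_pos)
      finally show ?case by (simp add: dist_real_def)
    qed
  qed
  then show ?thesis by (rule LIM_zero_cancel)
qed

lemma integral_linear_combination:
  fixes f g :: "'a \<Rightarrow> real" and h :: "'b \<Rightarrow> 'a \<Rightarrow> real"
  assumes "integrable M f" "integrable M g" "\<And>i. integrable M (h i)"
  shows "(LINT s|M. f s + c * g s + (\<Sum>i\<in>A. a i * h i s)) = integral\<^sup>L M f + c * integral\<^sup>L M g + (\<Sum>i\<in>A. a i * integral\<^sup>L M (h i))"
  using assms by (simp add: Bochner_Integration.integral_sum)

text \<open>\<open>kernel_identity\<close> is integrated against ds/s over \<epsilon> \<le> s \<le>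
  T. The left side becomes a difference of two mollifications of u, and \<epsilon> -> 0 recovers
  u(x). The constant sign of the m-th Laplacian power makes the remaining integrals monotone in
  \<epsilon>, so integrability of the logarithmic potential at x is a conclusion instead of an
  assumption.\<close>

lemma representation:
  fixes u :: "'a::euclidean_space \<Rightarrow> real"
  assumes dim: "DIM('a) = 2 * m" and m: "1 \<le> m" and R: "0 < R" and T: "0 < T" "sqrt T < R"
    and u: "Ck_on (2 * m) (ball 0 R - {0}) u"
    and U: "integrable lborel (\<lambda>y. indicator (ball 0 R - {0}) y * u y)"
    and F: "integrable lborel (\<lambda>y. indicator (ball 0 R - {0}) y * (laplacian ^^ m) u y)"
    and small: "\<And>\<epsilon>. 0 < \<epsilon> \<Longrightarrow> \<forall>\<^sub>F r in at_right 0.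
        (LINT y|lborel. indicator (ball 0 r - {0}) y * \<bar>u y\<bar>) \<le> \<epsilon> * r ^ (2 * m - 2)"
    and pos: "AE y in lborel. 0 \<le> (-1) ^ m * (indicator (ball 0 R - {0}) y * (laplacian ^^ m) u y)"
  shows "\<exists>a0 a. \<forall>x. x \<noteq> 0 \<longrightarrow> norm x + sqrt T < R \<longrightarrow>
    integrable lborel (\<lambda>y. (indicator (ball 0 R - {0}) y * (laplacian ^^ m) u y) * log_kernel (2 * m + 1) ((norm (y - x))\<^sup>2 / T)) \<and>
    (LINT y|lborel. radial (mollifier_poly m) 1 (0::'a) y) * u x =
      (LINT y|lborel. (indicator (ball 0 R - {0}) y * u y) * ((1 / T) ^ m * radial (mollifier_poly m) T x y))
    + (LINT y|lborel. (indicator (ball 0 R - {0}) y * (laplacian ^^ m) u y) * log_kernel (2 * m + 1) ((norm (y - x))\<^sup>2 / T))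
    + a0 * log_kernel (2 * m + 1) ((norm x)\<^sup>2 / T)
    + (\<Sum>i\<in>Basis. a i * (2 * (x \<bullet> i) / (norm x)\<^sup>2 * max 0 (1 - (norm x)\<^sup>2 / T) ^ (2 * m + 1)))"
proof -
  define N where "N = 2 * m + 1"
  define b :: "real poly" where "b = monom 1 N"
  define B where "B = (lap_poly m ^^ m) b"
  define Q where "Q = mollifier_poly m"
  define Ue Fe where "Ue y = indicator (ball 0 R - {0}) y * u y" and "Fe y = indicator (ball 0 R - {0}) y * (laplacian ^^ m) u y" for y
  have intU: "integrable lborel Ue" "integrable lborel Fe" using U F by (simp_all add: Ue_def[abs_def] Fe_def[abs_def])
  note [measurable] = borel_measurable_integrable[OF intU(1)] borel_measurable_integrable[OF intU(2)]
  have N1: "1 \<le> N" by (simp add: N_def)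
  have v2: "vanish 2 b" unfolding b_def by (rule vanish_le[OF vanish_monom]) (use m in \<open>simp add: N_def\<close>)
  have v1: "vanish 1 b" by (rule vanish_le[OF v2]) simp
  have vQ: "vanish 1 Q" unfolding Q_def by (rule vanish_le[OF vanish_mollifier_poly[OF m]]) simp
  from kernel_identity[OF dim m R T u U F small]
  obtain a0 a where ident: "\<And>x s. norm x + sqrt T < R \<Longrightarrow> 0 < s \<Longrightarrow> s \<le> T \<Longrightarrow>
    (LINT y|lborel. Ue y * ((1 / s) ^ m * radial B s x y))
    = (LINT y|lborel. Fe y * radial b s x y)
      + a0 * radial b s x 0 + (\<Sum>i\<in>Basis. a i * ((2 / s) * (x \<bullet> i) * radial (pderiv b) s x 0))"
    unfolding Ue_def Fe_def B_def b_def N_def by blast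
  have radb: "radial b s x y = max 0 (1 - (norm (y - x))\<^sup>2 / s) ^ N" for s and x y :: 'a
    by (simp add: radial_def b_def poly_monom)
  have goal: "integrable lborel (\<lambda>y. Fe y * log_kernel N ((norm (y - x))\<^sup>2 / T)) \<and>
    (LINT y|lborel. radial Q 1 (0::'a) y) * u x =
      (LINT y|lborel. Ue y * ((1 / T) ^ m * radial Q T x y))
    + (LINT y|lborel. Fe y * log_kernel N ((norm (y - x))\<^sup>2 / T))
    + a0 * log_kernel N ((norm x)\<^sup>2 / T)
    + (\<Sum>i\<in>Basis. a i * (2 * (x \<bullet> i) / (norm x)\<^sup>2 * max 0 (1 - (norm x)\<^sup>2 / T) ^ N))"
    if x0: "x \<noteq> 0" and xR: "norm x + sqrt T < R" for x :: 'a
  proof -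
    let ?t = "(norm x)\<^sup>2"
    let ?G = "\<lambda>s y. log_kernel N ((norm (y - x))\<^sup>2 / s)"
    define rest where "rest = a0 * log_kernel N (?t / T) + (\<Sum>i\<in>Basis. a i * (2 * (x \<bullet> i) / ?t * max 0 (1 - ?t / T) ^ N))"
    have t0: "0 < ?t" using x0 by simp
    \<comment> \<open>For \<epsilon> \<le> |x|^2 the kernel at scale \<epsilon> does not reach the
      origin, so the contributions of a0 and a i, collected in \<open>rest\<close>, do not depend on
      \<epsilon>.\<close>
    have integ: "integrable lborel (\<lambda>y. Fe y * (?G T y - ?G \<epsilon> y)) \<and>
      (LINT y|lborel. Ue y * ((1 / \<epsilon>) ^ m * radial Q \<epsilon> x y)) = (LINT y|lborel. Ue y * ((1 / T) ^ m * radial Q T x y))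
       + (LINT y|lborel. Fe y * (?G T y - ?G \<epsilon> y)) + rest"
      if \<epsilon>: "0 < \<epsilon>" "\<epsilon> \<le> T" "\<epsilon> \<le> ?t" for \<epsilon>
    proof -
      let ?I = "indicator {\<epsilon>..T} :: real \<Rightarrow> real"
      obtain CB where CB: "CB \<ge> 0" "\<And>s y. s > 0 \<Longrightarrow> \<bar>radial B s x y\<bar> \<le> CB"
      by (metis radial_bounded[where p=B and 'a='a])
      obtain Cb where Cb: "Cb \<ge> 0" "\<And>s y. s > 0 \<Longrightarrow> \<bar>radial b s x y\<bar> \<le> Cb"
      by (metis radial_bounded[where p=b and 'a='a])
      have wB: "\<forall>s\<in>{\<epsilon>..T}. \<forall>y. \<bar>(1 / s) * ((1 / s) ^ m * radial B s x y)\<bar> \<le> (1 / \<epsilon>) * ((1 / \<epsilon>) ^ m * CB)"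
        unfolding abs_mult using \<epsilon> CB
        by (intro ballI allI mult_mono) (auto intro!: power_mono divide_left_mono simp: power_abs)
      have wb: "\<forall>s\<in>{\<epsilon>..T}. \<forall>y. \<bar>(1 / s) * radial b s x y\<bar> \<le> (1 / \<epsilon>) * Cb"
        unfolding abs_mult using \<epsilon> Cb by (intro ballI allI mult_mono) (auto intro!: divide_left_mono)
      have mB: "(\<lambda>(s, y). (1 / s) * ((1 / s) ^ m * radial B s x y)) \<in> borel_measurable (borel \<Otimes>\<^sub>M borel)"
        by measurable
      have mb: "(\<lambda>(s, y). (1 / s) * radial b s x y) \<in> borel_measurable (borel \<Otimes>\<^sub>M borel)"
        by measurable
      note fB = lborel_Fubini_bounded_kernel[OF intU(1) mB wB]
      note fb = lborel_Fubini_bounded_kernel[OF intU(2) mb wb]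
      have eqG: "(LINT s|lborel. ?I s * ((1 / s) * radial b s x y)) = ?G T y - ?G \<epsilon> y" if "y \<noteq> x" for y
        unfolding radb using integral_log_kernel[of "(norm (y - x))\<^sup>2" \<epsilon> T N] that \<epsilon> N1 by simp
      have AEG: "AE y in lborel. Fe y * (LINT s|lborel. ?I s * ((1 / s) * radial b s x y)) = Fe y * (?G T y - ?G \<epsilon> y)"
        using AE_lborel_singleton[of x] by eventually_elim (subst eqG, assumption, rule refl)
      have mG: "(\<lambda>y. Fe y * (?G T y - ?G \<epsilon> y)) \<in> borel_measurable lborel"
        by measurable
      have i1: "integrable lborel (\<lambda>y. Fe y * (?G T y - ?G \<epsilon> y))"
        using fb(3) integrable_cong_AE[OF borel_measurable_integrable[OF fb(3)] mG AEG] by simp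
      have e1: "(LINT y|lborel. Fe y * (LINT s|lborel. ?I s * ((1 / s) * radial b s x y))) = (LINT y|lborel. Fe y * (?G T y - ?G \<epsilon> y))"
        by (rule integral_cong_AE[OF borel_measurable_integrable[OF fb(3)] mG AEG])
      have kint: "(LINT s|lborel. ?I s * ((1 / s) * ((1 / s) ^ m * radial B s x y)))
         = (1 / \<epsilon>) ^ m * radial Q \<epsilon> x y - (1 / T) ^ m * radial Q T x y" for y
        using integral_mollifier_kernel[OF m \<epsilon>(1,2), of x y] by (simp only: B_def b_def N_def Q_def)
      have bint: "(LINT s|lborel. ?I s * ((1 / s) * radial b s x 0)) = log_kernel N (?t / T)"
        using integral_log_kernel[of ?t \<epsilon> T N] t0 \<epsilon> N1 log_kernel_eq_0[of "?t / \<epsilon>" N] unfolding radb by simp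
      have cont1: "continuous_on {\<epsilon>..T} (\<lambda>s. (1 / s) * radial b s x 0)"
        unfolding radial_def using \<epsilon> by (intro continuous_intros continuous_on_scaled_poly) auto
      have cont2: "continuous_on {\<epsilon>..T} (\<lambda>s. (1 / s) * ((2 / s) * (x \<bullet> i) * radial (pderiv b) s x 0))" for i
        unfolding radial_def using \<epsilon> by (intro continuous_intros continuous_on_scaled_poly) auto
      have ib: "integrable lborel (\<lambda>s. ?I s * ((1 / s) * radial b s x 0))"
        using borel_integrable_compact[OF _ cont1] by simp
      have id: "integrable lborel (\<lambda>s. ?I s * ((1 / s) * ((2 / s) * (x \<bullet> i) * radial (pderiv b) s x 0)))" for i
        using borel_integrable_compact[OF _ cont2[of i]] by simp
      \<comment> \<open>The integrand is an exact s-derivative because d\<sigma>/ds = |x|^2 / s^2 at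
        the origin; dividing by |x|^2 is what creates the singularity of order -1.\<close>
      have dint: "(LINT s|lborel. ?I s * ((1 / s) * ((2 / s) * (x \<bullet> i) * radial (pderiv b) s x 0)))
          = 2 * (x \<bullet> i) / ?t * max 0 (1 - ?t / T) ^ N" for i
      proof -
        have "(LINT s|lborel. ?I s * ((1 / s) * ((2 / s) * (x \<bullet> i) * radial (pderiv b) s x 0)))
           = 2 * (x \<bullet> i) / ?t * poly b (max 0 (1 - ?t / T)) - 2 * (x \<bullet> i) / ?t * poly b (max 0 (1 - ?t / \<epsilon>))"
        proof (rule lborel_integral_FTC[where S = "{}"])
          show "continuous_on {\<epsilon>..T} (\<lambda>s. 2 * (x \<bullet> i) / ?t * poly b (max 0 (1 - ?t / s)))"
            using \<epsilon> by (intro continuous_intros continuous_on_scaled_poly) auto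
          fix s assume "s \<in> {\<epsilon><..<T} - {}"
          then have s: "0 < s" using \<epsilon> by auto
          have "((\<lambda>s. 2 * (x \<bullet> i) / ?t * poly b (max 0 (1 - ?t / s))) has_real_derivative
             2 * (x \<bullet> i) / ?t * (poly (pderiv b) (max 0 (1 - ?t / s)) * (?t / s\<^sup>2))) (at s)"
            by (intro DERIV_cmult has_real_derivative_scaled_poly[OF v2 s])
          also have "2 * (x \<bullet> i) / ?t * (poly (pderiv b) (max 0 (1 - ?t / s)) * (?t / s\<^sup>2))
             = (1 / s) * ((2 / s) * (x \<bullet> i) * radial (pderiv b) s x 0)"
            using t0 by (simp add: radial_def power2_eq_square)
          finally show "((\<lambda>s. 2 * (x \<bullet> i) / ?t * poly b (max 0 (1 - ?t / s))) has_real_derivative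
             (1 / s) * ((2 / s) * (x \<bullet> i) * radial (pderiv b) s x 0)) (at s)" .
        qed (use \<epsilon> cont2 in auto)
        moreover have "poly b (max 0 (1 - ?t / \<epsilon>)) = 0" using \<epsilon> by (simp add: b_def poly_monom max_def power_0_left N_def)
        ultimately show ?thesis by (simp add: b_def poly_monom)
      qed
      have "(LINT y|lborel. Ue y * ((1 / \<epsilon>) ^ m * radial Q \<epsilon> x y - (1 / T) ^ m * radial Q T x y))
         = (LINT s|lborel. ?I s * (LINT y|lborel. Ue y * ((1 / s) * ((1 / s) ^ m * radial B s x y))))"
        by (rule fB(1)[unfolded kint, symmetric])
      also have "\<dots> = (LINT s|lborel. ?I s * (LINT y|lborel. Fe y * ((1 / s) * radial b s x y))
          + a0 * (?I s * ((1 / s) * radial b s x 0)) + (\<Sum>i\<in>Basis. a i * (?I s * ((1 / s) * ((2 / s) * (x \<bullet> i) * radial (pderiv b) s x 0)))))"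
      proof (intro Bochner_Integration.integral_cong refl)
        fix s
        show "?I s * (LINT y|lborel. Ue y * ((1 / s) * ((1 / s) ^ m * radial B s x y)))
          = ?I s * (LINT y|lborel. Fe y * ((1 / s) * radial b s x y))
          + a0 * (?I s * ((1 / s) * radial b s x 0)) + (\<Sum>i\<in>Basis. a i * (?I s * ((1 / s) * ((2 / s) * (x \<bullet> i) * radial (pderiv b) s x 0))))"
        proof (cases "s \<in> {\<epsilon>..T}")
          case True
          then have s: "0 < s" "s \<le> T" using \<epsilon> by auto
          have p1: "(LINT y|lborel. Ue y * ((1 / s) * ((1 / s) ^ m * radial B s x y))) = (1 / s) * (LINT y|lborel. Ue y * ((1 / s) ^ m * radial B s x y))"
            by (simp only: mult.left_commute[of _ "1 / s"] integral_mult_right_zero)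
          have p2: "(LINT y|lborel. Fe y * ((1 / s) * radial b s x y)) = (1 / s) * (LINT y|lborel. Fe y * radial b s x y)"
            by (simp only: mult.left_commute[of _ "1 / s"] integral_mult_right_zero)
          show ?thesis unfolding p1 p2 ident[OF xR s] using True
            by (simp add: distrib_left sum_distrib_left mult_ac del: times_divide_eq_left times_divide_eq_right)
        qed simp
      qed
      also have "\<dots> = (LINT s|lborel. ?I s * (LINT y|lborel. Fe y * ((1 / s) * radial b s x y)))
          + a0 * log_kernel N (?t / T) + (\<Sum>i\<in>Basis. a i * (2 * (x \<bullet> i) / ?t * max 0 (1 - ?t / T) ^ N))"
        unfolding bint[symmetric] dint[symmetric]
        by (rule integral_linear_combination[OF fb(2) ib id])
      also have "(LINT s|lborel. ?I s * (LINT y|lborel. Fe y * ((1 / s) * radial b s x y))) = (LINT y|lborel. Fe y * (?G T y - ?G \<epsilon> y))"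
        using fb(1) unfolding e1 .
      finally have eq: "(LINT y|lborel. Ue y * ((1 / \<epsilon>) ^ m * radial Q \<epsilon> x y - (1 / T) ^ m * radial Q T x y))
         = (LINT y|lborel. Fe y * (?G T y - ?G \<epsilon> y)) + rest" by (simp add: rest_def)
      obtain CQ where CQ: "CQ \<ge> 0" "\<And>s y. s > 0 \<Longrightarrow> \<bar>radial Q s x y\<bar> \<le> CQ"
      by (metis radial_bounded[where p=Q and 'a='a])
      have iQ: "integrable lborel (\<lambda>y. Ue y * ((1 / s) ^ m * radial Q s x y))" if "0 < s" for s
      proof (rule indicator_times_integrable_bound[OF intU(1)])
        show "\<bar>(1 / s) ^ m * radial Q s x y\<bar> \<le> (1 / s) ^ m * CQ" for y
          using CQ that by (simp add: abs_mult mult_left_mono)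
      qed simp
      have "(LINT y|lborel. Ue y * ((1 / \<epsilon>) ^ m * radial Q \<epsilon> x y - (1 / T) ^ m * radial Q T x y))
        = (LINT y|lborel. Ue y * ((1 / \<epsilon>) ^ m * radial Q \<epsilon> x y)) - (LINT y|lborel. Ue y * ((1 / T) ^ m * radial Q T x y))"
        unfolding right_diff_distrib using iQ[OF \<epsilon>(1)] iQ[OF T(1)] by (rule Bochner_Integration.integral_diff)
      with eq i1 show ?thesis by simp
    qed
    \<comment> \<open>Every term lies in the range where \<open>integ\<close> applies, and the
      sequence decreases, as monotone convergence requires.\<close>
    define e where "e n = min T ?t / real (Suc n)" for n
    have e0: "0 < e n" for n using T t0 by (simp add: e_def)
    have eT: "e n \<le> T" "e n \<le> ?t" for n
    proof -
      have "e n \<le> min T ?t / 1" unfolding e_def using T t0 by (intro divide_left_mono) auto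
      then show "e n \<le> T" "e n \<le> ?t" by auto
    qed
    have elim: "e \<longlonglongrightarrow> 0"
      unfolding e_def using tendsto_mult[OF tendsto_const LIMSEQ_inverse_real_of_nat, of "min T ?t"] by (simp add: divide_inverse)
    have emono: "e k \<le> e n" if "n \<le> k" for n k
      unfolding e_def using that T t0 by (intro divide_left_mono) auto
    note I = integ[OF e0 eT]
    have xin: "x \<in> ball 0 R - {0}" using x0 xR T by (auto intro: order_le_less_trans[rotated] simp: add_increasing2 dest: less_imp_le)
    have contU: "isCont Ue x"
    proof -
      have "continuous_on (ball 0 R - {0}) Ue"
        using Ck_on_continuous[OF u] by (rule continuous_on_eq) (simp add: Ue_def)
      then show ?thesis using xin continuous_on_eq_continuous_at[of "ball 0 R - {0}" Ue] by (simp add: open_delete)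
    qed
    define L where "L = (LINT y|lborel. radial Q 1 (0::'a) y) * u x - (LINT y|lborel. Ue y * ((1 / T) ^ m * radial Q T x y)) - rest"
    have limF: "(\<lambda>n. LINT y|lborel. Fe y * (?G T y - ?G (e n) y)) \<longlonglongrightarrow> L"
    proof -
      have "(\<lambda>n. (LINT y|lborel. Ue y * ((1 / e n) ^ m * radial Q (e n) x y)) - (LINT y|lborel. Ue y * ((1 / T) ^ m * radial Q T x y)) - rest) \<longlonglongrightarrow>
          (LINT y|lborel. radial Q 1 (0::'a) y) * Ue x - (LINT y|lborel. Ue y * ((1 / T) ^ m * radial Q T x y)) - rest"
        by (intro tendsto_diff tendsto_const mollifier_limit[OF dim intU(1) contU vQ elim e0])
      moreover have "Ue x = u x" using xin by (simp add: Ue_def)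
      ultimately show ?thesis using I by (simp add: L_def)
    qed
    let ?sg = "(-1) ^ m :: real"
    have Gmono: "0 \<le> (?G T y - ?G (e k) y) - (?G T y - ?G (e n) y)" if "y \<noteq> x" "n \<le> k" for y n k
    proof -
      have "(?G (e n) y - ?G (e k) y) = (LINT s|lborel. indicator {e k..e n} s * (max 0 (1 - (norm (y - x))\<^sup>2 / s) ^ N / s))"
        using integral_log_kernel[of "(norm (y - x))\<^sup>2" "e k" "e n" N] that e0 emono N1 by simp
      also have "0 \<le> \<dots>"
      proof (rule Bochner_Integration.integral_nonneg)
        fix s
        show "0 \<le> indicator {e k..e n} s * (max 0 (1 - (norm (y - x))\<^sup>2 / s) ^ N / s)"
          using e0[of k] by (auto simp: indicator_def)
      qed
      finally show ?thesis by simp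
    qed
    have Glim: "(\<lambda>n. ?G T y - ?G (e n) y) \<longlonglongrightarrow> ?G T y" if "y \<noteq> x" for y
    proof -
      have "\<forall>\<^sub>F n in sequentially. e n < (norm (y - x))\<^sup>2" using elim that by (intro order_tendstoD(2)) auto
      then have "\<forall>\<^sub>F n in sequentially. ?G T y - ?G (e n) y = ?G T y"
        by (rule eventually_mono) (use e0 in \<open>auto intro!: log_kernel_eq_0 simp: field_simps\<close>)
      then show ?thesis by (rule tendsto_eventually)
    qed
    have A1: "integrable lborel (\<lambda>y. ?sg * (Fe y * (?G T y - ?G (e n) y)))" for n using I[of n] by simp
    \<comment> \<open>The factor \<open>?sg\<close> makes the density nonnegative, and lowering
      \<epsilon> only enlarges the kernel.\<close>
    have A2: "AE y in lborel. mono (\<lambda>n. ?sg * (Fe y * (?G T y - ?G (e n) y)))"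
      using pos AE_lborel_singleton[of x]
    proof eventually_elim
      case (elim y)
      show ?case
      proof (rule monoI)
        fix n k :: nat assume "n \<le> k"
        have "0 \<le> ?sg * Fe y" using elim by (simp only: Fe_def)
        from mult_nonneg_nonneg[OF this Gmono[OF elim(2) \<open>n \<le> k\<close>]]
        show "?sg * (Fe y * (?G T y - ?G (e n) y)) \<le> ?sg * (Fe y * (?G T y - ?G (e k) y))"
          by (simp add: algebra_simps)
      qed
    qed
    have A3: "AE y in lborel. (\<lambda>n. ?sg * (Fe y * (?G T y - ?G (e n) y))) \<longlonglongrightarrow> ?sg * (Fe y * ?G T y)"
      using AE_lborel_singleton[of x] by eventually_elim (intro tendsto_mult tendsto_const Glim)
    have A4: "(\<lambda>n. LINT y|lborel. ?sg * (Fe y * (?G T y - ?G (e n) y))) \<longlonglongrightarrow> ?sg * L"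
      by (simp only: integral_mult_right_zero) (intro tendsto_mult tendsto_const limF)
    have A5: "(\<lambda>y. ?sg * (Fe y * ?G T y)) \<in> borel_measurable lborel"
      by measurable
    have sg: "?sg * ?sg = 1" by (simp flip: power_add add: mult_2[symmetric])
    have "integrable lborel (\<lambda>y. ?sg * (Fe y * ?G T y))" "(LINT y|lborel. ?sg * (Fe y * ?G T y)) = ?sg * L"
      using integrable_monotone_convergence[OF A1 A2 A3 A4 A5] integral_monotone_convergence[OF A1 A2 A3 A4 A5] by auto
    then have "integrable lborel (\<lambda>y. Fe y * ?G T y)" "(LINT y|lborel. Fe y * ?G T y) = L" by simp_all
    then show ?thesis by (simp add: L_def rest_def)
  qed
  show ?thesis
    by (intro exI[of _ a0] exI[of _ a] allI impI) (rule goal[unfolded Fe_def Ue_def N_def Q_def])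
qed

subsection \<open>Singular integrals\<close>

text \<open>The difference is an integral of (1 - 1/s)_+^N / s, and the integrand lies between 0 and
  1/s. So the kernel decreases, but never faster than -ln.\<close>

lemma log_kernel_diff_bounds:
  assumes "0 < \<tau>" "\<tau> \<le> \<tau>'" "1 \<le> N"
  shows "0 \<le> log_kernel N \<tau> - log_kernel N \<tau>'" "log_kernel N \<tau> - log_kernel N \<tau>' \<le> ln \<tau>' - ln \<tau>"
proof -
  let ?I = "indicator {1 / \<tau>'..1 / \<tau>} :: real \<Rightarrow> real"
  have ab: "0 < 1 / \<tau>'" "1 / \<tau>' \<le> 1 / \<tau>" using assms by (auto simp: frac_le)
  have eq: "log_kernel N \<tau> - log_kernel N \<tau>' = (LINT s|lborel. ?I s * (max 0 (1 - 1 / s) ^ N / s))"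
    using integral_log_kernel[of 1 "1 / \<tau>'" "1 / \<tau>" N] ab assms by simp
  have le1: "max 0 (1 - 1 / s) ^ N \<le> (1::real)" if "0 < s" for s using that by (intro power_le_one) auto
  have pos: "0 \<le> ?I s * (max 0 (1 - 1 / s) ^ N / s)" for s
  proof (cases "s \<in> {1 / \<tau>'..1 / \<tau>}")
    case True
    then have "0 < s" using less_le_trans[OF ab(1)] by auto
    then show ?thesis by simp
  qed simp
  then show "0 \<le> log_kernel N \<tau> - log_kernel N \<tau>'" unfolding eq by (rule Bochner_Integration.integral_nonneg)
  have c1: "continuous_on {1 / \<tau>'..1 / \<tau>} (\<lambda>s. max 0 (1 - 1 / s) ^ N / s)"
    and c2: "continuous_on {1 / \<tau>'..1 / \<tau>} (\<lambda>s. 1 / s)" using ab by (auto intro!: continuous_intros)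
  have "(LINT s|lborel. ?I s * (max 0 (1 - 1 / s) ^ N / s)) \<le> (LINT s|lborel. ?I s * (1 / s))"
  proof (rule integral_mono)
    show "integrable lborel (\<lambda>s. ?I s * (max 0 (1 - 1 / s) ^ N / s))" "integrable lborel (\<lambda>s. ?I s * (1 / s))"
      using borel_integrable_compact[OF _ c1] borel_integrable_compact[OF _ c2] by simp_all
    fix s
    show "?I s * (max 0 (1 - 1 / s) ^ N / s) \<le> ?I s * (1 / s)"
    proof (cases "s \<in> {1 / \<tau>'..1 / \<tau>}")
      case True
      then have "0 < s" using less_le_trans[OF ab(1)] by auto
      then show ?thesis using le1[of s] by (intro mult_left_mono divide_right_mono) auto
    qed simp
  qed
  also have "\<dots> = ln (1 / \<tau>) - ln (1 / \<tau>')"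
  proof (rule lborel_integral_FTC[where S = "{}"])
    show "continuous_on {1 / \<tau>'..1 / \<tau>} ln" using ab by (intro continuous_intros) auto
    fix s assume "s \<in> {1 / \<tau>'<..<1 / \<tau>} - {}"
    then have "0 < s" using less_trans[OF ab(1)] by auto
    then show "(ln has_real_derivative 1 / s) (at s)" by (auto intro!: derivative_eq_intros)
  qed (use ab c2 in auto)
  finally show "log_kernel N \<tau> - log_kernel N \<tau>' \<le> ln \<tau>' - ln \<tau>"
    unfolding eq using assms by (simp add: ln_div)
qed

lemma log_kernel_nonneg:
  assumes "0 < \<tau>" "1 \<le> N"
  shows "0 \<le> log_kernel N \<tau>"
  using log_kernel_diff_bounds(1)[of \<tau> "max \<tau> 1" N] log_kernel_eq_0[of "max \<tau> 1" N] assms by simp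

lemma log_kernel_le:
  assumes "0 < \<tau>" "1 \<le> N"
  shows "log_kernel N \<tau> \<le> max 0 (- ln \<tau>)"
proof (cases "\<tau> < 1")
  case True
  then show ?thesis using log_kernel_diff_bounds(2)[of \<tau> 1 N] log_kernel_eq_0[of 1 N] assms by simp
next
  case False
  then show ?thesis by (simp add: log_kernel_eq_0)
qed

text \<open>Combines \<gamma> ln z \<le> z^\<gamma> - 1 at z = b / a with the subadditivity (1 +
  t)^\<gamma> \<le> 1 + t^\<gamma>.\<close>

lemma ln_diff_le_powr:
  fixes a b \<gamma> :: real
  assumes "0 < a" "a \<le> b" "0 < \<gamma>" "\<gamma> \<le> 1" "b - a \<le> d"
  shows "ln b - ln a \<le> (1 / \<gamma>) * d powr \<gamma> * a powr (- \<gamma>)"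
proof -
  have q: "1 \<le> b / a" using assms by simp
  have sub: "(1 + t) powr \<gamma> \<le> 1 + t powr \<gamma>" if "0 \<le> t" for t :: real
  proof (cases "t = 0")
    case False
    then have t: "0 < t" using that by simp
    have "(1 + t) powr \<gamma> = (1 + t) powr (\<gamma> - 1) + t * (1 + t) powr (\<gamma> - 1)"
      using t powr_add[of "1 + t" 1 "\<gamma> - 1"] by (simp add: distrib_right)
    moreover have "(1 + t) powr (\<gamma> - 1) \<le> 1 powr (\<gamma> - 1)" using t assms by (intro powr_mono2') auto
    moreover have "t * (1 + t) powr (\<gamma> - 1) \<le> t * t powr (\<gamma> - 1)" using t assms by (intro mult_left_mono powr_mono2') auto
    moreover have "t * t powr (\<gamma> - 1) = t powr \<gamma>" using t powr_add[of t 1 "\<gamma> - 1"] by simp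
    ultimately show ?thesis by simp
  qed simp
  have "\<gamma> * ln (b / a) = ln ((b / a) powr \<gamma>)" using assms by (simp add: ln_powr)
  also have "\<dots> \<le> (b / a) powr \<gamma> - 1" using assms by (intro ln_le_minus_one) auto
  also have "(b / a) powr \<gamma> = (1 + (b - a) / a) powr \<gamma>" using assms by (simp add: field_simps)
  also have "\<dots> - 1 \<le> ((b - a) / a) powr \<gamma>" using sub[of "(b - a) / a"] assms by simp
  also have "\<dots> \<le> (d / a) powr \<gamma>" using assms by (intro powr_mono2 divide_right_mono) auto
  also have "\<dots> = d powr \<gamma> * a powr (- \<gamma>)"
    using assms powr_divide[of d a \<gamma>] by (simp add: powr_minus_divide)
  finally have "\<gamma> * ln (b / a) \<le> d powr \<gamma> * a powr (- \<gamma>)" .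
  then show ?thesis using assms by (simp add: ln_div field_simps)
qed

text \<open>Only the weight at the nearer point is needed; the sum of both weights makes the bound
  symmetric in x and x', so the nearer one may be assumed to be x.\<close>

lemma log_kernel_holder:
  fixes x x' y :: "'a::euclidean_space"
  assumes "y \<noteq> x" "y \<noteq> x'" "0 < T" "1 \<le> N" "0 < \<gamma>" "\<gamma> \<le> 1"
  shows "\<bar>log_kernel N ((norm (y - x))\<^sup>2 / T) - log_kernel N ((norm (y - x'))\<^sup>2 / T)\<bar>
    \<le> (2 / \<gamma>) * dist x x' powr \<gamma> * (norm (y - x) powr (- \<gamma>) + norm (y - x') powr (- \<gamma>))"
  using assms(1,2)
proof (induction "norm (y - x)" "norm (y - x')" arbitrary: x x' rule: linorder_wlog)
  case (le x x')
  let ?a = "norm (y - x)" and ?b = "norm (y - x')"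
  have a: "0 < ?a" "0 < ?b" using le by auto
  have t: "?a\<^sup>2 / T \<le> ?b\<^sup>2 / T" "0 < ?a\<^sup>2 / T" using le assms a by (auto intro!: divide_right_mono power_mono)
  have "?b - ?a \<le> dist x x'"
    using norm_triangle_ineq2[of "y - x'" "y - x"] by (simp add: dist_norm)
  then have L: "ln ?b - ln ?a \<le> (1 / \<gamma>) * dist x x' powr \<gamma> * ?a powr (- \<gamma>)"
    using a le assms by (intro ln_diff_le_powr) auto
  have "\<bar>log_kernel N (?a\<^sup>2 / T) - log_kernel N (?b\<^sup>2 / T)\<bar> \<le> ln (?b\<^sup>2 / T) - ln (?a\<^sup>2 / T)"
    using log_kernel_diff_bounds[OF t(2,1) assms(4)] by simp
  also have "\<dots> = 2 * (ln ?b - ln ?a)" using a assms by (simp add: ln_div ln_realpow)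
  also have "\<dots> \<le> 2 * ((1 / \<gamma>) * dist x x' powr \<gamma> * ?a powr (- \<gamma>))" using L by simp
  also have "\<dots> \<le> (2 / \<gamma>) * dist x x' powr \<gamma> * (?a powr (- \<gamma>) + ?b powr (- \<gamma>))"
  proof -
    have "(2 / \<gamma>) * dist x x' powr \<gamma> * ?a powr (- \<gamma>) \<le> (2 / \<gamma>) * dist x x' powr \<gamma> * (?a powr (- \<gamma>) + ?b powr (- \<gamma>))"
      using assms by (intro mult_left_mono) auto
    then show ?thesis by simp
  qed
  finally show ?case .
next
  case (sym x x')
  then show ?case by (simp add: abs_minus_commute dist_commute add.commute)
qed

lemma log_kernel_le_powr:
  assumes "0 < z" "0 < T" "1 \<le> N" "0 < \<gamma>"
  shows "log_kernel N (z\<^sup>2 / T) \<le> (2 / \<gamma>) * T powr (\<gamma> / 2) * z powr (- \<gamma>)"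
proof -
  let ?\<tau> = "z\<^sup>2 / T"
  have \<tau>: "0 < ?\<tau>" using assms by simp
  have "- ln ?\<tau> = (2 / \<gamma>) * ln (?\<tau> powr (- \<gamma> / 2))" using assms \<tau> by (simp add: ln_powr)
  also have "\<dots> \<le> (2 / \<gamma>) * (?\<tau> powr (- \<gamma> / 2))"
    using assms \<tau> ln_le_minus_one[of "?\<tau> powr (- \<gamma> / 2)"] by (intro mult_left_mono) auto
  finally have "max 0 (- ln ?\<tau>) \<le> (2 / \<gamma>) * (?\<tau> powr (- \<gamma> / 2))" using assms by simp
  also have "?\<tau> powr (- \<gamma> / 2) = T powr (\<gamma> / 2) * z powr (- \<gamma>)"
  proof -
    have "(z\<^sup>2) powr (- \<gamma> / 2) = z powr (- \<gamma>)" using assms by (simp add: powr_powr flip: powr_numeral)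
    moreover have "T powr (\<gamma> / 2) * T powr (- \<gamma> / 2) = 1" using assms by (simp flip: powr_add)
    then have "T powr (\<gamma> / 2) = 1 / T powr (- \<gamma> / 2)" using assms by (simp add: eq_divide_eq)
    ultimately show ?thesis unfolding powr_divide by simp
  qed
  finally have "max 0 (- ln ?\<tau>) \<le> (2 / \<gamma>) * (T powr (\<gamma> / 2) * z powr (- \<gamma>))" .
  from order_trans[OF log_kernel_le[OF \<tau> assms(3)] this] show ?thesis by (simp only: mult.assoc)
qed

text \<open>The kernel is at most the positive part of ln T - 2 ln z, hence the factor s / 2 for the
  exponent -s. Where this positive part is 0, the bound 1 \<le> 2^s z^(-s) for z \<le> 2 takes
  over.\<close>

lemma exp_log_kernel_le:
  assumes "0 < z" "z \<le> 2" "0 < T" "1 \<le> N" "0 < s"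
  shows "exp (s / 2 * log_kernel N (z\<^sup>2 / T)) \<le> max (T powr (s / 2)) (2 powr s) * z powr (- s)"
proof -
  let ?\<tau> = "z\<^sup>2 / T"
  have \<tau>: "0 < ?\<tau>" using assms by simp
  have "exp (s / 2 * log_kernel N ?\<tau>) \<le> exp (s / 2 * max 0 (- ln ?\<tau>))"
    using log_kernel_le[OF \<tau> assms(4)] assms by simp
  also have "\<dots> = max 1 (exp (s / 2 * (- ln ?\<tau>)))"
    using assms by (auto simp: max_def mult_le_0_iff zero_le_mult_iff)
  also have "exp (s / 2 * (- ln ?\<tau>)) = T powr (s / 2) * z powr (- s)"
  proof -
    have "s / 2 * (- ln ?\<tau>) = (s / 2) * ln T + (- s) * ln z"
      using assms by (simp add: ln_div ln_realpow algebra_simps)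
    then show ?thesis unfolding powr_def using assms by (simp only: exp_add) simp
  qed
  also have "max 1 (T powr (s / 2) * z powr (- s)) \<le> max (T powr (s / 2)) (2 powr s) * z powr (- s)"
  proof -
    have "1 = z powr s * z powr (- s)" using assms by (simp flip: powr_add)
    also have "\<dots> \<le> 2 powr s * z powr (- s)" using assms by (intro mult_right_mono powr_mono2) auto
    also have "\<dots> \<le> max (T powr (s / 2)) (2 powr s) * z powr (- s)" by (intro mult_right_mono) auto
    finally show ?thesis by (simp add: mult_right_mono)
  qed
  finally show ?thesis .
qed

section \<open>Integrability of powers of the norm\<close>

lemma nn_integral_lborel_affine:
  fixes f :: "'a::euclidean_space \<Rightarrow> ennreal"
  assumes "f \<in> borel_measurable borel" "c \<noteq> 0"
  shows "(\<integral>\<^sup>+ y. f y \<partial>lborel) = ennreal (\<bar>c\<bar> ^ DIM('a)) * (\<integral>\<^sup>+ y. f (t + c *\<^sub>R y) \<partial>lborel)"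
proof -
  note [measurable] = assms(1)
  have "(\<integral>\<^sup>+ y. f y \<partial>lborel) = (\<integral>\<^sup>+ y. f y \<partial>density (distr lborel borel (\<lambda>y. t + c *\<^sub>R y)) (\<lambda>_. \<bar>c\<bar> ^ DIM('a)))"
    using lborel_affine[OF assms(2), of t] by simp
  also have "\<dots> = (\<integral>\<^sup>+ y. ennreal (\<bar>c\<bar> ^ DIM('a)) * f (t + c *\<^sub>R y) \<partial>lborel)"
    by (subst nn_integral_density) (auto simp: nn_integral_distr)
  also have "\<dots> = ennreal (\<bar>c\<bar> ^ DIM('a)) * (\<integral>\<^sup>+ y. f (t + c *\<^sub>R y) \<partial>lborel)"
    by (rule nn_integral_cmult) measurable
  finally show ?thesis .
qed

text \<open>Dyadic comparison: balls of radius 2 * 2^(-k) with weight 2^(k p) have total size a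
  geometric series of ratio 2^(p - n), which is below 1 exactly for p < n.\<close>

lemma nn_integral_norm_powr_finite:
  fixes p :: real
  assumes "0 \<le> p" "p < DIM('a::euclidean_space)"
  shows "(\<integral>\<^sup>+ y. ennreal (norm y powr (- p)) * indicator (ball (0::'a) 2) y \<partial>lborel) < \<infinity>"
proof -
  let ?n = "DIM('a)"
  let ?B = "\<lambda>k. ball (0::'a) (2 * (1 / 2) ^ k)"
  let ?V = "unit_ball_vol (real ?n)"
  have le: "ennreal (norm y powr (- p)) * indicator (ball 0 2) y \<le> (\<Sum>k. ennreal (2 powr (real k * p)) * indicator (?B k) y)" for y :: 'a
  proof (cases "y = 0 \<or> 2 \<le> norm y")
    case False
    then have y: "0 < norm y" "norm y < 2" by auto
    obtain k0 where k0: "(1 / 2) ^ k0 < norm y" using real_arch_pow_inv[OF y(1), of "1 / 2"] by auto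
    \<comment> \<open>Minimality puts y into the k-th ball, while the defining inequality bounds the
      singular weight at y by the weight of that ball.\<close>
    define k where "k = (LEAST k. (1 / 2) ^ k \<le> norm y)"
    have k: "(1 / 2) ^ k \<le> norm y" unfolding k_def by (rule LeastI[of _ k0]) (use k0 in simp)
    have k': "norm y < 2 * (1 / 2) ^ k"
    proof (cases k)
      case 0
      then show ?thesis using y by simp
    next
      case (Suc j)
      then have "\<not> (1 / 2) ^ j \<le> norm y" using not_less_Least[of j "\<lambda>k. (1 / 2) ^ k \<le> norm y"] by (simp add: k_def)
      then show ?thesis by (simp add: Suc)
    qed
    have "norm y powr (- p) \<le> ((1 / 2) ^ k) powr (- p)"
      using assms k by (intro powr_mono2') auto
    also have "\<dots> = 2 powr (real k * p)"
    proof -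
      have "2 powr (- real k) = inverse (2 ^ k)" by (simp add: powr_minus powr_realpow)
      then have "((1 / 2) ^ k :: real) = 2 powr (- real k)" by (simp add: power_one_over inverse_eq_divide)
      then show ?thesis by (simp add: powr_powr)
    qed
    finally have h1: "ennreal (norm y powr (- p)) * indicator (ball 0 2) y \<le> ennreal (2 powr (real k * p)) * indicator (?B k) y"
      using k' y by (simp add: ennreal_leI)
    define g where "g k = ennreal (2 powr (real k * p)) * indicator (?B k) y" for k
    have "g k \<le> (\<Sum>k. g k)" using sum_le_suminf[of g "{k}"] by simp
    with h1 show ?thesis unfolding g_def by (rule order_trans)
  next
    case True
    then have "ennreal (norm y powr (- p)) * indicator (ball 0 2) y = 0" by (auto simp: indicator_def)
    then show ?thesis by (simp only: zero_le)
  qed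
  define q where "q = 2 powr (p - ?n)"
  have q: "0 < q" "q < 1" using assms powr_less_mono[of "p - real ?n" 0 2] by (simp_all add: q_def)
  have shell: "(\<integral>\<^sup>+ y. ennreal (2 powr (real k * p)) * indicator (?B k) y \<partial>lborel) = ennreal (2 ^ ?n * ?V * q ^ k)" for k
  proof -
    have "(\<integral>\<^sup>+ y. ennreal (2 powr (real k * p)) * indicator (?B k) y \<partial>lborel) = ennreal (2 powr (real k * p)) * ennreal (?V * (2 * (1 / 2) ^ k) ^ ?n)"
      by (subst nn_integral_cmult_indicator) (auto simp: emeasure_ball)
    also have "\<dots> = ennreal (2 powr (real k * p) * (?V * (2 * (1 / 2) ^ k) ^ ?n))"
      by (simp add: ennreal_mult)
    also have "2 powr (real k * p) * (?V * (2 * (1 / 2) ^ k) ^ ?n) = 2 ^ ?n * ?V * q ^ k"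
    proof -
      have "q ^ k = q powr real k" using q(1) by (simp only: powr_realpow)
      also have "\<dots> = 2 powr ((p - ?n) * real k)" by (simp only: q_def powr_powr)
      also have "(p - ?n) * real k = real k * p + - (real (k * ?n))" by (simp add: algebra_simps)
      also have "2 powr \<dots> = 2 powr (real k * p) * 2 powr (- (real (k * ?n)))" by (rule powr_add)
      also have "2 powr (- (real (k * ?n))) = inverse (2 ^ (k * ?n))" by (simp only: powr_minus powr_realpow[of 2] zero_less_numeral)
      also have "\<dots> = ((1 / 2) ^ k) ^ ?n" by (simp only: power_mult power_one_over inverse_eq_divide)
      finally have eq: "q ^ k = 2 powr (real k * p) * ((1 / 2) ^ k) ^ ?n" .
      show ?thesis unfolding eq power_mult_distrib by (simp only: mult_ac)
    qed
    finally show ?thesis .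
  qed
  have "(\<integral>\<^sup>+ y. ennreal (norm y powr (- p)) * indicator (ball (0::'a) 2) y \<partial>lborel)
      \<le> (\<integral>\<^sup>+ y. (\<Sum>k. ennreal (2 powr (real k * p)) * indicator (?B k) y) \<partial>lborel)"
    by (rule nn_integral_mono) (rule le)
  also have "\<dots> = (\<Sum>k. \<integral>\<^sup>+ y. ennreal (2 powr (real k * p)) * indicator (?B k) y \<partial>lborel)"
  proof (rule nn_integral_suminf)
    have [measurable]: "ball (0::'a) r \<in> sets borel" for r by simp
    show "(\<lambda>y. c * indicator (ball (0::'a) r) y) \<in> borel_measurable lborel" for c :: ennreal and r by measurable
  qed
  also have "\<dots> = (\<Sum>k. ennreal (2 ^ ?n * ?V * q ^ k))" by (simp only: shell)
  also have "\<dots> = ennreal (\<Sum>k. 2 ^ ?n * ?V * q ^ k)"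
  proof (rule suminf_ennreal2)
    show "summable (\<lambda>k. 2 ^ ?n * ?V * q ^ k)" using q by (intro summable_mult summable_geometric) simp
    show "0 \<le> 2 ^ ?n * ?V * q ^ k" for k using q by (intro mult_nonneg_nonneg) simp_all
  qed
  also have "\<dots> < \<infinity>" by (simp only: infinity_ennreal_def ennreal_less_top)
  finally show ?thesis .
qed

text \<open>The smallest of the three bases dominates. If some base is 0, the left side is 0 because
  \<open>0 powr p\<close> is 0.\<close>

lemma three_powr_le_sum:
  fixes a b c :: real
  assumes "0 \<le> a" "0 \<le> b" "0 \<le> c" "0 \<le> p" "0 \<le> q" "0 \<le> r"
  shows "a powr (- p) * b powr (- q) * c powr (- r)
    \<le> a powr (- (p + q + r)) + b powr (- (p + q + r)) + c powr (- (p + q + r))"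
proof (cases "a = 0 \<or> b = 0 \<or> c = 0")
  case True
  then show ?thesis by (auto intro!: add_nonneg_nonneg)
next
  case False
  define d where "d = min a (min b c)"
  have d: "0 < d" "d \<le> a" "d \<le> b" "d \<le> c" using assms False by (auto simp: d_def)
  have "a powr (- p) * b powr (- q) * c powr (- r) \<le> d powr (- p) * d powr (- q) * d powr (- r)"
    using d assms by (intro mult_mono powr_mono2') auto
  also have "\<dots> = d powr (- (p + q + r))" by (simp flip: powr_add)
  also have "\<dots> \<le> a powr (- (p + q + r)) + b powr (- (p + q + r)) + c powr (- (p + q + r))"
    unfolding d_def min_def by auto
  finally show ?thesis .
qed

text \<open>Once the singularities are separated, each is translated to the origin; the unit ball
  then moves into the ball of radius 2, so the bound is uniform in the centres.\<close>

lemma three_powr_integral_bounded: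
  fixes p q r :: real
  assumes "0 \<le> p" "0 \<le> q" "0 \<le> r" "p + q + r < DIM('a::euclidean_space)"
  shows "\<exists>C. \<forall>x\<in>ball 0 1. \<forall>w\<in>ball 0 1.
    (\<integral>\<^sup>+ y. ennreal (norm (y - x) powr (- p) * norm y powr (- q) * norm (y - w) powr (- r)) * indicator (ball (0::'a) 1) y \<partial>lborel) \<le> ennreal C"
proof -
  let ?e = "- (p + q + r)"
  let ?J = "\<lambda>z. \<integral>\<^sup>+ y. ennreal (norm (y - z) powr ?e) * indicator (ball (0::'a) 1) y \<partial>lborel"
  define J where "J = (\<integral>\<^sup>+ y. ennreal (norm y powr ?e) * indicator (ball (0::'a) 2) y \<partial>lborel)"
  have J: "J < \<infinity>" unfolding J_def by (rule nn_integral_norm_powr_finite) (use assms in auto)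
  have JJ: "?J z \<le> J" if "z \<in> ball 0 1" for z
  proof -
    have "?J z \<le> (\<integral>\<^sup>+ y. ennreal (norm (y - z) powr ?e) * indicator (ball (0::'a) 2) (y - z) \<partial>lborel)"
    proof (rule nn_integral_mono)
      fix y :: 'a
      have "y - z \<in> ball 0 2" if "y \<in> ball 0 1"
        using norm_triangle_ineq4[of y z] that \<open>z \<in> ball 0 1\<close> by simp
      then show "ennreal (norm (y - z) powr ?e) * indicator (ball 0 1) y \<le> ennreal (norm (y - z) powr ?e) * indicator (ball 0 2) (y - z)"
        by (auto simp: indicator_def simp del: mem_ball)
    qed
    also have "\<dots> = J"
    proof -
      have "(\<lambda>y. y - z) \<in> borel \<rightarrow>\<^sub>M borel"
        "(\<lambda>y. ennreal (norm y powr ?e) * indicator (ball (0::'a) 2) y) \<in> borel_measurable borel"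
        by (measurable; simp)+
      from measurable_compose[OF this]
      have "(\<lambda>y. ennreal (norm (y - z) powr ?e) * indicator (ball (0::'a) 2) (y - z)) \<in> borel_measurable borel" .
      from nn_integral_lborel_affine[OF this, of 1 z] show ?thesis unfolding J_def by simp
    qed
    finally show ?thesis .
  qed
  have "(\<integral>\<^sup>+ y. ennreal (norm (y - x) powr (- p) * norm y powr (- q) * norm (y - w) powr (- r)) * indicator (ball (0::'a) 1) y \<partial>lborel) \<le> ennreal (enn2real (J + J + J))"
    if "x \<in> ball 0 1" "w \<in> ball 0 1" for x w :: 'a
  proof -
    have "(\<integral>\<^sup>+ y. ennreal (norm (y - x) powr (- p) * norm y powr (- q) * norm (y - w) powr (- r)) * indicator (ball (0::'a) 1) y \<partial>lborel)
      \<le> (\<integral>\<^sup>+ y. ennreal (norm (y - x) powr ?e) * indicator (ball (0::'a) 1) y + ennreal (norm (y - 0) powr ?e) * indicator (ball (0::'a) 1) y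
          + ennreal (norm (y - w) powr ?e) * indicator (ball (0::'a) 1) y \<partial>lborel)"
    proof (rule nn_integral_mono)
      fix y :: 'a
      have "ennreal (norm (y - x) powr (- p) * norm y powr (- q) * norm (y - w) powr (- r))
         \<le> ennreal (norm (y - x) powr ?e + norm (y - 0) powr ?e + norm (y - w) powr ?e)"
        using three_powr_le_sum[of "norm (y - x)" "norm y" "norm (y - w)" p q r] assms by (intro ennreal_leI) simp
      also have "\<dots> = ennreal (norm (y - x) powr ?e) + ennreal (norm (y - 0) powr ?e) + ennreal (norm (y - w) powr ?e)"
        by (simp add: ennreal_plus)
      finally show "ennreal (norm (y - x) powr (- p) * norm y powr (- q) * norm (y - w) powr (- r)) * indicator (ball 0 1) y
        \<le> ennreal (norm (y - x) powr ?e) * indicator (ball (0::'a) 1) y + ennreal (norm (y - 0) powr ?e) * indicator (ball (0::'a) 1) y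
          + ennreal (norm (y - w) powr ?e) * indicator (ball (0::'a) 1) y"
        by (simp add: indicator_def)
    qed
    also have "\<dots> = ?J x + ?J 0 + ?J w"
    proof -
      have meas: "(\<lambda>y. ennreal (norm (y - z) powr ?e) * indicator (ball (0::'a) 1) y) \<in> borel_measurable lborel" for z
        by (measurable; simp)
      show ?thesis
        by (rule trans[OF nn_integral_add[OF borel_measurable_add[OF meas[of x] meas[of 0]] meas[of w]]])
           (simp only: nn_integral_add[OF meas meas])
    qed
    also have "\<dots> \<le> J + J + J" by (rule add_mono[OF add_mono[OF JJ[OF that(1)] JJ] JJ[OF that(2)]]) simp
    also have "\<dots> = ennreal (enn2real (J + J + J))" using J by (intro ennreal_enn2real[symmetric]) (simp only: ennreal_add_less_top infinity_ennreal_def)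
    finally show ?thesis .
  qed
  then show ?thesis by blast
qed

text \<open>The measure |y|^(-n) dy and the cone are invariant under dilations, so halving the
  radius leaves the integral unchanged. If it were finite, the shell in between would have integral
  zero, although it contains a nonempty open set.\<close>

lemma cone_integral_infinite:
  fixes e :: "'a::euclidean_space"
  assumes e: "norm e = 1" and \<rho>: "0 < \<rho>"
  shows "(\<integral>\<^sup>+ y. ennreal (norm y powr (- real DIM('a))) * indicator {y. 0 < norm y \<and> norm y < \<rho> \<and> norm y / 2 \<le> e \<bullet> y} y \<partial>lborel) = \<infinity>"
proof -
  let ?n = "real DIM('a)"
  define E where "E r = {y. 0 < norm y \<and> norm y < r \<and> norm y / 2 \<le> e \<bullet> y}" for r
  have [measurable]: "E r \<in> sets borel" for r unfolding E_def by measurable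
  define I where "I r = (\<integral>\<^sup>+ y. ennreal (norm y powr (- ?n)) * indicator (E r) y \<partial>lborel)" for r
  have half: "I (\<rho> / 2) = I \<rho>"
  proof -
    have "I (\<rho> / 2) = ennreal (\<bar>1 / 2\<bar> ^ DIM('a)) * (\<integral>\<^sup>+ y. ennreal (norm (0 + (1 / 2) *\<^sub>R y) powr (- ?n)) * indicator (E (\<rho> / 2)) (0 + (1 / 2) *\<^sub>R y) \<partial>lborel)"
      unfolding I_def by (rule nn_integral_lborel_affine) auto
    also have "\<dots> = (\<integral>\<^sup>+ y. ennreal (\<bar>1 / 2\<bar> ^ DIM('a)) * (ennreal (norm (0 + (1 / 2) *\<^sub>R y) powr (- ?n)) * indicator (E (\<rho> / 2)) (0 + (1 / 2) *\<^sub>R y)) \<partial>lborel)"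
      by (rule nn_integral_cmult[symmetric]) measurable
    also have "\<dots> = I \<rho>"
      unfolding I_def
    proof (rule nn_integral_cong)
      fix y :: 'a
      have ind: "indicator (E (\<rho> / 2)) (0 + (1 / 2) *\<^sub>R y) = (indicator (E \<rho>) y :: ennreal)"
        by (auto simp: E_def indicator_def)
      have "\<bar>1 / 2\<bar> ^ DIM('a) * norm (0 + (1 / 2) *\<^sub>R y) powr (- ?n) = norm y powr (- ?n)"
      proof -
        have "norm (0 + (1 / 2) *\<^sub>R y) powr (- ?n) = (1 / 2) powr (- ?n) * norm y powr (- ?n)"
          by (simp add: powr_mult[symmetric])
        moreover have "\<bar>1 / 2\<bar> ^ DIM('a) = (1 / 2 :: real) powr ?n" by (simp add: powr_realpow)
        ultimately show ?thesis by (simp flip: powr_add mult.assoc)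
      qed
      then show "ennreal (\<bar>1 / 2\<bar> ^ DIM('a)) * (ennreal (norm (0 + (1 / 2) *\<^sub>R y) powr (- ?n)) * indicator (E (\<rho> / 2)) (0 + (1 / 2) *\<^sub>R y))
        = ennreal (norm y powr (- ?n)) * indicator (E \<rho>) y"
        unfolding ind by (simp flip: mult.assoc ennreal_mult')
    qed
    finally show ?thesis .
  qed
  have split: "I \<rho> = I (\<rho> / 2) + (\<integral>\<^sup>+ y. ennreal (norm y powr (- ?n)) * indicator (E \<rho> - E (\<rho> / 2)) y \<partial>lborel)"
  proof -
    have "I \<rho> = (\<integral>\<^sup>+ y. ennreal (norm y powr (- ?n)) * indicator (E (\<rho> / 2)) y + ennreal (norm y powr (- ?n)) * indicator (E \<rho> - E (\<rho> / 2)) y \<partial>lborel)"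
      unfolding I_def using \<rho> by (intro nn_integral_cong) (auto simp: E_def indicator_def)
    then show ?thesis unfolding I_def by (subst (asm) nn_integral_add) measurable
  qed
  have "I \<rho> = \<infinity>"
  proof (rule ccontr)
    assume "I \<rho> \<noteq> \<infinity>"
    then have "(\<integral>\<^sup>+ y. ennreal (norm y powr (- ?n)) * indicator (E \<rho> - E (\<rho> / 2)) y \<partial>lborel) = 0"
    proof -
      have "I \<rho> + (\<integral>\<^sup>+ y. ennreal (norm y powr (- ?n)) * indicator (E \<rho> - E (\<rho> / 2)) y \<partial>lborel) = I \<rho> + 0"
        using split unfolding half by simp
      then show ?thesis using \<open>I \<rho> \<noteq> \<infinity>\<close> by (simp only: ennreal_add_left_cancel) simp
    qed
    then have AE0: "AE y in lborel. ennreal (norm y powr (- ?n)) * indicator (E \<rho> - E (\<rho> / 2)) y = 0"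
      by (subst (asm) nn_integral_0_iff_AE) measurable
    define V where "V = {y::'a. \<rho> / 2 < norm y \<and> norm y < \<rho> \<and> norm y / 2 < e \<bullet> y}"
    have "open V" unfolding V_def by (intro open_Collect_conj open_Collect_less continuous_intros) auto
    have "AE y in lborel. y \<notin> V"
      using AE0
    proof eventually_elim
      case (elim y)
      show ?case
      proof
        assume "y \<in> V"
        then have "y \<in> E \<rho> - E (\<rho> / 2)" "0 < norm y" using \<rho> by (auto simp: V_def E_def)
        then show False using elim by (simp add: ennreal_eq_0_iff)
      qed
    qed
    then have "V \<in> null_sets lborel" using \<open>open V\<close> by (subst AE_iff_null_sets) auto
    then have "negligible V" by (simp add: negligible_iff_null_sets null_sets_completionI)
    moreover have "(3 / 4 * \<rho>) *\<^sub>R e \<in> V" using e \<rho> by (simp add: V_def dot_square_norm)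
    ultimately show False using open_not_negligible[OF \<open>open V\<close>] by auto
  qed
  then show ?thesis by (simp add: I_def E_def)
qed

subsection \<open>Consequences of integrability of the exponential\<close>

text \<open>On a cone around B, where B \<bullet> x \<ge> |B| |x| / 2, a nonzero B contributes at
  least a multiple of 1/|x|, which beats every logarithm. If B = 0 and \<alpha> \<le> -n, the
  logarithm alone suffices. In both cases exp u is at least a multiple of |x|^(-n) on a cone and is
  not integrable.\<close>

lemma singular_part_trivial:
  fixes u :: "'a::euclidean_space \<Rightarrow> real" and B :: 'a
  assumes \<rho>: "0 < \<rho>" and T: "0 < T"
    and lower: "\<And>x. 0 < norm x \<Longrightarrow> norm x < \<rho> \<Longrightarrow>
      \<alpha> * ln (norm x) + (B \<bullet> x) / (norm x)\<^sup>2 * max 0 (1 - (norm x)\<^sup>2 / T) ^ N - M \<le> u x"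
    and int: "(\<integral>\<^sup>+ x. ennreal (exp (u x)) * indicator (ball 0 \<rho> - {0}) x \<partial>lborel) < \<infinity>"
  shows "B = 0 \<and> - real DIM('a) < \<alpha>"
proof (rule ccontr)
  assume neg: "\<not> (B = 0 \<and> - real DIM('a) < \<alpha>)"
  let ?n = "real DIM('a)"
  obtain i :: 'a where i: "i \<in> Basis" using nonempty_Basis by blast
  \<comment> \<open>The axis of the cone; for B = 0 any unit vector will do.\<close>
  define e where "e = (if B = 0 then i else B /\<^sub>R norm B)"
  have e: "norm e = 1" using i by (auto simp: e_def)
  have Be: "B \<bullet> x = norm B * (e \<bullet> x)" for x by (auto simp: e_def)
  have "\<exists>\<rho>'. 0 < \<rho>' \<and> \<rho>' \<le> \<rho> \<and> (\<forall>x. 0 < norm x \<and> norm x < \<rho>' \<and> norm x / 2 \<le> e \<bullet> x \<longrightarrow>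
     - ?n * ln (norm x) \<le> \<alpha> * ln (norm x) + (B \<bullet> x) / (norm x)\<^sup>2 * max 0 (1 - (norm x)\<^sup>2 / T) ^ N)"
  proof (cases "B = 0")
    case True
    then have "\<alpha> \<le> - ?n" using neg by simp
    then have "- ?n * ln (norm x) \<le> \<alpha> * ln (norm x)" if "0 < norm x" "norm x < min \<rho> 1" for x :: 'a
      using that by (intro mult_right_mono_neg) auto
    then show ?thesis using \<rho> True by (intro exI[of _ "min \<rho> 1"]) auto
  next
    case False
    define \<kappa> where "\<kappa> = norm B / 2 * (1 / 2) ^ N"
    have \<kappa>: "0 < \<kappa>" using False by (simp add: \<kappa>_def)
    define L where "L = \<bar>?n + \<alpha>\<bar>"
    have L: "0 \<le> L" by (simp add: L_def)
    \<comment> \<open>Below sqrt (T / 2) the truncation factor is at least 1/2, which explains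
      (1/2)^N in \<kappa>. The last entry gives 2 L sqrt r \<le> \<kappa>, so that \<kappa> / r
      exceeds L (-ln r) by way of -ln r \<le> 2 / sqrt r.\<close>
    define \<rho>' where "\<rho>' = min (min \<rho> 1) (min (sqrt (T / 2)) ((\<kappa> / (2 * L + 1))\<^sup>2))"
    have \<rho>': "0 < \<rho>'" using \<rho> T \<kappa> L by (simp add: \<rho>'_def)
    have "- ?n * ln (norm x) \<le> \<alpha> * ln (norm x) + (B \<bullet> x) / (norm x)\<^sup>2 * max 0 (1 - (norm x)\<^sup>2 / T) ^ N"
      if x: "0 < norm x" "norm x < \<rho>'" "norm x / 2 \<le> e \<bullet> x" for x :: 'a
    proof -
      define r where "r = norm x"
      have r: "0 < r" "r < 1" "r < sqrt (T / 2)" "r < (\<kappa> / (2 * L + 1))\<^sup>2" using x by (auto simp: r_def \<rho>'_def)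
      have "r\<^sup>2 < (sqrt (T / 2))\<^sup>2" using r by (intro power_strict_mono) auto
      then have "r\<^sup>2 / T \<le> 1 / 2" using T by (simp add: field_simps)
      then have "1 / 2 \<le> 1 - r\<^sup>2 / T" by linarith
      then have "1 / 2 \<le> max 0 (1 - r\<^sup>2 / T)" by (rule max.coboundedI2)
      then have pw: "(1 / 2) ^ N \<le> max 0 (1 - r\<^sup>2 / T) ^ N" by (rule power_mono) simp
      have "norm B * (r / 2) \<le> B \<bullet> x" unfolding Be using x by (intro mult_left_mono) (auto simp: r_def)
      then have "norm B * (r / 2) / r\<^sup>2 \<le> (B \<bullet> x) / r\<^sup>2" by (intro divide_right_mono) auto
      then have "norm B / 2 / r \<le> (B \<bullet> x) / r\<^sup>2" using r by (simp add: power2_eq_square)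
      then have "norm B / 2 / r * (1 / 2) ^ N \<le> (B \<bullet> x) / r\<^sup>2 * max 0 (1 - r\<^sup>2 / T) ^ N"
        using pw r by (intro mult_mono) (auto intro: order_trans[rotated])
      then have 1: "\<kappa> / r \<le> (B \<bullet> x) / r\<^sup>2 * max 0 (1 - r\<^sup>2 / T) ^ N" by (simp add: \<kappa>_def)
      have sr: "0 < sqrt r" "sqrt r * sqrt r = r" using r by auto
      have "ln (1 / sqrt r) \<le> 1 / sqrt r" using sr by (intro ln_bound) auto
      then have "- ln r \<le> 2 / sqrt r" using r by (simp add: ln_div ln_sqrt)
      then have "L * (- ln r) \<le> L * (2 / sqrt r)" using L by (intro mult_left_mono) auto
      also have "\<dots> = (2 * L * sqrt r) / r"
      proof -
        have "L * (2 / q) = (2 * L * q) / (q * q)" if "0 < q" for q :: real using that by simp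
        from this[OF sr(1)] show ?thesis unfolding sr(2) .
      qed
      also have "\<dots> \<le> \<kappa> / r"
      proof (rule divide_right_mono)
        have "sqrt r \<le> \<kappa> / (2 * L + 1)" using r \<kappa> L by (intro real_le_lsqrt) auto
        then have "(2 * L + 1) * sqrt r \<le> \<kappa>" using L by (simp add: field_simps)
        then have "2 * L * sqrt r + sqrt r \<le> \<kappa>" by (simp add: distrib_right)
        with sr(1) show "2 * L * sqrt r \<le> \<kappa>" by linarith
      qed (use r in simp)
      finally have 2: "L * (- ln r) \<le> \<kappa> / r" .
      have "- (?n + \<alpha>) * ln r \<le> L * (- ln r)"
      proof -
        have "(?n + \<alpha>) * (- ln r) \<le> L * (- ln r)" using r by (intro mult_right_mono) (auto simp: L_def)
        then show ?thesis by (simp only: minus_mult_left[symmetric] mult_minus_right)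
      qed
      with 1 2 show ?thesis unfolding r_def[symmetric] by (simp add: algebra_simps)
    qed
    then show ?thesis using \<rho>' by (intro exI[of _ \<rho>']) (auto simp: \<rho>'_def)
  qed
  then obtain \<rho>' where \<rho>': "0 < \<rho>'" "\<rho>' \<le> \<rho>" and low: "\<And>x. 0 < norm x \<Longrightarrow> norm x < \<rho>' \<Longrightarrow> norm x / 2 \<le> e \<bullet> x \<Longrightarrow>
     - ?n * ln (norm x) \<le> \<alpha> * ln (norm x) + (B \<bullet> x) / (norm x)\<^sup>2 * max 0 (1 - (norm x)\<^sup>2 / T) ^ N" by blast
  define E where "E = {y. 0 < norm y \<and> norm y < \<rho>' \<and> norm y / 2 \<le> e \<bullet> y}"
  have [measurable]: "E \<in> sets borel" unfolding E_def by measurable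
  have "ennreal (exp (- M)) * (\<integral>\<^sup>+ y. ennreal (norm y powr (- ?n)) * indicator E y \<partial>lborel)
     = (\<integral>\<^sup>+ y. ennreal (exp (- M)) * (ennreal (norm y powr (- ?n)) * indicator E y) \<partial>lborel)"
    by (rule nn_integral_cmult[symmetric]) measurable
  also have "\<dots> \<le> (\<integral>\<^sup>+ x. ennreal (exp (u x)) * indicator (ball 0 \<rho> - {0}) x \<partial>lborel)"
  proof (rule nn_integral_mono)
    fix y :: 'a
    show "ennreal (exp (- M)) * (ennreal (norm y powr (- ?n)) * indicator E y) \<le> ennreal (exp (u y)) * indicator (ball 0 \<rho> - {0}) y"
    proof (cases "y \<in> E")
      case True
      then have y: "0 < norm y" "norm y < \<rho>'" "norm y / 2 \<le> e \<bullet> y" by (auto simp: E_def)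
      have "exp (- M) * norm y powr (- ?n) = exp (- ?n * ln (norm y) - M)"
      proof -
        have "norm y powr (- ?n) = exp (- ?n * ln (norm y))" using y by (simp add: powr_def)
        then show ?thesis by (simp only: exp_add[symmetric] add.commute[of "- M"] diff_conv_add_uminus)
      qed
      also have "\<dots> \<le> exp (u y)" using low[OF y] lower[of y] y \<rho>' by simp
      finally have "ennreal (exp (- M)) * ennreal (norm y powr (- ?n)) \<le> ennreal (exp (u y))"
        by (simp add: ennreal_leI flip: ennreal_mult')
      moreover have "y \<in> ball 0 \<rho> - {0}" using y \<rho>' by auto
      ultimately show ?thesis using True by (simp only: indicator_simps mult_1_right)
    qed simp
  qed
  finally have "ennreal (exp (- M)) * (\<integral>\<^sup>+ y. ennreal (norm y powr (- ?n)) * indicator E y \<partial>lborel) < \<infinity>"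
    using int by (rule le_less_trans)
  moreover have "(\<integral>\<^sup>+ y. ennreal (norm y powr (- ?n)) * indicator E y \<partial>lborel) = \<infinity>"
    unfolding E_def by (rule cone_integral_infinite[OF e \<rho>'(1)])
  ultimately show False by (simp add: ennreal_mult_top)
qed

text \<open>Jensen's inequality for \<open>exp\<close> with respect to the sub-probability measure \<open>f / M\<close>, proved
  through the tangent line of \<open>exp\<close> at the mean.\<close>

lemma exp_integral_le:
  fixes f g :: "'a::euclidean_space \<Rightarrow> real"
  assumes f: "integrable lborel f" and pos: "AE w in lborel. 0 \<le> f w"
    and M: "0 < M" "(LINT w|lborel. f w) \<le> M"
    and fg: "integrable lborel (\<lambda>w. f w * g w)"
  shows "ennreal (exp (LINT w|lborel. f w * g w)) \<le> 1 + ennreal (1 / M) * (\<integral>\<^sup>+ w. ennreal (f w * exp (M * g w)) \<partial>lborel)"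
proof -
  define a where "a = (LINT w|lborel. f w * g w)"
  define \<theta> where "\<theta> = (LINT w|lborel. f w) / M"
  have \<theta>: "0 \<le> \<theta>" "\<theta> \<le> 1" using M integral_nonneg_AE[OF pos] by (auto simp: \<theta>_def)
  define L where "L w = exp a * ((1 - a) * f w + M * (f w * g w))" for w
  have intL: "integrable lborel L" unfolding L_def using f fg by auto
  have "(LINT w|lborel. L w) = exp a * ((1 - a) * (LINT w|lborel. f w) + M * a)"
    unfolding L_def a_def using f fg by simp
  also have "\<dots> = M * (exp a * ((1 - a) * \<theta> + a))" using M by (simp add: \<theta>_def field_simps)
  finally have IL: "(1 / M) * (LINT w|lborel. L w) = exp a * ((1 - a) * \<theta> + a)" using M by simp
  \<comment> \<open>The mass \<theta> of f / M may fall short of 1. The deficit enters as X (1 -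
    \<theta>), and since X \<le> 1 it is covered by the summand 1 in the conclusion.\<close>
  define X where "X = exp a * (1 - a)"
  have X: "X \<le> 1" unfolding X_def
  proof -
    have "1 - a \<le> exp (- a)" using exp_ge_add_one_self[of "- a"] by simp
    then have "exp a * (1 - a) \<le> exp a * exp (- a)" by (intro mult_left_mono) auto
    then show "exp a * (1 - a) \<le> 1" by (simp flip: exp_add)
  qed
  have "X * (1 - \<theta>) \<le> 1"
  proof (cases "0 \<le> X")
    case True
    then show ?thesis using X \<theta> by (intro mult_le_one) auto
  next
    case False
    then have "X * (1 - \<theta>) \<le> 0" using \<theta> by (intro mult_nonpos_nonneg) auto
    then show ?thesis by simp
  qed
  then have "exp a \<le> 1 + (1 / M) * (LINT w|lborel. L w)" unfolding IL X_def by (simp add: algebra_simps)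
  then have "ennreal (exp a) \<le> ennreal (1 + (1 / M) * (LINT w|lborel. L w))" by (rule ennreal_leI)
  also have "\<dots> \<le> 1 + ennreal (1 / M) * ennreal (LINT w|lborel. L w)"
  proof (cases "0 \<le> (LINT w|lborel. L w)")
    case True
    then show ?thesis using M by (simp add: ennreal_plus flip: ennreal_mult')
  next
    case False
    then have "1 + (1 / M) * (LINT w|lborel. L w) \<le> 1" using M by (simp add: divide_nonpos_pos)
    then have "ennreal (1 + (1 / M) * (LINT w|lborel. L w)) \<le> ennreal 1" by (rule ennreal_leI)
    also have "\<dots> \<le> 1 + ennreal (1 / M) * ennreal (LINT w|lborel. L w)" by simp
    finally show ?thesis .
  qed
  also have "ennreal (LINT w|lborel. L w) \<le> (\<integral>\<^sup>+ w. ennreal (f w * exp (M * g w)) \<partial>lborel)"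
  proof -
    have "(LINT w|lborel. L w) \<le> (LINT w|lborel. max 0 (L w))"
      using intL by (intro integral_mono) auto
    then have "ennreal (LINT w|lborel. L w) \<le> ennreal (LINT w|lborel. max 0 (L w))" by (rule ennreal_leI)
    also have "\<dots> = (\<integral>\<^sup>+ w. ennreal (max 0 (L w)) \<partial>lborel)"
      using intL by (intro nn_integral_eq_integral[symmetric]) auto
    also have "\<dots> \<le> (\<integral>\<^sup>+ w. ennreal (f w * exp (M * g w)) \<partial>lborel)"
    proof (rule nn_integral_mono_AE)
      show "AE w in lborel. ennreal (max 0 (L w)) \<le> ennreal (f w * exp (M * g w))"
        using pos
      proof eventually_elim
        case (elim w)
        have "1 + (M * g w - a) \<le> exp (M * g w - a)" by (rule exp_ge_add_one_self)
        then have "exp a * (1 + (M * g w - a)) \<le> exp a * exp (M * g w - a)" by (intro mult_left_mono) auto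
        then have "exp a * (1 + (M * g w - a)) \<le> exp (M * g w)" by (simp flip: exp_add)
        then have "f w * (exp a * (1 + (M * g w - a))) \<le> f w * exp (M * g w)" using elim by (rule mult_left_mono)
        moreover have "L w = f w * (exp a * (1 + (M * g w - a)))" by (simp add: L_def algebra_simps)
        moreover have "0 \<le> f w * exp (M * g w)" using elim by simp
        ultimately show ?case by (intro ennreal_leI) simp
      qed
    qed
    finally show ?thesis .
  qed
  finally show ?thesis unfolding a_def by (simp add: mult_left_mono add_left_mono)
qed

lemma small_mass_ball:
  fixes f :: "'a::euclidean_space \<Rightarrow> real"
  assumes f: "integrable lborel f" and \<epsilon>: "0 < \<epsilon>"
  shows "\<exists>r0>0. \<forall>r. 0 < r \<longrightarrow> r \<le> r0 \<longrightarrow> (LINT y|lborel. \<bar>f y\<bar> * indicator (ball 0 r) y) \<le> \<epsilon>"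
proof -
  define d where "d n = 1 / real (Suc n)" for n
  have dlim: "d \<longlonglongrightarrow> 0" unfolding d_def using LIMSEQ_inverse_real_of_nat by (simp add: inverse_eq_divide)
  have [measurable]: "f \<in> borel_measurable borel" using f by auto
  have I: "integrable lborel (\<lambda>y. \<bar>f y\<bar> * indicator (ball 0 r) y)" for r
    using f by (intro indicator_times_integrable_bound[where C = 1]) (auto simp: indicator_def)
  have "(\<lambda>n. LINT y|lborel. \<bar>f y\<bar> * indicator (ball 0 (d n)) y) \<longlonglongrightarrow> (LINT y::'a|lborel. (0::real))"
  proof (rule integral_dominated_convergence[where w = "\<lambda>y. \<bar>f y\<bar>" and f = "\<lambda>y. 0"])
    show "AE y in lborel. (\<lambda>n. \<bar>f y\<bar> * indicator (ball 0 (d n)) y) \<longlonglongrightarrow> 0"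
      using AE_lborel_singleton[of 0]
    proof eventually_elim
      case (elim y)
      have "\<forall>\<^sub>F n in sequentially. d n < norm y" using dlim elim by (intro order_tendstoD(2)) auto
      then have "\<forall>\<^sub>F n in sequentially. \<bar>f y\<bar> * indicator (ball 0 (d n)) y = 0" by (rule eventually_mono) auto
      then show ?case by (rule tendsto_eventually)
    qed
  qed (use f I in \<open>auto simp: indicator_def intro!: borel_measurable_integrable\<close>)
  then have "\<forall>\<^sub>F n in sequentially. (LINT y|lborel. \<bar>f y\<bar> * indicator (ball 0 (d n)) y) < \<epsilon>"
    using \<epsilon> by (intro order_tendstoD(2)) auto
  then obtain n where n: "(LINT y|lborel. \<bar>f y\<bar> * indicator (ball 0 (d n)) y) < \<epsilon>"
    by (auto simp: eventually_sequentially)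
  have "(LINT y|lborel. \<bar>f y\<bar> * indicator (ball 0 r) y) \<le> \<epsilon>" if "r \<le> d n" for r
  proof -
    have "(LINT y|lborel. \<bar>f y\<bar> * indicator (ball 0 r) y) \<le> (LINT y|lborel. \<bar>f y\<bar> * indicator (ball 0 (d n)) y)"
      using that by (intro integral_mono I) (auto simp: indicator_def)
    then show ?thesis using n by simp
  qed
  then show ?thesis by (intro exI[of _ "d n"]) (auto simp: d_def)
qed

lemma holder_potential:
  fixes f :: "'a::euclidean_space \<Rightarrow> real"
  assumes f: "integrable lborel f" and pos: "AE y in lborel. 0 \<le> f y"
    and par: "0 < \<gamma>" "\<gamma> \<le> 1" "0 < T" "1 \<le> N"
    and K: "\<And>x. x \<in> ball 0 r \<Longrightarrow> (\<integral>\<^sup>+ y. ennreal (f y * norm (y - x) powr (- \<gamma>)) \<partial>lborel) \<le> ennreal K"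
  defines "v \<equiv> \<lambda>x. LINT y|lborel. f y * log_kernel N ((norm (y - x))\<^sup>2 / T)"
  shows "\<exists>C\<ge>0. \<forall>x\<in>ball 0 r. \<forall>x'\<in>ball 0 r. \<bar>v x - v x'\<bar> \<le> C * dist x x' powr \<gamma>"
proof -
  have [measurable]: "f \<in> borel_measurable borel" using f by auto
  let ?P = "\<lambda>x y. f y * norm (y - x) powr (- \<gamma>)"
  let ?G = "\<lambda>x y. log_kernel N ((norm (y - x))\<^sup>2 / T)"
  have Ppos: "AE y in lborel. 0 \<le> ?P x y" for x using pos by eventually_elim simp
  have intP: "integrable lborel (?P x)" if "x \<in> ball 0 r" for x
    by (rule integrableI_nonneg) (use Ppos K[OF that] in \<open>auto intro: le_less_trans\<close>)
  \<comment> \<open>K may be negative, in which case \<open>ennreal K\<close> is 0; hence the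
    maximum with 0.\<close>
  have intPK: "(LINT y|lborel. ?P x y) \<le> max 0 K" if "x \<in> ball 0 r" for x
  proof -
    have "ennreal (LINT y|lborel. ?P x y) \<le> ennreal K"
      using nn_integral_eq_integral[OF intP[OF that] Ppos] K[OF that] by simp
    then show ?thesis by (auto simp: ennreal_le_iff2)
  qed
  have intG: "integrable lborel (\<lambda>y. f y * ?G x y)" if x: "x \<in> ball 0 r" for x
  proof (rule Bochner_Integration.integrable_bound[OF integrable_mult_right[OF intP[OF x], of "(2 / \<gamma>) * T powr (\<gamma> / 2)"]])
    show "(\<lambda>y. f y * ?G x y) \<in> borel_measurable lborel" by measurable
    show "AE y in lborel. norm (f y * ?G x y) \<le> norm ((2 / \<gamma>) * T powr (\<gamma> / 2) * ?P x y)"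
      using pos AE_lborel_singleton[of x]
    proof eventually_elim
      case (elim y)
      have z: "0 < norm (y - x)" using elim by simp
      have "0 \<le> ?G x y" using z par by (intro log_kernel_nonneg) auto
      moreover have "f y * ?G x y \<le> f y * ((2 / \<gamma>) * T powr (\<gamma> / 2) * norm (y - x) powr (- \<gamma>))"
        using elim z par by (intro mult_left_mono log_kernel_le_powr) auto
      ultimately show ?case using elim par by (simp add: mult_ac)
    qed
  qed
  have "\<bar>v x - v x'\<bar> \<le> ((2 / \<gamma>) * (2 * max 0 K)) * dist x x' powr \<gamma>"
    if x: "x \<in> ball 0 r" "x' \<in> ball 0 r" for x x'
  proof -
    have "v x - v x' = (LINT y|lborel. f y * ?G x y - f y * ?G x' y)"
      unfolding v_def using intG[OF x(1)] intG[OF x(2)] by (rule Bochner_Integration.integral_diff[symmetric])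
    also have "\<bar>\<dots>\<bar> \<le> (LINT y|lborel. \<bar>f y * ?G x y - f y * ?G x' y\<bar>)" by (rule integral_abs_bound)
    also have "\<dots> \<le> (LINT y|lborel. (2 / \<gamma>) * dist x x' powr \<gamma> * (?P x y + ?P x' y))"
    proof (rule integral_mono_AE)
      show "integrable lborel (\<lambda>y. \<bar>f y * ?G x y - f y * ?G x' y\<bar>)"
        using intG[OF x(1)] intG[OF x(2)] by (intro integrable_abs Bochner_Integration.integrable_diff)
      show "integrable lborel (\<lambda>y. (2 / \<gamma>) * dist x x' powr \<gamma> * (?P x y + ?P x' y))"
        using intP[OF x(1)] intP[OF x(2)] by (intro integrable_mult_right Bochner_Integration.integrable_add)
      show "AE y in lborel. \<bar>f y * ?G x y - f y * ?G x' y\<bar> \<le> (2 / \<gamma>) * dist x x' powr \<gamma> * (?P x y + ?P x' y)"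
        using pos AE_lborel_singleton[of x] AE_lborel_singleton[of x']
      proof eventually_elim
        case (elim y)
        have "\<bar>f y * ?G x y - f y * ?G x' y\<bar> = f y * \<bar>?G x y - ?G x' y\<bar>"
          using elim by (simp add: abs_mult flip: right_diff_distrib)
        also have "\<dots> \<le> f y * ((2 / \<gamma>) * dist x x' powr \<gamma> * (norm (y - x) powr (- \<gamma>) + norm (y - x') powr (- \<gamma>)))"
          using elim par by (intro mult_left_mono log_kernel_holder) auto
        finally show ?case by (simp only: distrib_left mult_ac)
      qed
    qed
    also have "\<dots> = (2 / \<gamma>) * dist x x' powr \<gamma> * ((LINT y|lborel. ?P x y) + (LINT y|lborel. ?P x' y))"
      using intP[OF x(1)] intP[OF x(2)] by simp
    also have "\<dots> \<le> (2 / \<gamma>) * dist x x' powr \<gamma> * (max 0 K + max 0 K)"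
      using par intPK x by (intro mult_left_mono add_mono) auto
    finally show ?thesis by (simp only: mult_2 mult_ac)
  qed
  then show ?thesis using par by (intro exI[of _ "(2 / \<gamma>) * (2 * max 0 K)"]) auto
qed

subsection \<open>Hoelder continuity of the potential\<close>

text \<open>The bound on f contains the potential of f itself. Mass of f away from 0 adds only a
  bounded amount to the potential at points near 0; the mass near 0 is small, and
  \<open>exp_integral_le\<close> turns its exponential into an average over w of |y - w|^(-s) plus a
  constant. What remains is the integral of |y - x|^(-\<gamma>) |y|^(-q) |y - w|^(-s), bounded
  uniformly in x and w because \<gamma> + q + s < n.\<close>

lemma singular_potential:
  fixes f :: "'a::euclidean_space \<Rightarrow> real"
  assumes par: "0 < T" "1 \<le> N" "0 < \<rho>" "\<rho> \<le> 1" "- real DIM('a) < \<alpha>" "0 \<le> C"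
    and f: "integrable lborel f" and pos: "AE y in lborel. 0 \<le> f y"
    and vint: "\<And>y. 0 < norm y \<Longrightarrow> norm y < \<rho> \<Longrightarrow> integrable lborel (\<lambda>w. f w * log_kernel N ((norm (w - y))\<^sup>2 / T))"
    and fb: "AE y in lborel. 0 < norm y \<and> norm y < \<rho> \<longrightarrow>
      f y \<le> C * norm y powr \<alpha> * exp (LINT w|lborel. f w * log_kernel N ((norm (w - y))\<^sup>2 / T))"
  shows "\<exists>r \<gamma> K. 0 < r \<and> r \<le> \<rho> \<and> 0 < \<gamma> \<and> \<gamma> < 1 \<and>
    (\<forall>x\<in>ball 0 r. (\<integral>\<^sup>+ y. ennreal (f y * norm (y - x) powr (- \<gamma>)) \<partial>lborel) \<le> ennreal K)"
proof -
  have [measurable]: "f \<in> borel_measurable borel" using f by auto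
  let ?G = "\<lambda>y w. log_kernel N ((norm (w - y))\<^sup>2 / T)"
  define n where "n = real DIM('a)"
  have n0: "0 < n" by (simp add: n_def)
  \<comment> \<open>A nonnegative exponent below n that still satisfies |y|^\<alpha> \<le> |y|^(-q)
    in the unit ball.\<close>
  define q where "q = max 0 (- \<alpha>)"
  have q: "0 \<le> q" "q < n" "- q \<le> \<alpha>" using par n0 by (auto simp: q_def n_def)
  \<comment> \<open>With \<gamma> \<le> s the three exponents add up to at most q + (n - q) / 2,
    which is below n.\<close>
  define s where "s = (n - q) / 4"
  have s: "0 < s" using q by (simp add: s_def)
  define \<gamma> where "\<gamma> = min s (1 / 2)"
  have \<gamma>: "0 < \<gamma>" "\<gamma> < 1" "\<gamma> \<le> s" using s by (auto simp: \<gamma>_def)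
  have sum: "\<gamma> + q + s < DIM('a)" using \<gamma> q unfolding n_def[symmetric] s_def by (simp add: field_simps)
  \<comment> \<open>The kernel grows like -2 ln, so exp (M G) is of order |y - w|^(-2M) = |y -
    w|^(-s). The local mass of f has to be at most this M.\<close>
  define M where "M = s / 2"
  have M: "0 < M" using s by (simp add: M_def)
  obtain r0 where r0: "0 < r0" "\<And>r. 0 < r \<Longrightarrow> r \<le> r0 \<Longrightarrow> (LINT y|lborel. \<bar>f y\<bar> * indicator (ball 0 r) y) \<le> M"
    using small_mass_ball[OF f M] by blast
  define r1 where "r1 = min \<rho> r0"
  have r1: "0 < r1" "r1 \<le> \<rho>" "r1 \<le> 1" "(LINT y|lborel. \<bar>f y\<bar> * indicator (ball 0 r1) y) \<le> M"
    using r0 par by (auto simp: r1_def)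
  define f1 where "f1 w = f w * indicator (ball 0 r1) w" for w
  \<comment> \<open>An everywhere nonnegative version of f1, which is nonnegative only almost
    everywhere; it lets constants be split off pointwise in \<open>ennreal\<close>.\<close>
  define F where "F w = max 0 (f w) * indicator (ball 0 r1) w" for w
  have [measurable]: "ball (0::'a) t \<in> sets borel" for t by simp
  have [measurable]: "f1 \<in> borel_measurable borel" "F \<in> borel_measurable borel" unfolding f1_def F_def by measurable
  have intf1: "integrable lborel f1"
    unfolding f1_def by (rule indicator_times_integrable_bound[OF f, where C = 1]) (auto simp: indicator_def)
  have intF: "integrable lborel F"
    unfolding F_def using f by (intro indicator_times_integrable_bound[where C = 1]) (auto simp: indicator_def)
  have pos1: "AE w in lborel. 0 \<le> f1 w" using pos by eventually_elim (simp add: f1_def)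
  have F0: "0 \<le> F w" for w by (simp add: F_def)
  have f1F: "f1 w \<le> F w" for w by (simp add: f1_def F_def indicator_def)
  have massf1: "(LINT w|lborel. f1 w) \<le> M"
  proof -
    have "(LINT w|lborel. f1 w) = (LINT w|lborel. \<bar>f w\<bar> * indicator (ball 0 r1) w)"
      by (rule integral_cong_AE) (use pos in \<open>auto simp: f1_def\<close>)
    then show ?thesis using r1 by simp
  qed
  define D where "D = max (T powr (s / 2)) (2 powr s)"
  have D: "0 \<le> D" by (simp add: D_def le_max_iff_disj)
  define g0 where "g0 = log_kernel N ((r1 / 2)\<^sup>2 / T)"
  have g0: "0 \<le> g0" unfolding g0_def using r1 par by (intro log_kernel_nonneg) auto
  \<comment> \<open>Contribution of the far mass: for |y| < r1 / 2 and |w| \<ge> r1 the points are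
    at least r1 / 2 apart, where the kernel is at most g0.\<close>
  define K0 where "K0 = g0 * (LINT w|lborel. f w)"
  define \<Phi> where "\<Phi> y = (\<integral>\<^sup>+ w. ennreal (F w * (D * norm (y - w) powr (- s))) \<partial>lborel)" for y
  have [measurable]: "\<Phi> \<in> borel_measurable borel" unfolding \<Phi>_def by measurable
  define A where "A = C * exp K0"
  have A: "0 \<le> A" using par by (simp add: A_def)

  have expv: "ennreal (exp (LINT w|lborel. f w * ?G y w)) \<le> ennreal (exp K0) * (1 + ennreal (1 / M) * \<Phi> y)"
    if y: "0 < norm y" "norm y < r1 / 2" for y
  proof -
    have vi: "integrable lborel (\<lambda>w. f w * ?G y w)" using vint[of y] y r1 by auto
    have i1: "integrable lborel (\<lambda>w. f1 w * ?G y w)"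
    proof -
      have "integrable lborel (\<lambda>w. (f w * ?G y w) * indicator (ball 0 r1) w)"
        by (rule indicator_times_integrable_bound[OF vi, where C = 1]) (auto simp: indicator_def)
      then show ?thesis by (simp add: f1_def mult_ac)
    qed
    have i2: "integrable lborel (\<lambda>w. f w * ?G y w - f1 w * ?G y w)" using vi i1 by simp
    have "(LINT w|lborel. f w * ?G y w - f1 w * ?G y w) \<le> (LINT w|lborel. g0 * f w)"
    proof (rule integral_mono_AE[OF i2])
      show "integrable lborel (\<lambda>w. g0 * f w)" using f by simp
      show "AE w in lborel. f w * ?G y w - f1 w * ?G y w \<le> g0 * f w"
        using pos
      proof eventually_elim
        case (elim w)
        show ?case
        proof (cases "w \<in> ball 0 r1")
          case True
          then show ?thesis using elim g0 by (simp add: f1_def)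
        next
          case False
          then have "r1 \<le> norm w" by simp
          moreover have "norm w \<le> norm (w - y) + norm y" using norm_triangle_ineq[of "w - y" y] by simp
          ultimately have "r1 / 2 \<le> norm (w - y)" using y by linarith
          then have "(r1 / 2)\<^sup>2 / T \<le> (norm (w - y))\<^sup>2 / T" using r1 par by (intro divide_right_mono power_mono) auto
          then have "?G y w \<le> g0" unfolding g0_def
            using log_kernel_diff_bounds(1)[of "(r1 / 2)\<^sup>2 / T" "(norm (w - y))\<^sup>2 / T" N] r1 par by simp
          then have "f w * ?G y w \<le> f w * g0" using elim by (rule mult_left_mono)
          then show ?thesis using False by (simp add: f1_def mult.commute)
        qed
      qed
    qed
    then have "(LINT w|lborel. f w * ?G y w) \<le> K0 + (LINT w|lborel. f1 w * ?G y w)"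
      using vi i1 by (simp add: K0_def)
    then have "ennreal (exp (LINT w|lborel. f w * ?G y w)) \<le> ennreal (exp (K0 + (LINT w|lborel. f1 w * ?G y w)))"
      by (intro ennreal_leI) simp
    also have "\<dots> = ennreal (exp K0) * ennreal (exp (LINT w|lborel. f1 w * ?G y w))"
      by (simp add: exp_add ennreal_mult')
    also have "ennreal (exp (LINT w|lborel. f1 w * ?G y w)) \<le> 1 + ennreal (1 / M) * (\<integral>\<^sup>+ w. ennreal (f1 w * exp (M * ?G y w)) \<partial>lborel)"
      by (rule exp_integral_le[OF intf1 pos1 M massf1 i1])
    also have "(\<integral>\<^sup>+ w. ennreal (f1 w * exp (M * ?G y w)) \<partial>lborel) \<le> \<Phi> y"
      unfolding \<Phi>_def
    proof (rule nn_integral_mono_AE)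
      show "AE w in lborel. ennreal (f1 w * exp (M * ?G y w)) \<le> ennreal (F w * (D * norm (y - w) powr (- s)))"
        using AE_lborel_singleton[of y]
      proof eventually_elim
        case (elim w)
        show ?case
        proof (cases "w \<in> ball 0 r1")
          case True
          have "norm (w - y) \<le> norm w + norm y" by (rule norm_triangle_ineq4)
          then have "0 < norm (w - y)" "norm (w - y) \<le> 2" using True y r1 elim by auto
          then have "exp (M * ?G y w) \<le> D * norm (w - y) powr (- s)"
            unfolding M_def D_def using par s by (intro exp_log_kernel_le) auto
          then have "f1 w * exp (M * ?G y w) \<le> F w * (D * norm (y - w) powr (- s))"
            using f1F F0 by (intro order_trans[OF mult_right_mono[OF f1F] mult_left_mono]) (auto simp: norm_minus_commute)
          then show ?thesis by (rule ennreal_leI)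
        next
          case False
          then show ?thesis by (simp add: f1_def)
        qed
      qed
    qed
    finally show ?thesis by (simp add: mult_left_mono add_left_mono)
  qed

  have fle: "AE y in lborel. 0 < norm y \<and> norm y < r1 / 2 \<longrightarrow>
     ennreal (f y) \<le> ennreal A * (ennreal (norm y powr (- q)) * (1 + ennreal (1 / M) * \<Phi> y))"
    using fb
  proof eventually_elim
    case (elim y)
    show ?case
    proof
      assume y: "0 < norm y \<and> norm y < r1 / 2"
      let ?v = "LINT w|lborel. f w * ?G y w"
      have "f y \<le> C * norm y powr \<alpha> * exp ?v" using elim y r1 by auto
      also have "\<dots> \<le> C * norm y powr (- q) * exp ?v"
        using par y r1 q by (intro mult_right_mono mult_left_mono powr_mono') auto
      finally have "ennreal (f y) \<le> ennreal (C * norm y powr (- q) * exp ?v)" by (rule ennreal_leI)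
      also have "\<dots> = ennreal C * ennreal (norm y powr (- q)) * ennreal (exp ?v)"
        using par by (simp add: ennreal_mult')
      also have "\<dots> \<le> ennreal C * ennreal (norm y powr (- q)) * (ennreal (exp K0) * (1 + ennreal (1 / M) * \<Phi> y))"
        using expv y by (intro mult_left_mono) auto
      also have "\<dots> = ennreal A * (ennreal (norm y powr (- q)) * (1 + ennreal (1 / M) * \<Phi> y))"
        using par by (simp add: A_def ennreal_mult' mult_ac)
      finally show "ennreal (f y) \<le> ennreal A * (ennreal (norm y powr (- q)) * (1 + ennreal (1 / M) * \<Phi> y))" .
    qed
  qed

  obtain C3 where C3: "\<And>x w. x \<in> ball 0 1 \<Longrightarrow> w \<in> ball 0 1 \<Longrightarrow>
    (\<integral>\<^sup>+ y. ennreal (norm (y - x) powr (- \<gamma>) * norm y powr (- q) * norm (y - w) powr (- s)) * indicator (ball (0::'a) 1) y \<partial>lborel) \<le> ennreal C3"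
    using three_powr_integral_bounded[OF less_imp_le[OF \<gamma>(1)] q(1) less_imp_le[OF s] sum] by blast
  \<comment> \<open>Then |x| < r and |y| \<ge> r1 / 2 force |y - x| \<ge> r, so outside the ball of
    radius r1 / 2 the weight is bounded and integrability of f is enough.\<close>
  define r where "r = r1 / 4"
  have r: "0 < r" "r \<le> \<rho>" "r \<le> 1" using r1 by (auto simp: r_def)
  define I where "I = (LINT w|lborel. F w)"
  define I' where "I' = (LINT w|lborel. f w)"
  define X where "X = ennreal A * (ennreal C3 + ennreal (1 / M) * (ennreal (D * I) * ennreal C3)) + ennreal (r powr (- \<gamma>) * I')"
  have bound: "(\<integral>\<^sup>+ y. ennreal (f y * norm (y - x) powr (- \<gamma>)) \<partial>lborel) \<le> X" if x: "x \<in> ball 0 r" for x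
  proof -
    have x1: "x \<in> ball 0 1" using x r by auto
    define k where "k w y = ennreal (norm (y - x) powr (- \<gamma>) * norm y powr (- q) * norm (y - w) powr (- s)) * indicator (ball 0 1) y" for w y :: 'a
    define a where "a y = ennreal (norm (y - x) powr (- \<gamma>) * norm y powr (- q)) * indicator (ball 0 1) y" for y :: 'a
    have [measurable]: "a \<in> borel_measurable borel" unfolding a_def by measurable
    have [measurable]: "(\<lambda>(w, y). k w y) \<in> borel_measurable (borel \<Otimes>\<^sub>M borel)" unfolding k_def by measurable
    have kC: "(\<integral>\<^sup>+ y. k w y \<partial>lborel) \<le> ennreal C3" if "w \<in> ball 0 1" for w
      unfolding k_def by (rule C3[OF x1 that])
    \<comment> \<open>The case w = 0 of \<open>kC\<close> also covers the constant in Jensen's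
      bound, as |y|^(-s) \<ge> 1 for nonzero y in the unit ball.\<close>
    have aint: "(\<integral>\<^sup>+ y. a y \<partial>lborel) \<le> ennreal C3"
    proof -
      have "(\<integral>\<^sup>+ y. a y \<partial>lborel) \<le> (\<integral>\<^sup>+ y. k 0 y \<partial>lborel)"
      proof (rule nn_integral_mono)
        fix y :: 'a
        show "a y \<le> k 0 y"
        proof (cases "y = 0 \<or> y \<notin> ball 0 1")
          case True
          then show ?thesis by (auto simp: a_def k_def indicator_def)
        next
          case False
          then have "1 \<le> norm y powr (- s)" using s powr_mono2'[of "- s" "norm y" 1] by auto
          then have "norm (y - x) powr (- \<gamma>) * norm y powr (- q) * 1 \<le> norm (y - x) powr (- \<gamma>) * norm y powr (- q) * norm (y - 0) powr (- s)"
            by (intro mult_left_mono) auto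
          then show ?thesis unfolding a_def k_def by (intro mult_right_mono ennreal_leI) auto
        qed
      qed
      then show ?thesis using kC[of 0] by (simp add: order_trans)
    qed
    have a\<Phi>: "(\<integral>\<^sup>+ y. a y * \<Phi> y \<partial>lborel) \<le> ennreal (D * I) * ennreal C3"
    proof -
      \<comment> \<open>After exchanging the integrals, y is integrated out for fixed w with the
        uniform bound C3, and only the mass of F remains.\<close>
      have "(\<integral>\<^sup>+ y. a y * \<Phi> y \<partial>lborel) = (\<integral>\<^sup>+ y. (\<integral>\<^sup>+ w. ennreal (D * F w) * k w y \<partial>lborel) \<partial>lborel)"
      proof (rule nn_integral_cong)
        fix y :: 'a
        have "a y * \<Phi> y = (\<integral>\<^sup>+ w. a y * ennreal (F w * (D * norm (y - w) powr (- s))) \<partial>lborel)"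
          unfolding \<Phi>_def by (rule nn_integral_cmult[symmetric]) measurable
        also have "\<dots> = (\<integral>\<^sup>+ w. ennreal (D * F w) * k w y \<partial>lborel)"
        proof (rule nn_integral_cong)
          fix w :: 'a
          show "a y * ennreal (F w * (D * norm (y - w) powr (- s))) = ennreal (D * F w) * k w y"
            unfolding a_def k_def using F0[of w] D by (simp add: ennreal_mult mult_ac)
        qed
        finally show "a y * \<Phi> y = (\<integral>\<^sup>+ w. ennreal (D * F w) * k w y \<partial>lborel)" .
      qed
      also have "\<dots> = (\<integral>\<^sup>+ w. (\<integral>\<^sup>+ y. ennreal (D * F w) * k w y \<partial>lborel) \<partial>lborel)"
        by (rule lborel_pair.Fubini') measurable
      also have "\<dots> \<le> (\<integral>\<^sup>+ w. ennreal (D * F w) * ennreal C3 \<partial>lborel)"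
      proof (rule nn_integral_mono)
        fix w :: 'a
        have "(\<integral>\<^sup>+ y. ennreal (D * F w) * k w y \<partial>lborel) = ennreal (D * F w) * (\<integral>\<^sup>+ y. k w y \<partial>lborel)"
          by (rule nn_integral_cmult) measurable
        also have "\<dots> \<le> ennreal (D * F w) * ennreal C3"
        proof (cases "w \<in> ball 0 1")
          case True
          then show ?thesis by (intro mult_left_mono kC) auto
        next
          case False
          then have "F w = 0" using r1 by (auto simp: F_def)
          then show ?thesis by simp
        qed
        finally show "(\<integral>\<^sup>+ y. ennreal (D * F w) * k w y \<partial>lborel) \<le> ennreal (D * F w) * ennreal C3" .
      qed
      also have "\<dots> = (\<integral>\<^sup>+ w. ennreal (D * F w) \<partial>lborel) * ennreal C3"
        by (rule nn_integral_multc) measurable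
      also have "(\<integral>\<^sup>+ w. ennreal (D * F w) \<partial>lborel) = ennreal (LINT w|lborel. D * F w)"
        using intF F0 D by (intro nn_integral_eq_integral) auto
      also have "(LINT w|lborel. D * F w) = D * I" by (simp add: I_def)
      finally show ?thesis .
    qed
    have "(\<integral>\<^sup>+ y. ennreal (f y * norm (y - x) powr (- \<gamma>)) \<partial>lborel)
        \<le> (\<integral>\<^sup>+ y. ennreal A * (a y * (1 + ennreal (1 / M) * \<Phi> y)) + ennreal (r powr (- \<gamma>) * f y) \<partial>lborel)"
    proof (rule nn_integral_mono_AE)
      show "AE y in lborel. ennreal (f y * norm (y - x) powr (- \<gamma>)) \<le> ennreal A * (a y * (1 + ennreal (1 / M) * \<Phi> y)) + ennreal (r powr (- \<gamma>) * f y)"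
        using fle pos AE_lborel_singleton[of 0]
      proof eventually_elim
        case (elim y)
        show ?case
        proof (cases "norm y < r1 / 2")
          case True
          have "ennreal (f y * norm (y - x) powr (- \<gamma>)) = ennreal (norm (y - x) powr (- \<gamma>)) * ennreal (f y)"
            by (simp add: ennreal_mult'' mult.commute)
          also have "\<dots> \<le> ennreal (norm (y - x) powr (- \<gamma>)) * (ennreal A * (ennreal (norm y powr (- q)) * (1 + ennreal (1 / M) * \<Phi> y)))"
            using elim True by (intro mult_left_mono) auto
          also have "\<dots> = ennreal A * (a y * (1 + ennreal (1 / M) * \<Phi> y))"
            using True r1 by (simp add: a_def ennreal_mult' mult_ac)
          finally show ?thesis by (rule order_trans) simp
        next
          case False
          have "norm y \<le> norm (y - x) + norm x" using norm_triangle_ineq[of "y - x" x] by simp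
          then have "r \<le> norm (y - x)" using False x by (simp add: r_def)
          then have "norm (y - x) powr (- \<gamma>) \<le> r powr (- \<gamma>)" using r \<gamma> by (intro powr_mono2') auto
          then have "f y * norm (y - x) powr (- \<gamma>) \<le> r powr (- \<gamma>) * f y"
            using elim by (subst mult.commute) (intro mult_right_mono, auto)
          then have "ennreal (f y * norm (y - x) powr (- \<gamma>)) \<le> ennreal (r powr (- \<gamma>) * f y)" by (rule ennreal_leI)
          then show ?thesis by (rule order_trans) simp
        qed
      qed
    qed
    also have "\<dots> = (\<integral>\<^sup>+ y. ennreal A * (a y * (1 + ennreal (1 / M) * \<Phi> y)) \<partial>lborel) + (\<integral>\<^sup>+ y. ennreal (r powr (- \<gamma>) * f y) \<partial>lborel)"
      by (rule nn_integral_add) measurable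
    also have "(\<integral>\<^sup>+ y. ennreal (r powr (- \<gamma>) * f y) \<partial>lborel) = ennreal (LINT y|lborel. r powr (- \<gamma>) * f y)"
      using f pos by (intro nn_integral_eq_integral) auto
    also have "(LINT y|lborel. r powr (- \<gamma>) * f y) = r powr (- \<gamma>) * I'" by (simp add: I'_def)
    also have "(\<integral>\<^sup>+ y. ennreal A * (a y * (1 + ennreal (1 / M) * \<Phi> y)) \<partial>lborel) = ennreal A * (\<integral>\<^sup>+ y. a y * (1 + ennreal (1 / M) * \<Phi> y) \<partial>lborel)"
      by (rule nn_integral_cmult) measurable
    also have "(\<integral>\<^sup>+ y. a y * (1 + ennreal (1 / M) * \<Phi> y) \<partial>lborel) = (\<integral>\<^sup>+ y. a y + ennreal (1 / M) * (a y * \<Phi> y) \<partial>lborel)"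
      by (intro nn_integral_cong) (simp add: distrib_left mult_ac)
    also have "\<dots> = (\<integral>\<^sup>+ y. a y \<partial>lborel) + (\<integral>\<^sup>+ y. ennreal (1 / M) * (a y * \<Phi> y) \<partial>lborel)"
      by (rule nn_integral_add) measurable
    also have "(\<integral>\<^sup>+ y. ennreal (1 / M) * (a y * \<Phi> y) \<partial>lborel) = ennreal (1 / M) * (\<integral>\<^sup>+ y. a y * \<Phi> y \<partial>lborel)"
      by (rule nn_integral_cmult) measurable
    also have "ennreal A * ((\<integral>\<^sup>+ y. a y \<partial>lborel) + ennreal (1 / M) * (\<integral>\<^sup>+ y. a y * \<Phi> y \<partial>lborel)) + ennreal (r powr (- \<gamma>) * I') \<le> X"
      unfolding X_def by (intro add_mono mult_left_mono aint a\<Phi>) auto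
    finally show ?thesis .
  qed
  have "X < top" unfolding X_def by (simp add: ennreal_mult_less_top)
  then have "X = ennreal (enn2real X)" by simp
  then show ?thesis using bound r \<gamma> by (intro exI[of _ r] exI[of _ \<gamma>] exI[of _ "enn2real X"]) auto
qed

section \<open>Lipschitz bounds for the regular part of the representation\<close>

lemma poly_lipschitz_unit:
  fixes p :: "real poly"
  shows "\<exists>L\<ge>0. \<forall>a\<in>{0..1}. \<forall>b\<in>{0..1}. \<bar>poly p a - poly p b\<bar> \<le> L * \<bar>a - b\<bar>"
proof -
  obtain L where L: "0 \<le> L" "\<forall>t\<in>{0..1}. \<bar>poly (pderiv p) t\<bar> \<le> L" using poly_bounded_unit by blast
  have *: "\<bar>poly p a - poly p b\<bar> \<le> L * \<bar>a - b\<bar>" if ab: "0 \<le> a" "a < b" "b \<le> 1" for a b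
  proof -
    obtain x where x: "a < x" "x < b" "poly p b - poly p a = (b - a) * poly (pderiv p) x"
      using poly_MVT[OF ab(2), of p] by blast
    have "\<bar>poly p a - poly p b\<bar> = \<bar>poly p b - poly p a\<bar>" by simp
    also have "\<dots> = \<bar>a - b\<bar> * \<bar>poly (pderiv p) x\<bar>" by (simp add: x(3) abs_mult abs_minus_commute)
    also have "\<dots> \<le> \<bar>a - b\<bar> * L" using L(2) x ab by (intro mult_left_mono) auto
    finally show ?thesis by (simp add: mult.commute)
  qed
  have "\<bar>poly p a - poly p b\<bar> \<le> L * \<bar>a - b\<bar>" if "a \<in> {0..1}" "b \<in> {0..1}" for a b
    using *[of a b] *[of b a] that by (cases a b rule: linorder_cases) (auto simp: abs_minus_commute)
  then show ?thesis using L(1) by blast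
qed

lemma radial_lipschitz:
  assumes s: "0 < s"
  shows "\<exists>L\<ge>0. \<forall>x\<in>ball 0 1. \<forall>x'\<in>ball 0 1. \<forall>y\<in>ball (0::'a::euclidean_space) 1.
    \<bar>radial p s x y - radial p s x' y\<bar> \<le> L * dist x x'"
proof -
  obtain L where L: "0 \<le> L" "\<forall>a\<in>{0..1}. \<forall>b\<in>{0..1}. \<bar>poly p a - poly p b\<bar> \<le> L * \<bar>a - b\<bar>"
    using poly_lipschitz_unit by blast
  have "\<bar>radial p s x y - radial p s x' y\<bar> \<le> (L * (4 / s)) * dist x x'"
    if "x \<in> ball 0 1" "x' \<in> ball 0 1" "y \<in> ball 0 1" for x x' y :: 'a
  proof -
    let ?a = "norm (y - x)" and ?b = "norm (y - x')"
    have ab: "?a \<le> 2" "?b \<le> 2" using that norm_triangle_ineq4[of y x] norm_triangle_ineq4[of y x'] by auto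
    have "\<bar>max 0 (1 - ?a\<^sup>2 / s) - max 0 (1 - ?b\<^sup>2 / s)\<bar> \<le> \<bar>?b\<^sup>2 / s - ?a\<^sup>2 / s\<bar>"
    proof -
      have "\<bar>max 0 (1 - a) - max 0 (1 - b)\<bar> \<le> \<bar>b - a\<bar>" for a b :: real by (auto simp: max_def)
      then show ?thesis .
    qed
    also have "\<dots> = \<bar>?b\<^sup>2 - ?a\<^sup>2\<bar> / s" unfolding diff_divide_distrib[symmetric] abs_divide using s by simp
    also have "?b\<^sup>2 - ?a\<^sup>2 = (?b + ?a) * (?b - ?a)" by (simp add: power2_eq_square algebra_simps)
    also have "\<bar>(?b + ?a) * (?b - ?a)\<bar> / s \<le> 4 * dist x x' / s"
    proof (rule divide_right_mono)
      have "\<bar>?b - ?a\<bar> \<le> dist x x'" using norm_triangle_ineq3[of "y - x'" "y - x"] by (simp add: dist_norm)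
      then show "\<bar>(?b + ?a) * (?b - ?a)\<bar> \<le> 4 * dist x x'" unfolding abs_mult using ab by (intro mult_mono) auto
    qed (use s in simp)
    finally have d: "\<bar>max 0 (1 - ?a\<^sup>2 / s) - max 0 (1 - ?b\<^sup>2 / s)\<bar> \<le> 4 * dist x x' / s" .
    have "\<bar>radial p s x y - radial p s x' y\<bar> \<le> L * \<bar>max 0 (1 - ?a\<^sup>2 / s) - max 0 (1 - ?b\<^sup>2 / s)\<bar>"
      unfolding radial_def using L(2) s by auto
    also have "\<dots> \<le> L * (4 * dist x x' / s)" using d L(1) by (rule mult_left_mono)
    finally show ?thesis by simp
  qed
  then show ?thesis using L(1) s by (intro exI[of _ "L * (4 / s)"]) auto
qed

lemma lipschitz_mollified:
  fixes U :: "'a::euclidean_space \<Rightarrow> real"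
  assumes U: "integrable lborel U" and supp: "\<And>y. y \<notin> ball 0 1 \<Longrightarrow> U y = 0" and s: "0 < s"
  shows "\<exists>L\<ge>0. \<forall>x\<in>ball 0 1. \<forall>x'\<in>ball 0 1.
    \<bar>(LINT y|lborel. U y * (c * radial p s x y)) - (LINT y|lborel. U y * (c * radial p s x' y))\<bar> \<le> L * dist x x'"
proof -
  obtain L where L: "0 \<le> L" "\<forall>x\<in>ball 0 1. \<forall>x'\<in>ball 0 1. \<forall>y\<in>ball (0::'a) 1. \<bar>radial p s x y - radial p s x' y\<bar> \<le> L * dist x x'"
    using radial_lipschitz[OF s] by blast
  obtain C where C: "C \<ge> 0" "\<forall>s>0. \<forall>x y::'a. \<bar>radial p s x y\<bar> \<le> C" using radial_bounded by blast
  have int: "integrable lborel (\<lambda>y. U y * (c * radial p s x y))" for x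
  proof (rule indicator_times_integrable_bound[OF U])
    show "\<bar>c * radial p s x y\<bar> \<le> \<bar>c\<bar> * C" for y using C s by (simp add: abs_mult mult_left_mono)
  qed simp
  define I where "I = (LINT y|lborel. \<bar>U y\<bar>)"
  have I: "0 \<le> I" by (simp add: I_def)
  have "\<bar>(LINT y|lborel. U y * (c * radial p s x y)) - (LINT y|lborel. U y * (c * radial p s x' y))\<bar> \<le> (\<bar>c\<bar> * L * I) * dist x x'"
    if x: "x \<in> ball 0 1" "x' \<in> ball 0 1" for x x'
  proof -
    have "(LINT y|lborel. U y * (c * radial p s x y)) - (LINT y|lborel. U y * (c * radial p s x' y))
      = (LINT y|lborel. U y * (c * radial p s x y) - U y * (c * radial p s x' y))"
      by (rule Bochner_Integration.integral_diff[OF int int, symmetric])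
    also have "\<bar>\<dots>\<bar> \<le> (LINT y|lborel. \<bar>U y * (c * radial p s x y) - U y * (c * radial p s x' y)\<bar>)"
      by (rule integral_abs_bound)
    also have "\<dots> \<le> (LINT y|lborel. (\<bar>c\<bar> * L * dist x x') * \<bar>U y\<bar>)"
    proof (rule integral_mono)
      fix y
      show "\<bar>U y * (c * radial p s x y) - U y * (c * radial p s x' y)\<bar> \<le> (\<bar>c\<bar> * L * dist x x') * \<bar>U y\<bar>"
      proof (cases "y \<in> ball 0 1")
        case True
        have "\<bar>U y * (c * radial p s x y) - U y * (c * radial p s x' y)\<bar> = (\<bar>U y\<bar> * \<bar>c\<bar>) * \<bar>radial p s x y - radial p s x' y\<bar>"
          by (simp add: abs_mult[symmetric] right_diff_distrib mult.assoc)
        also have "\<dots> \<le> (\<bar>U y\<bar> * \<bar>c\<bar>) * (L * dist x x')"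
          using L(2) x True by (intro mult_left_mono) auto
        finally show ?thesis by (simp only: mult_ac)
      qed (simp add: supp)
    qed (use int U in auto)
    also have "\<dots> = (\<bar>c\<bar> * L * I) * dist x x'" by (simp add: I_def)
    finally show ?thesis .
  qed
  then show ?thesis using L(1) I by (intro exI[of _ "\<bar>c\<bar> * L * I"]) auto
qed

text \<open>Inside the truncation radius the logarithm splits off, and what is left is a polynomial
  profile to which \<open>radial_lipschitz\<close> applies.\<close>

lemma log_kernel_radial:
  assumes "0 < norm x" "(norm x)\<^sup>2 < T" "0 < T"
  shows "log_kernel N ((norm x)\<^sup>2 / T) = - 2 * ln (norm x) + (ln T - radial (\<Sum>k=1..N. monom (1 / real k) k) T x 0)"
proof -
  have "log_kernel N ((norm x)\<^sup>2 / T) = - ln ((norm x)\<^sup>2 / T) - radial (\<Sum>k=1..N. monom (1 / real k) k) T x 0"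
    using assms by (simp add: log_kernel_def radial_def poly_sum poly_monom)
  then show ?thesis using assms by (simp add: ln_div ln_realpow)
qed

section \<open>Assembly of the asymptotic expansion\<close>

theorem theorem1p2:
  fixes m :: nat and K u :: "'a::euclidean_space \<Rightarrow> real"
  assumes dim: "DIM('a) = 2 * m" and m2: "m \<ge> 2"
    and K_meas: "set_borel_measurable lebesgue (ball 0 1) K"
    and K_bdd: "\<exists>C. AE x in lebesgue. x \<in> ball 0 1 \<longrightarrow> \<bar>K x\<bar> \<le> C"
    and K_nonneg: "AE x in lebesgue. x \<in> ball 0 1 \<longrightarrow> K x \<ge> 0"
    and u_reg: "Ck_on (2 * m) (ball 0 1 - {0}) u"
    and eq: "\<And>x. x \<in> ball 0 1 - {0} \<Longrightarrow> neg_lap_pow m u x = K x * exp (u x)"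
    and exp_int: "(\<integral>\<^sup>+ x \<in> ball 0 1 - {0}. ennreal (exp (u x)) \<partial>lebesgue) < \<infinity>"
    and small: "\<And>\<epsilon>. \<epsilon> > 0 \<Longrightarrow> \<forall>\<^sub>F r in at_right 0.
        (\<integral>\<^sup>+ x \<in> ball 0 r - {0}. ennreal \<bar>u x\<bar> \<partial>lebesgue) \<le> ennreal (\<epsilon> * r ^ (2 * m - 2))"
  shows "\<exists>\<alpha> \<rho> \<gamma> \<phi>. \<alpha> > - 2 * real m \<and> 0 < \<rho> \<and> \<rho> < 1 \<and> 0 < \<gamma> \<and> \<gamma> < 1 \<and>
           holder_on \<gamma> (ball 0 \<rho>) \<phi> \<and>
           (\<forall>x \<in> ball 0 \<rho> - {0}. u x = \<alpha> * ln (norm x) + \<phi> x)"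
proof -
  have m: "1 \<le> m" using m2 by simp
  let ?L = "laplacian ^^ m" and ?S = "ball 0 1 - {0} :: 'a set"
  have openS: "open (ball 0 r - {0} :: 'a set)" for r by (simp add: open_delete)
  have sub: "ball 0 r - {0} \<subseteq> ?S" if "r \<le> 1" for r using that by auto
  have contu: "continuous_on ?S u" "continuous_on ?S (?L u)"
    using Ck_on_continuous[OF u_reg] Ck_on_laplacian_pow[OF openS, of m 0 1 u] u_reg by simp_all
  have meas: "(\<lambda>y. indicator (ball 0 r - {0}) y * g y) \<in> borel_measurable borel"
    if "r \<le> 1" "continuous_on ?S g" for r and g :: "'a \<Rightarrow> real"
    using that by (intro borel_measurable_indicator_times_continuous openS) (auto intro: continuous_on_subset)
  have conte: "continuous_on ?S (\<lambda>y. exp (u y))" "continuous_on ?S (\<lambda>y. \<bar>u y\<bar>)"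
    by (intro continuous_intros contu)+
  have leb: "(\<integral>\<^sup>+ x \<in> ball 0 r - {0}. ennreal (g x) \<partial>lebesgue) = (\<integral>\<^sup>+ x. ennreal (indicator (ball 0 r - {0}) x * g x) \<partial>lborel)"
    if "r \<le> 1" "continuous_on ?S g" for r and g :: "'a \<Rightarrow> real"
  proof -
    have "(\<integral>\<^sup>+ x \<in> ball 0 r - {0}. ennreal (g x) \<partial>lebesgue) = (\<integral>\<^sup>+ x. ennreal (indicator (ball 0 r - {0}) x * g x) \<partial>lebesgue)"
      by (intro nn_integral_cong) (simp add: indicator_def)
    also have "\<dots> = (\<integral>\<^sup>+ x. ennreal (indicator (ball 0 r - {0}) x * g x) \<partial>lborel)"
      by (rule nn_integral_completion)
    finally show ?thesis .
  qed
  have intI: "integrable lborel (\<lambda>x. indicator (ball 0 r - {0}) x * g x)"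
    if "r \<le> 1" "continuous_on ?S g" "\<And>x. 0 \<le> g x" "(\<integral>\<^sup>+ x \<in> ball 0 r - {0}. ennreal (g x) \<partial>lebesgue) < \<infinity>" for r and g :: "'a \<Rightarrow> real"
    by (rule integrableI_nonneg) (use meas[OF that(1,2)] leb[OF that(1,2)] that(3,4) in auto)

  have ev1: "\<forall>\<^sub>F r in at_right 0. r < (1::real)" by (rule eventually_at_rightI[of 0 1]) auto
  have small': "\<forall>\<^sub>F r in at_right 0. (LINT y|lborel. indicator (ball 0 r - {0}) y * \<bar>u y\<bar>) \<le> \<epsilon> * r ^ (2 * m - 2)"
    if "0 < \<epsilon>" for \<epsilon>
    using small[OF that] ev1 eventually_at_right_less[of 0]
  proof eventually_elim
    case (elim r)
    have int: "integrable lborel (\<lambda>x. indicator (ball 0 r - {0}) x * \<bar>u x\<bar>)"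
      using elim by (intro intI conte) (auto intro: le_less_trans)
    have "ennreal (LINT y|lborel. indicator (ball 0 r - {0}) y * \<bar>u y\<bar>) = (\<integral>\<^sup>+ x. ennreal (indicator (ball 0 r - {0}) x * \<bar>u x\<bar>) \<partial>lborel)"
      by (rule nn_integral_eq_integral[OF int, symmetric]) simp
    also have "\<dots> \<le> ennreal (\<epsilon> * r ^ (2 * m - 2))" using elim leb[of r "\<lambda>y. \<bar>u y\<bar>"] conte by simp
    finally show ?case using elim that by (subst (asm) ennreal_le_iff) auto
  qed
  \<comment> \<open>Integrability of u is known only near the origin, from the smallness hypothesis
    with \<epsilon> = 1; u may fail to be integrable near the unit sphere. Hence the passage to a
    smaller ball.\<close>
  obtain R where R: "0 < R" "R < 1" "(\<integral>\<^sup>+ x \<in> ball 0 R - {0}. ennreal \<bar>u x\<bar> \<partial>lebesgue) < \<infinity>"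
  proof -
    have "\<forall>\<^sub>F r in at_right 0. 0 < r \<and> r < 1 \<and> (\<integral>\<^sup>+ x \<in> ball 0 r - {0}. ennreal \<bar>u x\<bar> \<partial>lebesgue) < \<infinity>"
      using small[OF zero_less_one] ev1 eventually_at_right_less[of "0::real"] by eventually_elim (auto intro: le_less_trans)
    from eventually_happens'[OF trivial_limit_at_right_real this] show ?thesis using that by blast
  qed
  let ?SR = "ball 0 R - {0} :: 'a set"
  define Ue Fe where "Ue y = indicator ?SR y * u y" and "Fe y = indicator ?SR y * ?L u y" for y
  have U: "integrable lborel Ue"
  proof (rule Bochner_Integration.integrable_bound[OF intI[of R "\<lambda>y. \<bar>u y\<bar>"]])
    show "Ue \<in> borel_measurable lborel" unfolding Ue_def using meas[of R u] R contu by simp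
    show "AE x in lborel. norm (Ue x) \<le> norm (indicator ?SR x * \<bar>u x\<bar>)" by (simp add: Ue_def abs_mult)
  qed (use R conte in auto)
  have AEl: "(AE x in lebesgue. P x) \<longleftrightarrow> (AE x in lborel. P x)" for P :: "'a \<Rightarrow> bool" by (rule AE_completion_iff)
  obtain C where C: "AE x in lborel. x \<in> ball 0 1 \<longrightarrow> \<bar>K x\<bar> \<le> C" using K_bdd unfolding AEl by blast
  define C' where "C' = max 0 C"
  have Kb: "AE x in lborel. x \<in> ?SR \<longrightarrow> 0 \<le> (-1) ^ m * Fe x \<and> (-1) ^ m * Fe x \<le> C' * exp (u x)"
    using C K_nonneg[unfolded AEl]
  proof eventually_elim
    case (elim x)
    show ?case
    proof
      assume x: "x \<in> ?SR"
      then have xS: "x \<in> ?S" "x \<in> ball 0 1" using R by auto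
      have "(-1) ^ m * Fe x = K x * exp (u x)" using eq[OF xS(1)] x by (simp add: Fe_def neg_lap_pow_def)
      moreover have "0 \<le> K x" "K x \<le> C'" using elim xS by (auto simp: C'_def)
      ultimately show "0 \<le> (-1) ^ m * Fe x \<and> (-1) ^ m * Fe x \<le> C' * exp (u x)" by (simp add: mult_right_mono)
    qed
  qed
  have pos: "AE x in lborel. 0 \<le> (-1) ^ m * Fe x"
    using Kb by eventually_elim (auto simp: Fe_def indicator_def)
  have intE: "integrable lborel (\<lambda>x. indicator ?S x * exp (u x))"
    by (rule intI) (use exp_int conte in auto)
  have F: "integrable lborel Fe"
  proof (rule Bochner_Integration.integrable_bound[OF integrable_mult_right[OF intE, of C']])
    show "Fe \<in> borel_measurable lborel" unfolding Fe_def using meas[of R "?L u"] R contu by simp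
    show "AE x in lborel. norm (Fe x) \<le> norm (C' * (indicator ?S x * exp (u x)))"
      using Kb
    proof eventually_elim
      case (elim x)
      show ?case
      proof (cases "x \<in> ?SR")
        case True
        then have "x \<in> ?S" using R by auto
        have "\<bar>Fe x\<bar> = \<bar>(-1) ^ m * Fe x\<bar>" by (simp add: abs_mult power_abs)
        then show ?thesis using elim True \<open>x \<in> ?S\<close> by (simp add: C'_def)
      qed (simp add: Fe_def)
    qed
  qed

  \<comment> \<open>With T = \<rho>0^2, the condition |x| < \<rho>0 gives both |x| + sqrt T < R, as
    the representation requires, and |x|^2 < T, so that the logarithm splits off.\<close>
  define \<rho>0 where "\<rho>0 = R / 2"
  define T where "T = \<rho>0\<^sup>2"
  have \<rho>0: "0 < \<rho>0" "\<rho>0 \<le> 1" "\<rho>0 < 1 / 2" using R by (auto simp: \<rho>0_def)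
  have T: "0 < T" "sqrt T = \<rho>0" using \<rho>0 by (auto simp: T_def)
  define N where "N = 2 * m + 1"
  have N: "1 \<le> N" by (simp add: N_def)
  define Q where "Q = mollifier_poly m"
  define c where "c = (LINT y|lborel. radial Q 1 (0::'a) y)"
  have c: "0 < (-1) ^ m * c" unfolding c_def Q_def by (rule mollifier_poly_mass[OF dim m])
  then have c0: "c \<noteq> 0" by auto
  let ?G = "\<lambda>x y. log_kernel N ((norm (y - x))\<^sup>2 / T)"
  obtain a0 a where rep: "\<And>x. x \<noteq> 0 \<Longrightarrow> norm x + sqrt T < R \<Longrightarrow>
    integrable lborel (\<lambda>y. Fe y * ?G x y) \<and>
    c * u x = (LINT y|lborel. Ue y * ((1 / T) ^ m * radial Q T x y)) + (LINT y|lborel. Fe y * ?G x y)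
    + a0 * log_kernel N ((norm x)\<^sup>2 / T) + (\<Sum>i\<in>Basis. a i * (2 * (x \<bullet> i) / (norm x)\<^sup>2 * max 0 (1 - (norm x)\<^sup>2 / T) ^ N))"
  proof -
    have "sqrt T < R" using T R by (simp add: \<rho>0_def)
    from representation[OF dim m R(1) T(1) this Ck_on_subset[OF u_reg sub] U[unfolded Ue_def[abs_def]] F[unfolded Fe_def[abs_def]] small' pos[unfolded Fe_def]] R
    show ?thesis using that unfolding Ue_def Fe_def N_def c_def Q_def by (auto 0 0)
  qed
  \<comment> \<open>Numerator and denominator both carry the sign (-1)^m, so f is nonnegative almost
    everywhere.\<close>
  define f where "f y = Fe y / c" for y
  have intf: "integrable lborel f" unfolding f_def using F by simp
  have fsg: "f y = ((-1) ^ m * Fe y) / ((-1) ^ m * c)" for y unfolding f_def by simp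
  have posf: "AE y in lborel. 0 \<le> f y" using pos by eventually_elim (use c in \<open>simp only: fsg divide_nonneg_pos\<close>)
  define v where "v x = (LINT y|lborel. f y * ?G x y)" for x
  define pp :: "real poly" where "pp = (\<Sum>k=1..N. monom (1 / real k) k)"
  define h where "h x = (1 / c) * (LINT y|lborel. Ue y * ((1 / T) ^ m * radial Q T x y)) + (a0 / c) * (ln T - radial pp T x 0)" for x
  \<comment> \<open>The factor -2 is the coefficient of ln |x| in \<open>log_kernel_radial\<close>;
    the gradient defects are collected into the single vector B.\<close>
  define \<alpha> where "\<alpha> = - 2 * (a0 / c)"
  define B where "B = (\<Sum>i\<in>Basis. (2 * a i / c) *\<^sub>R i)"
  have near: "norm x + sqrt T < R" "(norm x)\<^sup>2 < T" if "norm x < \<rho>0" for x :: 'a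
    using that T power_strict_mono[of "norm x" \<rho>0 2] by (auto simp: \<rho>0_def T_def)
  have ueq: "u x = \<alpha> * ln (norm x) + h x + (B \<bullet> x) / (norm x)\<^sup>2 * max 0 (1 - (norm x)\<^sup>2 / T) ^ N + v x"
    if x: "0 < norm x" "norm x < \<rho>0" for x
  proof -
    let ?w = "max 0 (1 - (norm x)\<^sup>2 / T) ^ N"
    have "x \<noteq> 0" using x by auto
    note r = rep[OF this near(1)[OF x(2)]]
    have vx: "v x = (1 / c) * (LINT y|lborel. Fe y * ?G x y)"
    proof -
      have "f y * ?G x y = (1 / c) * (Fe y * ?G x y)" for y by (simp add: f_def)
      then show ?thesis by (simp only: v_def integral_mult_right_zero)
    qed
    have Bx: "(B \<bullet> x) / (norm x)\<^sup>2 * ?w = (1 / c) * (\<Sum>i\<in>Basis. a i * (2 * (x \<bullet> i) / (norm x)\<^sup>2 * ?w))"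
      unfolding B_def inner_sum_left inner_scaleR_left sum_divide_distrib sum_distrib_left sum_distrib_right
      by (intro sum.cong refl) (simp add: inner_commute)
    have "u x = (1 / c) * (c * u x)" using c0 by simp
    also have "\<dots> = (1 / c) * (LINT y|lborel. Ue y * ((1 / T) ^ m * radial Q T x y)) + (1 / c) * (LINT y|lborel. Fe y * ?G x y)
      + (a0 / c) * log_kernel N ((norm x)\<^sup>2 / T) + (1 / c) * (\<Sum>i\<in>Basis. a i * (2 * (x \<bullet> i) / (norm x)\<^sup>2 * ?w))"
      using r by (simp only: distrib_left) (simp only: mult.assoc[symmetric] times_divide_eq_left mult_1)
    also have "log_kernel N ((norm x)\<^sup>2 / T) = - 2 * ln (norm x) + (ln T - radial pp T x 0)"
      unfolding pp_def by (rule log_kernel_radial[OF x(1) near(2)[OF x(2)] T(1)])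
    finally show ?thesis unfolding vx Bx h_def \<alpha>_def by (simp add: algebra_simps)
  qed
  have vint: "integrable lborel (\<lambda>y. f y * ?G x y)" if "0 < norm x" "norm x < \<rho>0" for x
  proof -
    have "x \<noteq> 0" using that by auto
    with rep[OF this near(1)[OF that(2)]] show ?thesis by (simp add: f_def)
  qed
  have v0: "0 \<le> v x" for x
    unfolding v_def
  proof (rule integral_nonneg_AE)
    show "AE y in lborel. 0 \<le> f y * ?G x y"
      using posf AE_lborel_singleton[of x]
      by eventually_elim (intro mult_nonneg_nonneg log_kernel_nonneg N, use T in auto)
  qed

  obtain L where L: "0 \<le> L" "\<And>x x'. x \<in> ball 0 1 \<Longrightarrow> x' \<in> ball 0 1 \<Longrightarrow> \<bar>h x - h x'\<bar> \<le> L * dist x x'"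
  proof -
    let ?H = "\<lambda>x. LINT y|lborel. Ue y * ((1 / T) ^ m * radial Q T x y)"
    have "Ue y = 0" if "y \<notin> ball 0 1" for y using that R by (auto simp: Ue_def indicator_def)
    from lipschitz_mollified[OF U this T(1), of "(1 / T) ^ m" Q]
    obtain L1 where L1: "0 \<le> L1" "\<forall>x\<in>ball 0 1. \<forall>x'\<in>ball 0 1. \<bar>?H x - ?H x'\<bar> \<le> L1 * dist x x'" by blast
    obtain L2 where L2: "0 \<le> L2" "\<forall>x\<in>ball 0 1. \<forall>x'\<in>ball 0 1. \<forall>y\<in>ball (0::'a) 1. \<bar>radial pp T x y - radial pp T x' y\<bar> \<le> L2 * dist x x'"
      using radial_lipschitz[OF T(1)] by blast
    have "\<bar>h x - h x'\<bar> \<le> (\<bar>1 / c\<bar> * L1 + \<bar>a0 / c\<bar> * L2) * dist x x'" if x: "x \<in> ball 0 1" "x' \<in> ball 0 1" for x x'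
    proof -
      have hd: "h x - h x' = (1 / c) * (?H x - ?H x') + (a0 / c) * (radial pp T x' 0 - radial pp T x 0)"
        by (simp add: h_def algebra_simps)
      have "\<bar>h x - h x'\<bar> \<le> \<bar>1 / c\<bar> * \<bar>?H x - ?H x'\<bar> + \<bar>a0 / c\<bar> * \<bar>radial pp T x' 0 - radial pp T x 0\<bar>"
        unfolding hd abs_mult[symmetric] by (rule abs_triangle_ineq)
      also have "\<dots> \<le> \<bar>1 / c\<bar> * (L1 * dist x x') + \<bar>a0 / c\<bar> * (L2 * dist x' x)"
        using L1(2) L2(2) x by (intro add_mono mult_left_mono) auto
      finally show ?thesis by (simp add: dist_commute algebra_simps)
    qed
    then show ?thesis using that[of "\<bar>1 / c\<bar> * L1 + \<bar>a0 / c\<bar> * L2"] L1(1) L2(1) by auto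
  qed
  define Mh where "Mh = \<bar>h 0\<bar> + L"
  have hb: "\<bar>h x\<bar> \<le> Mh" if "x \<in> ball 0 1" for x
  proof -
    have "\<bar>h x - h 0\<bar> \<le> L * dist x 0" using that by (intro L) auto
    also have "\<dots> \<le> L * 1" using that L by (intro mult_left_mono) auto
    finally show ?thesis by (simp add: Mh_def)
  qed

  have "B = 0 \<and> - real DIM('a) < \<alpha>"
  proof (rule singular_part_trivial[OF \<rho>0(1) T(1)])
    fix x :: 'a assume x: "0 < norm x" "norm x < \<rho>0"
    then have "x \<in> ball 0 1" using \<rho>0 by auto
    then show "\<alpha> * ln (norm x) + (B \<bullet> x) / (norm x)\<^sup>2 * max 0 (1 - (norm x)\<^sup>2 / T) ^ N - Mh \<le> u x"
      using ueq[OF x] v0[of x] hb[of x] by (simp add: abs_le_iff)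
  next
    have "(\<integral>\<^sup>+ x. ennreal (exp (u x)) * indicator (ball 0 \<rho>0 - {0}) x \<partial>lborel) \<le> (\<integral>\<^sup>+ x. ennreal (indicator ?S x * exp (u x)) \<partial>lborel)"
      using \<rho>0 by (intro nn_integral_mono) (auto simp: indicator_def)
    also have "\<dots> < \<infinity>" using exp_int leb[of 1 "\<lambda>x. exp (u x)"] conte by simp
    finally show "(\<integral>\<^sup>+ x. ennreal (exp (u x)) * indicator (ball 0 \<rho>0 - {0}) x \<partial>lborel) < \<infinity>" .
  qed
  then have B0: "B = 0" and \<alpha>: "- real DIM('a) < \<alpha>" by auto
  have ueq': "u x = \<alpha> * ln (norm x) + (h x + v x)" if "0 < norm x" "norm x < \<rho>0" for x
    using ueq[OF that] by (simp add: B0)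

  \<comment> \<open>C' bounds K and exp Mh bounds exp h; once B = 0, the expansion of u leaves only
    the power of |y| and exp v.\<close>
  have fb: "AE y in lborel. 0 < norm y \<and> norm y < \<rho>0 \<longrightarrow> f y \<le> (C' / ((-1) ^ m * c) * exp Mh) * norm y powr \<alpha> * exp (v y)"
    using Kb
  proof eventually_elim
    case (elim y)
    show ?case
    proof
      assume y: "0 < norm y \<and> norm y < \<rho>0"
      then have yS: "y \<in> ?SR" "y \<in> ball 0 1" using R by (auto simp: \<rho>0_def)
      have C'0: "0 \<le> C'" by (simp add: C'_def)
      have "f y \<le> C' * exp (u y) / ((-1) ^ m * c)"
        unfolding fsg using elim yS c by (intro divide_right_mono) auto
      also have "\<dots> = C' / ((-1) ^ m * c) * (norm y powr \<alpha> * exp (h y) * exp (v y))"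
        using ueq'[of y] y by (simp add: powr_def exp_add mult_ac)
      also have "\<dots> \<le> C' / ((-1) ^ m * c) * (norm y powr \<alpha> * exp Mh * exp (v y))"
        using hb[OF yS(2)] C'0 c by (intro mult_left_mono mult_right_mono) (auto simp: abs_le_iff)
      finally show "f y \<le> (C' / ((-1) ^ m * c) * exp Mh) * norm y powr \<alpha> * exp (v y)" by (simp only: mult_ac)
    qed
  qed
  have C0: "0 \<le> C' / ((-1) ^ m * c) * exp Mh"
    using c by (intro mult_nonneg_nonneg divide_nonneg_pos) (auto simp: C'_def)
  from singular_potential[OF T(1) N \<rho>0(1,2) \<alpha> C0 intf posf vint fb[unfolded v_def]]
  obtain r \<gamma> K0 where r: "0 < r" "r \<le> \<rho>0" "0 < \<gamma>" "\<gamma> < 1"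
    and K0: "\<And>x. x \<in> ball 0 r \<Longrightarrow> (\<integral>\<^sup>+ y. ennreal (f y * norm (y - x) powr (- \<gamma>)) \<partial>lborel) \<le> ennreal K0"
    by blast
  obtain C4 where C4: "0 \<le> C4" "\<And>x x'. x \<in> ball 0 r \<Longrightarrow> x' \<in> ball 0 r \<Longrightarrow> \<bar>v x - v x'\<bar> \<le> C4 * dist x x' powr \<gamma>"
    using holder_potential[OF intf posf r(3) less_imp_le[OF r(4)] T(1) N K0] unfolding v_def by blast
  define \<phi> where "\<phi> x = h x + v x" for x
  \<comment> \<open>Distances at most 1 turn the Lipschitz bound on h into a Hoelder bound with
    exponent \<gamma>.\<close>
  have d1: "dist x x' \<le> 1" if "x \<in> ball 0 r" "x' \<in> ball 0 r" for x x' :: 'a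
    using that r \<rho>0 dist_triangle2[of x x' 0] by auto
  have hol: "\<bar>\<phi> x - \<phi> x'\<bar> \<le> (L + C4) * dist x x' powr \<gamma>" if x: "x \<in> ball 0 r" "x' \<in> ball 0 r" for x x'
  proof -
    have "x \<in> ball 0 1" "x' \<in> ball 0 1" using x r \<rho>0 by auto
    then have "\<bar>h x - h x'\<bar> \<le> L * dist x x'" by (rule L(2))
    also have "\<dots> \<le> L * dist x x' powr \<gamma>"
    proof (rule mult_left_mono[OF _ L(1)])
      show "dist x x' \<le> dist x x' powr \<gamma>"
        using powr_mono'[of \<gamma> 1 "dist x x'"] d1[OF x] r by simp
    qed
    finally have "\<bar>h x - h x'\<bar> \<le> L * dist x x' powr \<gamma>" .
    with C4(2)[OF x] show ?thesis unfolding \<phi>_def distrib_right by linarith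
  qed
  have "holder_on \<gamma> (ball 0 r) \<phi>"
    unfolding holder_on_def
  proof
    have "\<bar>\<phi> x\<bar> \<le> \<bar>\<phi> 0\<bar> + (L + C4)" if "x \<in> ball 0 r" for x
    proof -
      have "\<bar>\<phi> x - \<phi> 0\<bar> \<le> (L + C4) * dist x 0 powr \<gamma>" using that r by (intro hol) auto
      also have "\<dots> \<le> (L + C4) * 1"
        using d1[OF that, of 0] r L(1) C4(1) by (intro mult_left_mono powr_le1) auto
      finally show ?thesis by simp
    qed
    then show "bounded (\<phi> ` ball 0 r)" by (auto simp: bounded_iff intro!: exI[of _ "\<bar>\<phi> 0\<bar> + (L + C4)"])
    show "\<exists>C. \<forall>x\<in>ball 0 r. \<forall>y\<in>ball 0 r. \<bar>\<phi> x - \<phi> y\<bar> \<le> C * dist x y powr \<gamma>" using hol by blast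
  qed
  moreover have "u x = \<alpha> * ln (norm x) + \<phi> x" if "x \<in> ball 0 r - {0}" for x
    unfolding \<phi>_def using that r by (intro ueq') auto
  moreover have "- 2 * real m < \<alpha>" using \<alpha> dim by simp
  ultimately show ?thesis using r \<rho>0 by (intro exI[of _ \<alpha>] exI[of _ r] exI[of _ \<gamma>] exI[of _ \<phi>]) auto
qed

end
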